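(* Let $k$ be a field of characteristic zero, let $R = k[x_1,x_2,x_3,x_4,x_5]$, let $d$ be a positive integer, let $L \in R$ be a general linear form, and let $I = \langle x_1^{d}, x_2^{d}, x_3^{d}, x_4^{d}, x_5^{d}, L^{d} \rangle$. Then the ring $R/I$ fails the WLP if and only if $d > 3$.
   Context: "General linear form" means that the assertion holds for all linear forms whose coefficient vector lies in some nonempty Zariski-open subset of the space of linear forms $[R]_1$. A standard graded artinian $k$-algebra $A = R/I$ has the Weak Lefschetz Property (WLP) if, for a general linear form $\ell \in R$, the multiplication map $\times \ell : [A]_{t} \to [A]_{t+1}$ has maximal rank (i.e. is injective or surjective) for every integer $t$; otherwise $A$ fails the WLP. *)

theory Defs
  imports
    "HOL-Library.Poly_Mapping"
    "HOL-Library.Numeral_Type"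
    "HOL-Algebra.QuotRing"
    "HOL-Algebra.Algebraic_Closure_Type"
begin

text \<open>
  The polynomial ring \<open>k[x\<^sub>i | i \<in> 'n]\<close>: finitely supported functions from exponent vectors to
  coefficients, with the convolution product of \<^theory>\<open>HOL-Library.Poly_Mapping\<close>.
\<close>

type_synonym ('n, 'k) mpoly = "('n \<Rightarrow>\<^sub>0 nat) \<Rightarrow>\<^sub>0 'k"

abbreviation mpoly_ring :: "('n, 'k::field) mpoly ring" where
  "mpoly_ring \<equiv> ring_of_type_algebra"

definition Var :: "'n \<Rightarrow> ('n, 'k::field) mpoly" where
  "Var i = Poly_Mapping.single (Poly_Mapping.single i 1) 1"

definition Const :: "'k::field \<Rightarrow> ('n, 'k) mpoly" where
  "Const a = Poly_Mapping.single 0 a"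

definition total_deg :: "('n::finite \<Rightarrow>\<^sub>0 nat) \<Rightarrow> nat" where
  "total_deg m = (\<Sum>i\<in>UNIV. Poly_Mapping.lookup m i)"

definition eval_mpoly :: "('n::finite, 'k::field) mpoly \<Rightarrow> ('n \<Rightarrow> 'k) \<Rightarrow> 'k" where
  "eval_mpoly p c =
     (\<Sum>m\<in>Poly_Mapping.keys p.
        Poly_Mapping.lookup p m * (\<Prod>i\<in>UNIV. c i ^ Poly_Mapping.lookup m i))"

text \<open>The graded piece \<open>[R]\<^sub>t\<close>; it is zero for negative \<open>t\<close>.\<close>

definition graded_piece :: "int \<Rightarrow> ('n::finite, 'k::field) mpoly set" where
  "graded_piece t = {f. \<forall>m\<in>Poly_Mapping.keys f. int (total_deg m) = t}"

text \<open>The graded piece \<open>[R/I]\<^sub>t\<close>: the image of \<open>[R]\<^sub>t\<close> in the quotient ring.\<close>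

definition quot_graded_piece ::
  "('n::finite, 'k::field) mpoly set \<Rightarrow> int \<Rightarrow> ('n, 'k) mpoly set set" where
  "quot_graded_piece I t = (\<lambda>f. I +>\<^bsub>mpoly_ring\<^esub> f) ` graded_piece t"

definition linear_form :: "('n::finite \<Rightarrow> 'k::field) \<Rightarrow> ('n, 'k) mpoly" where
  "linear_form c = (\<Sum>i\<in>UNIV. Const (c i) * Var i)"

lemma lookup_linear_form:
  "Poly_Mapping.lookup (linear_form c :: ('n::finite, 'k::field) mpoly) m =
     (\<Sum>i\<in>UNIV. if m = Poly_Mapping.single i 1 then c i else 0)"
  unfolding linear_form_def Const_def Var_def
  by (auto simp: lookup_sum mult_single lookup_single when_def intro!: sum.cong)

lemma total_deg_single: "total_deg (Poly_Mapping.single (i::'n::finite) n) = n"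
  by (simp add: total_deg_def lookup_single when_def)

lemma total_deg_eq_1:
  assumes "total_deg (m :: 'n::finite \<Rightarrow>\<^sub>0 nat) = 1"
  shows "\<exists>i. m = Poly_Mapping.single i 1"
proof -
  obtain i where i: "Poly_Mapping.lookup m i = 1" "\<forall>j\<in>UNIV. i \<noteq> j \<longrightarrow> Poly_Mapping.lookup m j = 0"
    using assms sum_eq_1_iff[of UNIV "Poly_Mapping.lookup m"] unfolding total_deg_def by auto
  then have "m = Poly_Mapping.single i 1"
    by (intro poly_mapping_eqI) (auto simp: lookup_single when_def)
  then show ?thesis ..
qed

lemma single_eq_iff: "Poly_Mapping.single i (1::nat) = Poly_Mapping.single j 1 \<longleftrightarrow> i = j"
proof
  assume *: "Poly_Mapping.single i (1::nat) = Poly_Mapping.single j 1"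
  have "Poly_Mapping.lookup (Poly_Mapping.single i (1::nat)) i = 1" by simp
  then have "Poly_Mapping.lookup (Poly_Mapping.single j (1::nat)) i = 1" by (simp only: *)
  then show "i = j" by (simp add: lookup_single when_def split: if_splits)
qed simp

lemma lookup_linear_form_single:
  "Poly_Mapping.lookup (linear_form c :: ('n::finite, 'k::field) mpoly) (Poly_Mapping.single i 1) = c i"
  unfolding lookup_linear_form single_eq_iff by simp

lemma bij_betw_linear_form:
  "bij_betw linear_form UNIV (graded_piece 1 :: ('n::finite, 'k::field) mpoly set)"
proof (rule bij_betw_imageI)
  show "inj (linear_form :: _ \<Rightarrow> ('n, 'k) mpoly)"
  proof (intro injI ext)
    fix c c' :: "'n \<Rightarrow> 'k" and i
    assume "(linear_form c :: ('n, 'k) mpoly) = linear_form c'"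
    then show "c i = c' i"
      using lookup_linear_form_single[of c i] lookup_linear_form_single[of c' i] by simp
  qed
  show "range linear_form = (graded_piece 1 :: ('n, 'k) mpoly set)"
  proof (intro equalityI subsetI)
    fix f :: "('n, 'k) mpoly" assume "f \<in> range linear_form"
    then obtain c where f: "f = linear_form c" by blast
    show "f \<in> graded_piece 1"
      unfolding graded_piece_def
    proof (intro CollectI ballI)
      fix m assume "m \<in> Poly_Mapping.keys f"
      then have "Poly_Mapping.lookup f m \<noteq> 0" by (simp add: in_keys_iff)
      then obtain i where "m = Poly_Mapping.single i 1"
        unfolding f lookup_linear_form by (auto elim!: sum.not_neutral_contains_not_neutral split: if_splits)
      then show "int (total_deg m) = 1" by (simp add: total_deg_single)
    qed
  next
    fix f :: "('n, 'k) mpoly" assume f: "f \<in> graded_piece 1"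
    have "f = linear_form (\<lambda>i. Poly_Mapping.lookup f (Poly_Mapping.single i 1))" (is "_ = ?g")
    proof (rule poly_mapping_eqI)
      fix m
      show "Poly_Mapping.lookup f m = Poly_Mapping.lookup ?g m"
      proof (cases "\<exists>i. m = Poly_Mapping.single i 1")
        case True
        then obtain i where m: "m = Poly_Mapping.single i 1" ..
        show ?thesis unfolding m lookup_linear_form_single ..
      next
        case False
        then have "m \<notin> Poly_Mapping.keys f"
          using f total_deg_eq_1 unfolding graded_piece_def by fastforce
        moreover have "Poly_Mapping.lookup ?g m = 0"
          unfolding lookup_linear_form using False by (intro sum.neutral) auto
        ultimately show ?thesis by (simp add: in_keys_iff)
      qed
    qed
    then show "f \<in> range linear_form" by blast
  qed
qed

text \<open>
  By the preceding bijection, linear forms are parametrised by coefficient vectors in \<open>k\<^sup>n\<close>; the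
  Zariski topology on \<open>[R]\<^sub>1\<close> is the one of this affine space.
\<close>

definition zariski_open :: "('n::finite \<Rightarrow> 'k::field) set \<Rightarrow> bool" where
  "zariski_open U \<longleftrightarrow>
     (\<exists>S :: ('n, 'k) mpoly set. U = - {c. \<forall>p\<in>S. eval_mpoly p c = 0})"

definition for_general_linear_form ::
  "(('n::finite, 'k::field) mpoly \<Rightarrow> bool) \<Rightarrow> bool" where
  "for_general_linear_form P \<longleftrightarrow>
     (\<exists>U :: ('n \<Rightarrow> 'k) set. zariski_open U \<and> U \<noteq> {} \<and> (\<forall>c\<in>U. P (linear_form c)))"

definition maximal_rank :: "('a \<Rightarrow> 'b) \<Rightarrow> 'a set \<Rightarrow> 'b set \<Rightarrow> bool" where
  "maximal_rank h A B \<longleftrightarrow> inj_on h A \<or> h ` A = B"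

text \<open>
  The weak Lefschetz property of \<open>R/I\<close>, intended for homogeneous ideals \<open>I\<close> with \<open>R/I\<close> artinian.
\<close>

definition WLP :: "('n::finite, 'k::field) mpoly set \<Rightarrow> bool" where
  "WLP I \<longleftrightarrow>
     for_general_linear_form (\<lambda>l. \<forall>t::int.
       maximal_rank (\<lambda>a. (I +>\<^bsub>mpoly_ring\<^esub> l) \<otimes>\<^bsub>mpoly_ring Quot I\<^esub> a)
         (quot_graded_piece I t) (quot_graded_piece I (t + 1)))"

end

theory Submission
  imports Defs
begin

text \<open>
  Write \<open>L = \<Sum>i. a\<^sub>i x\<^sub>i\<close>, let \<open>ell = \<Sum>i. c\<^sub>i x\<^sub>i\<close> be the general linear form of the weak Lefschetz property, and
  put \<open>z\<^sub>i = c\<^sub>i x\<^sub>i\<close>, \<open>s\<^sub>i = a\<^sub>i / c\<^sub>i\<close>, so that \<open>ell = \<Sum>i. z\<^sub>i\<close> and \<open>L = \<Sum>i. s\<^sub>i z\<^sub>i\<close>. The interpolation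
  polynomial \<open>\<Sum>i. z\<^sub>i \<Prod>j\<noteq>i. (s - s\<^sub>j)\<close> in one new variable \<open>s\<close> has top coefficient \<open>ell\<close>. Modulo \<open>ell\<close> it
  is therefore a cubic \<open>P(s)\<close>; its leading coefficient is \<open>L\<close> and its value at \<open>s\<^sub>i\<close> is a nonzero multiple of
  \<open>z\<^sub>i\<close>. In other words, the six linear forms \<open>x\<^sub>1, \<dots>, x\<^sub>5, L\<close> restricted to the hyperplane \<open>ell = 0\<close> are
  six points of a twisted cubic, and \<open>L\<close> is the one at \<open>s = \<infinity>\<close>. What happens in \<open>R/(I, ell)\<close> is then read off
  by counting zeros of polynomials in \<open>s\<close>: if a polynomial with coefficients in a ring has, modulo an ideal \<open>J\<close>,
  more zeros than its degree allows, then all its coefficients lie in \<open>J\<close>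
  (\<open>too_many_zeros_mod_ideal\<close>). Modulo \<open>d\<close>-th powers of its six special values, \<open>P\<^sup>N\<close> vanishes to
  order \<open>N + 1 - d\<close> at each of the six points.

  Let \<open>d > 3\<close>, and consider the multiplication by \<open>ell\<close> from degree \<open>2 d - 2\<close> to degree \<open>2 d - 1\<close>. The
  polynomial \<open>P\<^sup>2\<^sup>d\<^sup>-\<^sup>1\<close> has degree \<open>6 d - 3\<close>, and modulo \<open>(x\<^sub>i\<^sup>d, L\<^sup>d\<^sup>+\<^sup>1, ell)\<close> it still has
  \<open>5 d + (d - 1)\<close> zeros, too many by two. So its coefficients lie in that ideal, and one of them is,
  up to multiples of \<open>L\<^sup>d\<^sup>+\<^sup>1\<close> and \<open>ell\<close>, a nonzero scalar times \<open>L\<^sup>d M\<^sup>d\<^sup>-\<^sup>1\<close> for a linear form \<open>M\<close> independent of \<open>L\<close> and \<open>ell\<close> (\<open>syzygy\<close>). In the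
  resulting relation between the six \<open>d\<close>-th powers modulo \<open>ell\<close>, the cofactor \<open>f\<close> of \<open>ell\<close> is killed by \<open>ell\<close> in
  \<open>R/I\<close>. It is not zero there, since otherwise there would be a relation between the \<open>d\<close>-th powers
  themselves with cofactors of degree \<open>d - 1\<close>, which the strong Lefschetz property of \<open>R/(x\<^sub>i\<^sup>d)\<close>
  excludes (\<open>strong_lefschetz_powers\<close>, \<open>not_injective\<close>). The same relation makes one of the
  \<open>6 (d+2 choose 3)\<close> obvious generators of the degree \<open>2 d - 1\<close> part of \<open>(I, ell)/(ell)\<close> redundant, and
  \<open>6 (d+2 choose 3)\<close> is at most \<open>(2d+2 choose 3)\<close>, the dimension of the degree \<open>2 d - 1\<close> part of \<open>R/(ell)\<close>.
  So the multiplication is not surjective either (\<open>not_surjective\<close>).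

  Let \<open>d \<le> 3\<close>. Repeated counting of zeros shows that all products of \<open>2 d - 1\<close> linear forms lie in \<open>(I, ell)\<close>,
  which gives surjectivity from degree \<open>2 d - 2\<close> on (\<open>surjective_small\<close>). In lower degrees, let \<open>f\<close> be killed
  by \<open>ell\<close>, that is, \<open>ell f - L\<^sup>d h\<close> lies in \<open>(x\<^sub>i\<^sup>d)\<close> for some \<open>h\<close> of degree at most one. Polarization shows that
  \<open>ell\<close> divides \<open>h\<close>, and the Lefschetz property, now for \<open>ell\<close> itself, that \<open>f\<close> is zero in \<open>R/I\<close>
  (\<open>injective_small\<close>).
\<close>

section \<open>Zeros of a polynomial modulo an ideal\<close>

text \<open>
  The ideals of a commutative ring are its submodules as a module over itself, so that \<open>idl.span\<close> is the
  generated ideal. As a rewrite rule, \<open>scale_scale\<close> is associativity from right to left and loops with the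
  usual direction.
\<close>

interpretation idl: Modules.module "(*) :: 'a::comm_ring_1 \<Rightarrow> 'a \<Rightarrow> 'a"
  by unfold_locales (auto simp: algebra_simps)

declare idl.scale_scale [simp del]

abbreviation is_ideal :: "'a::comm_ring_1 set \<Rightarrow> bool" where
  "is_ideal \<equiv> idl.subspace"

lemma is_ideal_mult_right: "is_ideal J \<Longrightarrow> x \<in> J \<Longrightarrow> x * y \<in> J"
  using idl.subspace_scale[of J x y] by (simp add: mult.commute)

lemma is_ideal_unit_cancel:
  assumes "is_ideal J" "u dvd 1" "u * x \<in> J"
  shows "x \<in> J"
proof -
  obtain v where v: "1 = u * v" using assms(2) by (auto simp: dvd_def)
  have "x = v * (u * x)" using v by (metis mult.assoc mult.commute mult_1)
  then show ?thesis using idl.subspace_scale[OF assms(1,3)] by metis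
qed

definition coeffs_in :: "'a::comm_ring_1 set \<Rightarrow> 'a poly \<Rightarrow> bool" where
  "coeffs_in J F \<longleftrightarrow> (\<forall>n. coeff F n \<in> J)"

lemma is_ideal_coeffs_in:
  assumes "is_ideal J"
  shows "is_ideal {F. coeffs_in J F}"
proof (rule idl.subspaceI)
  show "0 \<in> {F. coeffs_in J F}" using idl.subspace_0[OF assms] by (simp add: coeffs_in_def)
  show "F + G \<in> {F. coeffs_in J F}" if "F \<in> {F. coeffs_in J F}" "G \<in> {F. coeffs_in J F}" for F G
    using that idl.subspace_add[OF assms] by (simp add: coeffs_in_def)
  show "C * F \<in> {F. coeffs_in J F}" if "F \<in> {F. coeffs_in J F}" for C F
    using that
    by (auto simp: coeffs_in_def coeff_mult intro!: idl.subspace_sum[OF assms] idl.subspace_scale[OF assms])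
qed

lemma coeffs_in_add: "is_ideal J \<Longrightarrow> coeffs_in J F \<Longrightarrow> coeffs_in J G \<Longrightarrow> coeffs_in J (F + G)"
  and coeffs_in_diff: "is_ideal J \<Longrightarrow> coeffs_in J F \<Longrightarrow> coeffs_in J G \<Longrightarrow> coeffs_in J (F - G)"
  and coeffs_in_mult_left: "is_ideal J \<Longrightarrow> coeffs_in J F \<Longrightarrow> coeffs_in J (C * F)"
  and coeffs_in_mult_right: "is_ideal J \<Longrightarrow> coeffs_in J F \<Longrightarrow> coeffs_in J (F * C)"
  and coeffs_in_0: "is_ideal J \<Longrightarrow> coeffs_in J 0"
  using idl.subspace_add[OF is_ideal_coeffs_in] idl.subspace_diff[OF is_ideal_coeffs_in]
    idl.subspace_scale[OF is_ideal_coeffs_in] is_ideal_mult_right[OF is_ideal_coeffs_in]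
    idl.subspace_0[OF is_ideal_coeffs_in]
  by (metis mem_Collect_eq)+

lemma coeffs_in_const: "is_ideal J \<Longrightarrow> c \<in> J \<Longrightarrow> coeffs_in J [:c:]"
  by (auto simp: coeffs_in_def coeff_pCons idl.subspace_0 split: nat.splits)

lemma poly_in_ideal:
  assumes "is_ideal J" "coeffs_in J F"
  shows "poly F a \<in> J"
  unfolding poly_altdef
  by (intro idl.subspace_sum[OF assms(1)] is_ideal_mult_right[OF assms(1)])
     (use assms(2) in \<open>auto simp: coeffs_in_def\<close>)

lemma pderiv_in_ideal:
  fixes F :: "'a::idom poly"
  assumes "is_ideal J" "coeffs_in J F"
  shows "coeffs_in J (pderiv F)"
  using assms idl.subspace_scale[OF assms(1)] by (auto simp: coeffs_in_def coeff_pderiv)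

text \<open>
  Working downwards from the degree of \<open>V\<close>: the coefficient of \<open>M * V\<close> at \<open>degree M + n\<close> is the one of
  \<open>V\<close> at \<open>n\<close> plus multiples of higher ones.
\<close>

lemma cancel_monic_mod_ideal:
  fixes M V :: "'a::comm_ring_1 poly"
  assumes J: "is_ideal J" and monic: "lead_coeff M = 1"
    and MV: "\<And>n. n \<ge> degree M + r \<Longrightarrow> coeff (M * V) n \<in> J"
    and "n \<ge> r"
  shows "coeff V n \<in> J"
proof -
  have "\<forall>n\<ge>r. n + k > degree V \<longrightarrow> coeff V n \<in> J" for k
  proof (induction k)
    case 0
    then show ?case using idl.subspace_0[OF J] by (auto simp: coeff_eq_0)
  next
    case (Suc k)
    show ?case
    proof (intro allI impI)
      fix n assume n: "n \<ge> r" "n + Suc k > degree V"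
      let ?D = "degree M"
      have "coeff (M * V) (?D + n) = (\<Sum>i\<le>?D + n. coeff M i * coeff V (?D + n - i))"
        by (simp add: coeff_mult)
      also have "\<dots> = (\<Sum>i\<in>{..?D}. coeff M i * coeff V (?D + n - i))"
        by (rule sum.mono_neutral_right) (auto simp: coeff_eq_0)
      also have "\<dots> = (\<Sum>i<?D. coeff M i * coeff V (?D + n - i)) + coeff V n"
        using monic by (simp add: lessThan_Suc_atMost[symmetric])
      finally have eq: "coeff V n = coeff (M * V) (?D + n) - (\<Sum>i<?D. coeff M i * coeff V (?D + n - i))"
        by simp
      have "(\<Sum>i<?D. coeff M i * coeff V (?D + n - i)) \<in> J"
        by (intro idl.subspace_sum[OF J] idl.subspace_scale[OF J]) (use Suc.IH n in auto)
      then show "coeff V n \<in> J"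
        unfolding eq using MV[of "?D + n"] n idl.subspace_diff[OF J] by auto
    qed
  qed
  from this[of "Suc (degree V)"] \<open>n \<ge> r\<close> show ?thesis by auto
qed

text \<open>
  Order of vanishing is defined by divisibility and not by derivatives, because for general \<open>m\<close> the latter
  would need division by factorials.
\<close>

definition vanishes_mod :: "'a::comm_ring_1 set \<Rightarrow> 'a \<Rightarrow> nat \<Rightarrow> 'a poly \<Rightarrow> bool" where
  "vanishes_mod J a m F \<longleftrightarrow> (\<exists>V. coeffs_in J (F - [:-a, 1:] ^ m * V))"

lemma split_at_point:
  fixes F :: "'a::comm_ring_1 poly"
  obtains G where "F = [:poly F a:] + [:-a, 1:] * G"
  using synthetic_div_correct'[of a F] by (metis add.commute)

lemma vanishes_mod_0: "is_ideal J \<Longrightarrow> vanishes_mod J a 0 F"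
  unfolding vanishes_mod_def by (rule exI[of _ F]) (simp add: coeffs_in_0)

lemma vanishes_mod_coeffs_in: "is_ideal J \<Longrightarrow> coeffs_in J F \<Longrightarrow> vanishes_mod J a m F"
  unfolding vanishes_mod_def by (rule exI[of _ 0]) simp

lemma vanishes_mod_1:
  assumes "is_ideal J" "poly F a \<in> J"
  shows "vanishes_mod J a 1 F"
proof -
  obtain G where G: "F = [:poly F a:] + [:-a, 1:] * G" by (rule split_at_point)
  have "F - [:-a, 1:] ^ 1 * G = [:poly F a:]" using G by (simp add: algebra_simps)
  then show ?thesis unfolding vanishes_mod_def
    using coeffs_in_const[OF assms] by metis
qed

lemma quadratic_remainder:
  fixes x :: "'b::comm_ring_1"
  assumes "f = c + x * g" and "g = b + x * h"
  shows "f - x\<^sup>2 * h = c + x * b"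
proof -
  have "f = c + x * (b + x * h)" using assms by simp
  also have "\<dots> - x\<^sup>2 * h = c + x * b"
    by (simp add: power2_eq_square ring_distribs mult.assoc)
  finally show ?thesis .
qed

lemma vanishes_mod_2:
  fixes F :: "'a::idom poly"
  assumes J: "is_ideal J" and "poly F a \<in> J" "poly (pderiv F) a \<in> J"
  shows "vanishes_mod J a 2 F"
proof -
  obtain G where G: "F = [:poly F a:] + [:-a, 1:] * G" by (rule split_at_point)
  obtain H where H: "G = [:poly G a:] + [:-a, 1:] * H" by (rule split_at_point)
  have "pderiv F = G + [:-a, 1:] * pderiv G"
    by (subst G) (simp add: pderiv_add pderiv_diff pderiv_smult pderiv_pCons)
  then have "poly G a \<in> J" using assms(3) by simp
  then have "coeffs_in J ([:poly F a:] + [:-a, 1:] * [:poly G a:])"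
    using coeffs_in_add[OF J coeffs_in_const[OF J assms(2)] coeffs_in_mult_left[OF J coeffs_in_const[OF J]]]
    by blast
  then have "coeffs_in J (F - [:-a, 1:] ^ 2 * H)" unfolding quadratic_remainder[OF G H] .
  then show ?thesis unfolding vanishes_mod_def by blast
qed

lemma vanishes_mod_add:
  assumes "is_ideal J" "vanishes_mod J a m F" "vanishes_mod J a m G"
  shows "vanishes_mod J a m (F + G)"
proof -
  from assms obtain U V where "coeffs_in J (F - [:-a, 1:] ^ m * U)" "coeffs_in J (G - [:-a, 1:] ^ m * V)"
    by (auto simp: vanishes_mod_def)
  from coeffs_in_add[OF assms(1) this] show ?thesis
    unfolding vanishes_mod_def by (intro exI[of _ "U + V"]) (simp add: algebra_simps)
qed

lemma vanishes_mod_mult: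
  assumes "is_ideal J" "vanishes_mod J a m F"
  shows "vanishes_mod J a m (G * F)"
proof -
  from assms obtain U where "coeffs_in J (F - [:-a, 1:] ^ m * U)" by (auto simp: vanishes_mod_def)
  from coeffs_in_mult_left[OF assms(1) this, of G] show ?thesis
    unfolding vanishes_mod_def by (intro exI[of _ "G * U"]) (simp add: algebra_simps)
qed

lemma vanishes_mod_linear_mult:
  assumes "is_ideal J" "vanishes_mod J a m F"
  shows "vanishes_mod J a (Suc m) ([:-a, 1:] * F)"
proof -
  from assms obtain U where "coeffs_in J (F - [:-a, 1:] ^ m * U)" by (auto simp: vanishes_mod_def)
  from coeffs_in_mult_left[OF assms(1) this, of "[:-a, 1:]"] show ?thesis
    unfolding vanishes_mod_def by (intro exI[of _ U]) (simp only: right_diff_distrib power_Suc mult.assoc)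
qed

lemma cancel_linear_mod_ideal:
  assumes J: "is_ideal J" and "coeffs_in J ([:-a, 1:] * Y)"
  shows "coeffs_in J Y"
  unfolding coeffs_in_def
proof
  fix n
  show "coeff Y n \<in> J"
    by (rule cancel_monic_mod_ideal[OF J, of "[:-a, 1:]" 0 Y n])
       (use assms(2) in \<open>simp_all only: coeffs_in_def, simp_all\<close>)
qed

lemma remainder_after_constant:
  fixes g :: "'b::comm_ring_1"
  assumes "v = c + x * w"
  shows "g * v - (x * y) * u - g * c = x * (g * w - y * u)"
  unfolding assms by (simp add: algebra_simps)

text \<open>
  One factor at a time: evaluation at \<open>a\<close> gives \<open>poly G a * poly V a \<in> J\<close>, and the unit can be removed.
\<close>

lemma vanishes_mod_cancel:
  assumes J: "is_ideal J" and u: "poly G a dvd 1" and "vanishes_mod J a m (G * V)"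
  shows "vanishes_mod J a m V"
  using assms(3)
proof (induction m arbitrary: V)
  case 0
  then show ?case using J by (simp add: vanishes_mod_0)
next
  case (Suc m)
  then obtain U where U: "coeffs_in J (G * V - [:-a, 1:] ^ Suc m * U)" by (auto simp: vanishes_mod_def)
  have "poly G a * poly V a \<in> J" using poly_in_ideal[OF J U, of a] by simp
  then have Va: "poly V a \<in> J" using is_ideal_unit_cancel[OF J u] by simp
  obtain W where W: "V = [:poly V a:] + [:-a, 1:] * W" by (rule split_at_point)
  have "coeffs_in J (G * V - [:-a, 1:] ^ Suc m * U - G * [:poly V a:])"
    by (intro coeffs_in_diff U J coeffs_in_mult_left coeffs_in_const Va)
  moreover have "G * V - [:-a, 1:] ^ Suc m * U - G * [:poly V a:] = [:-a, 1:] * (G * W - [:-a, 1:] ^ m * U)"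
    unfolding power_Suc by (rule remainder_after_constant[OF W])
  ultimately have "coeffs_in J ([:-a, 1:] * (G * W - [:-a, 1:] ^ m * U))" by (simp only:)
  then have "coeffs_in J (G * W - [:-a, 1:] ^ m * U)" by (rule cancel_linear_mod_ideal[OF J])
  then have "vanishes_mod J a m W" using Suc.IH by (auto simp: vanishes_mod_def)
  then have "vanishes_mod J a (Suc m) ([:poly V a:] + [:-a, 1:] * W)"
    by (rule vanishes_mod_add[OF J vanishes_mod_coeffs_in[OF J coeffs_in_const[OF J Va]]
        vanishes_mod_linear_mult[OF J]])
  then show ?case by (simp only: W[symmetric])
qed

lemma unit_prod: "(\<And>x. x \<in> A \<Longrightarrow> f x dvd (1::'a::comm_ring_1)) \<Longrightarrow> prod f A dvd 1"
proof (induction A rule: infinite_finite_induct)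
  case (insert x F)
  then show ?case using mult_dvd_mono[of "f x" 1 "prod f F" 1] by simp
qed auto

lemma monic_mult:
  fixes p q :: "'a::comm_ring_1 poly"
  assumes "lead_coeff p = 1" "lead_coeff q = 1"
  shows "degree (p * q) = degree p + degree q" "lead_coeff (p * q) = 1"
proof -
  have c: "coeff (p * q) (degree p + degree q) = 1"
    using assms by (simp add: coeff_mult_degree_sum)
  show "degree (p * q) = degree p + degree q"
    using c by (intro antisym degree_mult_le le_degree) simp
  with c show "lead_coeff (p * q) = 1" by simp
qed

lemma monic_prod_linear:
  fixes e :: "'a::comm_ring_1 \<Rightarrow> nat"
  assumes "finite A"
  shows "degree (\<Prod>a\<in>A. [:-a, 1:] ^ e a) = sum e A" "lead_coeff (\<Prod>a\<in>A. [:-a, 1:] ^ e a) = 1"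
proof -
  have pw: "degree ([:-a, 1:] ^ n) = n \<and> lead_coeff ([:-a, 1:] ^ n) = 1" for a :: 'a and n
  proof (induction n)
    case (Suc n)
    have "lead_coeff [:-a, 1:] = 1" "degree [:-a, 1:] = 1" by simp_all
    with monic_mult[of "[:-a, 1:]" "[:-a, 1:] ^ n"] Suc show ?case unfolding power_Suc by (metis plus_1_eq_Suc)
  qed simp
  have "degree (\<Prod>a\<in>A. [:-a, 1:] ^ e a) = sum e A \<and> lead_coeff (\<Prod>a\<in>A. [:-a, 1:] ^ e a) = 1"
    using assms
  proof (induction A)
    case (insert x F)
    then have IH: "degree (\<Prod>a\<in>F. [:-a, 1:] ^ e a) = sum e F" "lead_coeff (\<Prod>a\<in>F. [:-a, 1:] ^ e a) = 1"
      by blast+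
    note m = monic_mult[OF conjunct2[OF pw[of x "e x"]] IH(2)]
    show ?case
      unfolding prod.insert[OF insert(1,2)] sum.insert[OF insert(1,2)]
      using m(2) unfolding m(1) IH(1) conjunct1[OF pw[of x "e x"]] by (intro conjI refl)
  qed simp
  then show "degree (\<Prod>a\<in>A. [:-a, 1:] ^ e a) = sum e A" "lead_coeff (\<Prod>a\<in>A. [:-a, 1:] ^ e a) = 1"
    by blast+
qed

text \<open>
  Over a field this is the bound for the number of zeros. Modulo an ideal, the factors \<open>s - a\<close> can still be
  split off one after the other, as the differences of the points are units; what remains is a multiple of
  a monic polynomial of degree \<open>sum e A\<close>, and such a multiple cannot have small degree modulo \<open>J\<close> unless it
  vanishes modulo \<open>J\<close>.
\<close>

theorem too_many_zeros_mod_ideal: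
  fixes F :: "'a::comm_ring_1 poly"
  assumes J: "is_ideal J" and A: "finite A"
    and apart: "\<And>a b. a \<in> A \<Longrightarrow> b \<in> A \<Longrightarrow> a \<noteq> b \<Longrightarrow> a - b dvd 1"
    and zeros: "\<And>a. a \<in> A \<Longrightarrow> vanishes_mod J a (e a) F"
    and top: "\<And>n. n \<ge> sum e A \<Longrightarrow> coeff F n \<in> J"
  shows "coeffs_in J F"
proof -
  have "\<exists>V. coeffs_in J (F - (\<Prod>a\<in>B. [:-a, 1:] ^ e a) * V)" if "B \<subseteq> A" for B
    using finite_subset[OF that A] that
  proof (induction B)
    case empty
    show ?case by (rule exI[of _ F]) (simp add: coeffs_in_0 J)
  next
    case (insert b B)
    then obtain V where V: "coeffs_in J (F - (\<Prod>a\<in>B. [:-a, 1:] ^ e a) * V)" by auto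
    let ?Q = "\<Prod>a\<in>B. [:-a, 1:] ^ e a"
    have "vanishes_mod J b (e b) (F + - (F - ?Q * V))"
      by (rule vanishes_mod_add[OF J zeros vanishes_mod_coeffs_in[OF J]])
         (use insert coeffs_in_mult_left[OF J V, of "-1"] in \<open>simp_all only: mult_minus1 insert_subset\<close>)
    then have "vanishes_mod J b (e b) (?Q * V)" by simp
    moreover have "poly ?Q b dvd 1"
    proof -
      have "poly ?Q b = (\<Prod>a\<in>B. (b - a) ^ e a)" by (simp add: poly_prod poly_power)
      moreover have "(b - a) ^ e a dvd 1" if "a \<in> B" for a
        using dvd_power_same[OF apart[of b a], of "e a"] insert that by auto
      ultimately show ?thesis by (simp add: unit_prod)
    qed
    ultimately have "vanishes_mod J b (e b) V" using vanishes_mod_cancel[OF J] by blast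
    then obtain U where U: "coeffs_in J (V - [:-b, 1:] ^ e b * U)" unfolding vanishes_mod_def by blast
    have "f - (p * q) * u = (f - q * v) + q * (v - p * u)" for f p q u v :: "'a poly"
      by (simp add: algebra_simps)
    then have "F - (\<Prod>a\<in>insert b B. [:-a, 1:] ^ e a) * U = (F - ?Q * V) + ?Q * (V - [:-b, 1:] ^ e b * U)"
      unfolding prod.insert[OF insert(1,2)] .
    then show ?case using coeffs_in_add[OF J V coeffs_in_mult_left[OF J U, of ?Q]] by metis
  qed
  then obtain V where V: "coeffs_in J (F - (\<Prod>a\<in>A. [:-a, 1:] ^ e a) * V)" by blast
  let ?Q = "\<Prod>a\<in>A. [:-a, 1:] ^ e a"
  have QV: "coeff (?Q * V) n \<in> J" if "n \<ge> degree ?Q + 0" for n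
  proof -
    have "coeff F n - coeff (F - ?Q * V) n \<in> J"
      using that top[of n] V monic_prod_linear(1)[OF A, of e]
      by (intro idl.subspace_diff[OF J]) (simp_all only: coeffs_in_def add_0_right)
    then show ?thesis by (simp only: coeff_diff diff_diff_eq2 add_diff_cancel_left')
  qed
  have "coeffs_in J V"
    unfolding coeffs_in_def using cancel_monic_mod_ideal[OF J monic_prod_linear(2)[OF A] QV] by blast
  from coeffs_in_add[OF J V coeffs_in_mult_left[OF J this, of ?Q]] show ?thesis by simp
qed

section \<open>Powers of a cubic modulo an ideal\<close>

lemma coeff_mult_cubic:
  fixes P F :: "'a::comm_ring_1 poly"
  assumes "degree P \<le> 3"
  shows "coeff (P * F) (n + 3) =
    coeff P 3 * coeff F n + coeff P 2 * coeff F (n + 1) + coeff P 1 * coeff F (n + 2) + coeff P 0 * coeff F (n + 3)"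
proof -
  have "coeff (P * F) (n + 3) = (\<Sum>i\<le>n + 3. coeff P i * coeff F (n + 3 - i))"
    by (simp add: coeff_mult)
  also have "\<dots> = (\<Sum>i\<in>{0, 1, 2, 3}. coeff P i * coeff F (n + 3 - i))"
  proof (rule sum.mono_neutral_right)
    show "\<forall>i\<in>{..n + 3} - {0, 1, 2, 3}. coeff P i * coeff F (n + 3 - i) = 0"
    proof
      fix i assume "i \<in> {..n + 3} - {0, 1, 2, 3}"
      then have "i > 3" by auto
      then have "coeff P i = 0" using assms by (intro coeff_eq_0) simp
      then show "coeff P i * coeff F (n + 3 - i) = 0" by simp
    qed
  qed auto
  also have "\<dots> = coeff P 3 * coeff F n + coeff P 2 * coeff F (n + 1) + coeff P 1 * coeff F (n + 2) + coeff P 0 * coeff F (n + 3)"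
    by (simp add: algebra_simps eval_nat_numeral)
  finally show ?thesis .
qed

text \<open>
  The behaviour of \<open>P\<^sup>N\<close> at infinity: to form \<open>s\<^sup>2\<^sup>N\<^sup>+\<^sup>j\<close>, the top coefficient must be used at least \<open>j\<close>
  times, and if it is used exactly \<open>j\<close> times, all other factors contribute their quadratic terms.
\<close>

lemma coeff_cubic_power:
  fixes P :: "'a::comm_ring_1 poly"
  assumes P: "degree P \<le> 3"
  shows "\<exists>r. coeff (P ^ N) (2 * N + j) =
    of_nat (N choose j) * coeff P 3 ^ j * coeff P 2 ^ (N - j) + coeff P 3 ^ Suc j * r"
proof (induction N arbitrary: j)
  case 0
  show ?case by (rule exI[of _ 0]) (auto simp: binomial_eq_0)
next
  case (Suc N)
  let ?x = "coeff P 3" and ?y = "coeff P 2"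
  obtain r1 where r1: "coeff (P ^ N) (2 * N + j) = of_nat (N choose j) * ?x ^ j * ?y ^ (N - j) + ?x ^ Suc j * r1"
    using Suc by blast
  obtain r2 where r2: "coeff (P ^ N) (2 * N + Suc j) = of_nat (N choose Suc j) * ?x ^ Suc j * ?y ^ (N - Suc j) + ?x ^ Suc (Suc j) * r2"
    using Suc by blast
  obtain r3 where r3: "coeff (P ^ N) (2 * N + Suc (Suc j)) =
      of_nat (N choose Suc (Suc j)) * ?x ^ Suc (Suc j) * ?y ^ (N - Suc (Suc j)) + ?x ^ Suc (Suc (Suc j)) * r3"
    using Suc by blast
  define s2 where "s2 = of_nat (N choose Suc j) * ?y ^ (N - Suc j) + ?x * r2"
  define s3 where "s3 = of_nat (N choose Suc (Suc j)) * ?x * ?y ^ (N - Suc (Suc j)) + ?x * ?x * r3"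
  have s2: "coeff (P ^ N) (2 * N + Suc j) = ?x ^ Suc j * s2"
    unfolding r2 s2_def by (simp add: algebra_simps)
  have s3: "coeff (P ^ N) (2 * N + Suc (Suc j)) = ?x ^ Suc j * s3"
    unfolding r3 s3_def by (simp add: algebra_simps)
  have top: "\<exists>r0. ?x * coeff (P ^ N) (2 * N + j - 1) =
      (if j = 0 then 0 else of_nat (N choose (j - 1)) * ?x ^ j * ?y ^ (Suc N - j)) + ?x ^ Suc j * r0" if "2 * N + j \<ge> 1"
  proof (cases j)
    case 0
    show ?thesis using 0 by (intro exI[of _ "coeff (P ^ N) (2 * N - 1)"]) simp
  next
    case (Suc i)
    obtain r0 where r0: "coeff (P ^ N) (2 * N + i) = of_nat (N choose i) * ?x ^ i * ?y ^ (N - i) + ?x ^ Suc i * r0"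
      using Suc.IH by blast
    show ?thesis using Suc r0 by (intro exI[of _ r0]) (simp add: algebra_simps)
  qed
  have bin: "of_nat (Suc N choose j) * ?x ^ j * ?y ^ (Suc N - j) =
      (if j = 0 then 0 else of_nat (N choose (j - 1)) * ?x ^ j * ?y ^ (Suc N - j))
      + ?y * (of_nat (N choose j) * ?x ^ j * ?y ^ (N - j))"
  proof (cases j)
    case (Suc i)
    show ?thesis
    proof (cases "j \<le> N")
      case True
      then have "?y * ?y ^ (N - j) = ?y ^ (Suc N - j)" by (simp add: Suc_diff_le)
      then have "?y * (of_nat (N choose j) * ?x ^ j * ?y ^ (N - j)) = of_nat (N choose j) * ?x ^ j * ?y ^ (Suc N - j)"
        by (subst mult.left_commute) (simp only:)
      then show ?thesis using Suc by (simp add: distrib_right)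
    next
      case False
      then show ?thesis using Suc by (simp add: binomial_eq_0)
    qed
  qed simp
  show ?case
  proof (cases "2 * N + j = 0")
    case True
    then show ?thesis by (intro exI[of _ 0]) simp
  next
    case False
    then obtain r0 where r0: "?x * coeff (P ^ N) (2 * N + j - 1) =
      (if j = 0 then 0 else of_nat (N choose (j - 1)) * ?x ^ j * ?y ^ (Suc N - j)) + ?x ^ Suc j * r0"
      using top by auto
    have e: "2 * Suc N + j = (2 * N + j - 1) + 3" "2 * N + j - 1 + 1 = 2 * N + j"
      "2 * N + j - 1 + 2 = 2 * N + Suc j" "2 * N + j - 1 + 3 = 2 * N + Suc (Suc j)"
      using False by auto
    have "coeff (P ^ Suc N) (2 * Suc N + j) =
      ?x * coeff (P ^ N) (2 * N + j - 1) + ?y * coeff (P ^ N) (2 * N + j)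
        + coeff P 1 * coeff (P ^ N) (2 * N + Suc j) + coeff P 0 * coeff (P ^ N) (2 * N + Suc (Suc j))"
      using coeff_mult_cubic[OF P, of "P ^ N" "2 * N + j - 1"] unfolding power_Suc e .
    also have "\<dots> = of_nat (Suc N choose j) * ?x ^ j * ?y ^ (Suc N - j)
        + ?x ^ Suc j * (r0 + ?y * r1 + coeff P 1 * s2 + coeff P 0 * s3)"
      unfolding bin r0 r1 s2 s3 by (simp add: algebra_simps)
    finally show ?thesis by blast
  qed
qed

lemma coeff_cubic_power_in_ideal:
  fixes P :: "'a::comm_ring_1 poly"
  assumes J: "is_ideal J" and P: "degree P \<le> 3" and top: "coeff P 3 ^ d \<in> J" and n: "n \<ge> 2 * N + d"
  shows "coeff (P ^ N) n \<in> J"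
proof -
  let ?x = "coeff P 3"
  obtain j where j: "n = 2 * N + (d + j)" using n by (metis le_Suc_ex add.assoc)
  obtain r where "coeff (P ^ N) n =
    of_nat (N choose (d + j)) * ?x ^ (d + j) * coeff P 2 ^ (N - (d + j)) + ?x ^ Suc (d + j) * r"
    using coeff_cubic_power[OF P] j by blast
  then have "coeff (P ^ N) n =
    ?x ^ d * (of_nat (N choose (d + j)) * ?x ^ j * coeff P 2 ^ (N - (d + j)) + ?x ^ Suc j * r)"
    by (simp add: algebra_simps power_add)
  then show ?thesis using is_ideal_mult_right[OF J top] by simp
qed

text \<open>
  With \<open>P = b + (s - a) Q\<close> and \<open>b = P(a)\<close>, a term of \<open>P\<^sup>N\<close> with less than \<open>N + 1 - d\<close> factors \<open>s - a\<close>
  contains \<open>b\<^sup>d\<close>.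
\<close>

lemma vanishes_mod_power:
  fixes P :: "'a::comm_ring_1 poly"
  assumes J: "is_ideal J" and b: "poly P a ^ d \<in> J"
  shows "vanishes_mod J a (N + 1 - d) (P ^ N)"
proof -
  obtain Q where Q: "P = [:poly P a:] + [:-a, 1:] * Q" by (rule split_at_point)
  let ?b = "[:poly P a:]"
  \<comment> \<open>The extra factor \<open>?b ^ i\<close> keeps account of the factors \<open>b\<close> collected so far.\<close>
  have "vanishes_mod J a (N + 1 + i - d) (?b ^ i * P ^ N)" if "i \<le> d" for i
    using that
  proof (induction N arbitrary: i)
    have full: "vanishes_mod J a m (?b ^ d * P ^ N)" for m N
    proof -
      have "?b ^ d = [:poly P a ^ d:]" by (rule poly_const_pow)
      then show ?thesis
        using vanishes_mod_coeffs_in[OF J coeffs_in_mult_right[OF J coeffs_in_const[OF J b]]] by metis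
    qed
    case 0
    show ?case
    proof (cases "i = d")
      case True
      show ?thesis unfolding True by (rule full)
    next
      case False
      then have "0 + 1 + i - d = 0" using 0 by simp
      then show ?thesis using vanishes_mod_0[OF J] by metis
    qed
    case (Suc N)
    show ?case
    proof (cases "i = d")
      case True
      show ?thesis unfolding True by (rule full)
    next
      case False
      have "?b ^ i * P ^ Suc N = (?b ^ i * P ^ N) * P" by (simp add: mult_ac)
      also have "\<dots> = ?b ^ Suc i * P ^ N + [:-a, 1:] * (Q * (?b ^ i * P ^ N))"
      proof -
        have "u * p = v * (w * n) + x * (q * u)" if "p = v + x * q" "u = w * n" for u v w x p q n :: "'a poly"
          unfolding that by (simp only: ring_distribs mult_ac)
        from this[OF Q, of "?b ^ i * P ^ N" "?b ^ i" "P ^ N"] show ?thesis by (simp only: power_Suc mult.assoc refl)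
      qed
      finally have eq: "?b ^ i * P ^ Suc N = ?b ^ Suc i * P ^ N + [:-a, 1:] * (Q * (?b ^ i * P ^ N))" .
      have 1: "vanishes_mod J a (Suc N + 1 + i - d) (?b ^ Suc i * P ^ N)"
        using Suc.IH[of "Suc i"] Suc.prems False by simp
      have 2: "vanishes_mod J a (Suc N + 1 + i - d) ([:-a, 1:] * (Q * (?b ^ i * P ^ N)))"
      proof (cases "Suc N + 1 + i - d = 0")
        case True
        then show ?thesis using vanishes_mod_0[OF J] by metis
      next
        case False
        then have "Suc N + 1 + i - d = Suc (N + 1 + i - d)" by simp
        then show ?thesis
          using vanishes_mod_linear_mult[OF J vanishes_mod_mult[OF J Suc.IH[OF Suc.prems]]] by metis
      qed
      show ?thesis unfolding eq by (rule vanishes_mod_add[OF J 1 2])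
    qed
  qed
  from this[of 0] show ?thesis by simp
qed

text \<open>
  There are five zeros of order \<open>d\<close>, and the coefficients of \<open>s\<^sup>n\<close> with \<open>n \<ge> 5 d - 1\<close> already lie in \<open>J\<close>. This leaves
  room for the weaker hypothesis on the top coefficient, with the exponent \<open>d + 1\<close>.
\<close>

lemma cubic_power_mod_ideal:
  fixes P :: "'a::comm_ring_1 poly"
  assumes J: "is_ideal J" and P: "degree P \<le> 3" and A: "card A = 5"
    and apart: "\<And>a b. a \<in> A \<Longrightarrow> b \<in> A \<Longrightarrow> a \<noteq> b \<Longrightarrow> a - b dvd 1"
    and zeros: "\<And>a. a \<in> A \<Longrightarrow> poly P a ^ d \<in> J"
    and top: "coeff P 3 ^ (d + 1) \<in> J" and d: "d > 0"
  shows "coeffs_in J (P ^ (2 * d - 1))"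
proof (rule too_many_zeros_mod_ideal[OF J])
  show "finite A" using A by (simp add: card_ge_0_finite)
  show "vanishes_mod J a d (P ^ (2 * d - 1))" if "a \<in> A" for a
    using vanishes_mod_power[OF J zeros[OF that], of "2 * d - 1"] d by (simp add: mult_2)
  show "coeff (P ^ (2 * d - 1)) n \<in> J" if "sum (\<lambda>_. d) A \<le> n" for n
    using that A d by (intro coeff_cubic_power_in_ideal[OF J P top]) simp
qed (use apart in auto)

text \<open>
  The coefficient of \<open>s\<^sup>5\<^sup>d\<^sup>-\<^sup>2\<close> in \<open>P\<^sup>2\<^sup>d\<^sup>-\<^sup>1\<close> is a binomial coefficient times the stated product, up to a
  multiple of the \<open>(d + 1)\<close>-st power of the top coefficient. If \<open>J\<close> contained the \<open>d\<close>-th power of the top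
  coefficient, the conclusion would be trivial.
\<close>

lemma cubic_syzygy:
  fixes P :: "'a::comm_ring_1 poly"
  assumes J: "is_ideal J" and P: "degree P \<le> 3" and A: "card A = 5"
    and apart: "\<And>a b. a \<in> A \<Longrightarrow> b \<in> A \<Longrightarrow> a \<noteq> b \<Longrightarrow> a - b dvd 1"
    and zeros: "\<And>a. a \<in> A \<Longrightarrow> poly P a ^ d \<in> J"
    and top: "coeff P 3 ^ (d + 1) \<in> J" and d: "d > 0"
    and char0: "\<And>n. n > 0 \<Longrightarrow> (of_nat n :: 'a) dvd 1"
  shows "coeff P 3 ^ d * coeff P 2 ^ (d - 1) \<in> J"
proof -
  let ?N = "2 * d - 1" and ?x = "coeff P 3"
  obtain r where r: "coeff (P ^ ?N) (2 * ?N + d) =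
    of_nat (?N choose d) * ?x ^ d * coeff P 2 ^ (?N - d) + ?x ^ Suc d * r"
    using coeff_cubic_power[OF P] by blast
  have "coeff (P ^ ?N) (2 * ?N + d) \<in> J"
    using cubic_power_mod_ideal[OF assms(1-7)] by (simp add: coeffs_in_def)
  then have "coeff (P ^ ?N) (2 * ?N + d) - ?x ^ Suc d * r \<in> J"
    using is_ideal_mult_right[OF J top] idl.subspace_diff[OF J] by auto
  then have "of_nat (?N choose d) * (?x ^ d * coeff P 2 ^ (?N - d)) \<in> J"
    unfolding r by (simp add: mult.assoc)
  moreover have "?N choose d > 0" using d by (intro zero_less_binomial) simp
  ultimately have "?x ^ d * coeff P 2 ^ (?N - d) \<in> J"
    using is_ideal_unit_cancel[OF J char0] by blast
  moreover have "?N - d = d - 1" by simp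
  ultimately show ?thesis by simp
qed

section \<open>Products of linear forms on a twisted cubic\<close>

definition colon :: "'a::comm_ring_1 set \<Rightarrow> 'a \<Rightarrow> 'a set" where
  "colon J c = {q. q * c \<in> J}"

lemma is_ideal_colon: "is_ideal J \<Longrightarrow> is_ideal (colon J c)"
  by (rule idl.subspaceI)
     (auto simp: colon_def distrib_right mult.assoc idl.subspace_0 intro: idl.subspace_add idl.subspace_scale)

text \<open>
  The multipliers that take a polynomial into \<open>J[s]\<close> form an ideal, so that zeros can be counted again
  modulo this ideal.
\<close>

definition poly_colon :: "'a::comm_ring_1 set \<Rightarrow> 'a poly \<Rightarrow> 'a set" where
  "poly_colon J F = {q. coeffs_in J (smult q F)}"

lemma is_ideal_poly_colon:
  assumes J: "is_ideal J"
  shows "is_ideal (poly_colon J F)"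
  by (rule idl.subspaceI)
     (auto simp: poly_colon_def coeffs_in_def distrib_right mult.assoc
       intro: idl.subspace_add[OF J] idl.subspace_scale[OF J] idl.subspace_0[OF J])

text \<open>
  The coefficients of \<open>P\<close> are to be thought of as the linear forms on the span of a twisted cubic; \<open>J\<close> contains the
  \<open>d\<close>-th powers of the forms at the five points \<open>A\<close> and at infinity. The set \<open>V\<close> is an abstract stand-in for the
  variables: it lies in every ideal that contains \<open>J\<close> and the coefficients of \<open>P\<close>. The parameters in \<open>T\<close> are the
  points at which zeros may be prescribed.
\<close>

locale cubic_zeros =
  fixes J :: "'a::idom set" and P :: "'a poly" and A T V :: "'a set" and d :: nat
  assumes J: "is_ideal J" and P: "degree P \<le> 3"
    and infinite_T: "infinite T"
    and apart: "\<And>a b. a \<in> T \<Longrightarrow> b \<in> T \<Longrightarrow> a \<noteq> b \<Longrightarrow> a - b dvd 1"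
    and A: "A \<subseteq> T" "card A = 5"
    and zeros: "\<And>a. a \<in> A \<Longrightarrow> poly P a ^ d \<in> J" and top: "coeff P 3 ^ d \<in> J" and d: "d > 0"
    and char0: "\<And>n. n > 0 \<Longrightarrow> (of_nat n :: 'a) dvd 1"
    and V: "\<And>K. is_ideal K \<Longrightarrow> J \<subseteq> K \<Longrightarrow> coeffs_in K P \<Longrightarrow> V \<subseteq> K"
begin

lemma finite_A: "finite A"
  using A(2) by (simp add: card_ge_0_finite)

lemma coeffs_from_zeros:
  assumes K: "is_ideal K" and S: "finite S" "S \<subseteq> T" "sum e S \<ge> 4"
    and z: "\<And>a. a \<in> S \<Longrightarrow> vanishes_mod K a (e a) P"
  shows "coeffs_in K P"
proof (rule too_many_zeros_mod_ideal[OF K S(1)])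
  show "coeff P n \<in> K" if "sum e S \<le> n" for n
    using coeff_eq_0[of P n] that S(3) P idl.subspace_0[OF K] by simp
qed (use z apart S in auto)

lemma coeffs_from_values:
  assumes K: "is_ideal K" and "infinite B" "B \<subseteq> T" and z: "\<And>b. b \<in> B \<Longrightarrow> poly P b \<in> K"
  shows "coeffs_in K P"
proof -
  obtain S where S: "finite S" "card S = 4" "S \<subseteq> B"
    using infinite_arbitrarily_large[OF assms(2)] by blast
  show ?thesis
    by (rule coeffs_from_zeros[OF K S(1), of "\<lambda>_. 1"])
       (use S assms(3) z vanishes_mod_1[OF K] in auto)
qed

lemma derivative_in:
  assumes "coeffs_in J (smult q (P ^ Suc n))"
  shows "poly (pderiv P) t * (q * poly P t ^ n) \<in> J"
proof -
  have "poly (pderiv (smult q (P ^ Suc n))) t \<in> J"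
    by (rule poly_in_ideal[OF J pderiv_in_ideal[OF J assms]])
  also have "poly (pderiv (smult q (P ^ Suc n))) t = of_nat (Suc n) * (poly (pderiv P) t * (q * poly P t ^ n))"
    unfolding pderiv_smult pderiv_power_Suc by (simp add: mult_ac)
  finally show ?thesis using is_ideal_unit_cancel[OF J char0] by blast
qed

lemma value_in:
  assumes "coeffs_in J (smult q (P ^ n))"
  shows "q * poly P t ^ n \<in> J"
  using poly_in_ideal[OF J assms, of t] by simp

lemma curve_power_in_ideal: "coeffs_in J (P ^ (2 * d - 1))"
proof -
  have "coeff P 3 ^ (d + 1) \<in> J" using is_ideal_mult_right[OF J top, of "coeff P 3"] by (simp add: mult.commute)
  then show ?thesis using cubic_power_mod_ideal[OF J P A(2) _ zeros _ d] apart A(1) by blast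
qed

text \<open>
  In \<open>P\<^sup>2\<^sup>d\<^sup>-\<^sup>2 P(t)\<close> there are zeros of order \<open>d - 1\<close> at the five points of \<open>A\<close>, and one more at \<open>s = t\<close>, where the value
  is \<open>P(t)\<^sup>2\<^sup>d\<^sup>-\<^sup>1\<close>; this is one too many. As \<open>t\<close> varies, \<open>P(t)\<close> may be replaced by the coefficients of \<open>P\<close>.
\<close>

lemma curve_power_times_value: "coeffs_in (poly_colon J (P ^ (2 * d - 2))) P"
proof (rule coeffs_from_values[OF is_ideal_poly_colon[OF J]])
  show "infinite (T - A)" using infinite_T finite_A by simp
  fix t assume t: "t \<in> T - A"
  let ?F = "smult (poly P t) (P ^ (2 * d - 2))"
  let ?e = "\<lambda>a. if a = t then 1 else d - 1"
  have "coeffs_in J ?F"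
  proof (rule too_many_zeros_mod_ideal[OF J, of "insert t A" ?e])
    show "vanishes_mod J a (?e a) ?F" if "a \<in> insert t A" for a
    proof (cases "a = t")
      case True
      have "poly ?F t = poly (P ^ (2 * d - 1)) t"
      proof -
        have "2 * d - 1 = Suc (2 * d - 2)" using d by simp
        then show ?thesis by (simp only: poly_smult poly_power poly_mult power_Suc)
      qed
      then show ?thesis
        using poly_in_ideal[OF J curve_power_in_ideal, of t] True vanishes_mod_1[OF J, of ?F t] by simp
    next
      case False
      have "2 * d - 2 + 1 - d = d - 1" using d by linarith
      then have "vanishes_mod J a (d - 1) (P ^ (2 * d - 2))"
        using vanishes_mod_power[OF J zeros, of a "2 * d - 2"] that False by simp
      then show ?thesis
        using vanishes_mod_mult[OF J, of a "d - 1" "P ^ (2 * d - 2)" "[:poly P t:]"] False by simp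
    qed
    have "(\<Sum>a\<in>A. ?e a) = (\<Sum>a\<in>A. d - 1)" by (rule sum.cong) (use t in auto)
    then have "sum ?e (insert t A) = 1 + 5 * (d - 1)" using t finite_A A(2) by simp
    then show "coeff ?F n \<in> J" if "sum ?e (insert t A) \<le> n" for n
      using that d coeff_cubic_power_in_ideal[OF J P top, of "2 * d - 2" n] idl.subspace_scale[OF J] by simp
  qed (use finite_A apart t A in auto)
  then show "poly P t \<in> poly_colon J (P ^ (2 * d - 2))" by (simp add: poly_colon_def)
qed auto

text \<open>
  A factor \<open>P(t)\<close> that may be chosen at almost all \<open>t\<close> can be replaced by any variable: a cubic with
  infinitely many zeros modulo the ideal \<open>colon J c\<close> vanishes modulo it.
\<close>

lemma extend_factor:
  assumes F: "finite F" and z: "\<And>t. t \<in> T - F \<Longrightarrow> poly P t * c \<in> J" and q: "q \<in> V"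
  shows "q * c \<in> J"
proof -
  have "coeffs_in (colon J c) P"
    by (rule coeffs_from_values[OF is_ideal_colon[OF J], of "T - F"])
       (use infinite_T F z in \<open>auto simp: colon_def\<close>)
  then have "V \<subseteq> colon J c"
    by (intro V is_ideal_colon J) (auto simp: colon_def is_ideal_mult_right[OF J])
  then show ?thesis using q by (auto simp: colon_def)
qed

text \<open>
  The cubic \<open>P\<close> has double zeros at \<open>s\<close> and \<open>t\<close> modulo \<open>colon J (P(s) P(t))\<close>, which is one zero too many.
  Geometrically: a cubic form that vanishes doubly along the twisted cubic vanishes on all its
  secants, and these fill the space.
\<close>

lemma products_in_ideal_2:
  assumes d2: "d = 2" and q: "q1 \<in> V" "q2 \<in> V" "q3 \<in> V"
  shows "q1 * q2 * q3 \<in> J"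
proof -
  have l1: "coeffs_in J (smult (poly P t) (P ^ 2))" for t
    using poly_in_ideal[OF is_ideal_poly_colon[OF J] curve_power_times_value, of t] d2 by (simp add: poly_colon_def)
  have l2: "poly P u * (poly P s * poly P t) \<in> J" if "s \<in> T" "t \<in> T" "s \<noteq> t" for s t u
  proof -
    let ?K = "colon J (poly P s * poly P t)"
    have "coeffs_in ?K P"
    proof (rule coeffs_from_zeros[OF is_ideal_colon[OF J], of "{s, t}" "\<lambda>_. 2"])
      fix a assume "a \<in> {s, t}"
      then obtain b where b: "poly P s * poly P t = poly P a * poly P b"
        by (metis insertE mult.commute singletonD)
      show "vanishes_mod ?K a 2 P"
        by (rule vanishes_mod_2[OF is_ideal_colon[OF J]])
           (use value_in[OF l1[of b], of a] derivative_in[of "poly P b" 1 a] l1[of b] in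
             \<open>auto simp: colon_def b power2_eq_square mult_ac\<close>)
    qed (use that in auto)
    from poly_in_ideal[OF is_ideal_colon[OF J] this, of u] show ?thesis by (simp add: colon_def)
  qed
  have l3: "q3 * (poly P s * poly P t) \<in> J" if "s \<in> T" "t \<in> T" "s \<noteq> t" for s t
    by (rule extend_factor[of "{}"]) (use l2 that q in auto)
  have l4: "q2 * (q3 * poly P s) \<in> J" if "s \<in> T" for s
    by (rule extend_factor[of "{s}"]) (use l3[of s] that q in \<open>auto simp: mult_ac\<close>)
  have "q1 * (q2 * q3) \<in> J"
    by (rule extend_factor[of "{}"]) (use l4 q in \<open>auto simp: mult_ac\<close>)
  then show ?thesis by (simp add: mult_ac)
qed

text \<open>
  In \<open>P\<^sup>3 P(t) P(u)\<close> there are five simple zeros at \<open>A\<close> and, by the previous step and its derivative,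
  double zeros at \<open>t\<close> and \<open>u\<close>; but the coefficients of \<open>s\<^sup>9\<close> and higher powers lie in \<open>J\<close>.
\<close>

lemma curve_cube_times_values:
  assumes d3: "d = 3"
  shows "coeffs_in J (smult (poly P t * poly P u) (P ^ 3))"
proof -
  have l1: "coeffs_in J (smult (poly P t) (P ^ 4))" for t
    using poly_in_ideal[OF is_ideal_poly_colon[OF J] curve_power_times_value, of t] d3 by (simp add: poly_colon_def)
  have l2: "coeffs_in J (smult (poly P t * poly P u) (P ^ 3))" if tu: "t \<in> T - A" "u \<in> T - A" "t \<noteq> u" for t u
  proof (rule too_many_zeros_mod_ideal[OF J, of "{t, u} \<union> A" "\<lambda>a. if a \<in> A then 1 else 2"])
    let ?F = "smult (poly P t * poly P u) (P ^ 3)"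
    show "vanishes_mod J a (if a \<in> A then 1 else 2) ?F" if aa: "a \<in> {t, u} \<union> A" for a
    proof (cases "a \<in> A")
      case True
      then have "poly ?F a \<in> J" using zeros[OF True] d3 idl.subspace_scale[OF J] by simp
      then show ?thesis using vanishes_mod_1[OF J, of ?F a] True by simp
    next
      case False
      then obtain b where b: "poly P t * poly P u = poly P a * poly P b"
        using aa by (metis UnE insertE mult.commute singletonD)
      have "vanishes_mod J a 2 ?F" unfolding b
      proof (rule vanishes_mod_2[OF J])
        show "poly (smult (poly P a * poly P b) (P ^ 3)) a \<in> J"
          using value_in[OF l1[of b], of a] by (simp add: eval_nat_numeral mult_ac)
        have "coeffs_in J (smult (poly P b) (P ^ Suc 3))" using l1[of b] by simp
        from derivative_in[OF this, of a]
        have "3 * (poly (pderiv P) a * (poly P b * poly P a ^ 3)) \<in> J" by (rule idl.subspace_scale[OF J])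
        moreover have "poly (pderiv (smult (poly P a * poly P b) (P ^ 3))) a
            = 3 * (poly (pderiv P) a * (poly P b * poly P a ^ 3))"
          unfolding pderiv_smult numeral_3_eq_3 pderiv_power_Suc
          by (simp add: eval_nat_numeral mult_ac)
        ultimately show "poly (pderiv (smult (poly P a * poly P b) (P ^ 3))) a \<in> J" by simp
      qed
      then show ?thesis using False by simp
    qed
    have "sum (\<lambda>a. if a \<in> A then 1 else 2) ({t, u} \<union> A)
        = sum (\<lambda>a. if a \<in> A then 1 else 2) {t, u} + sum (\<lambda>a. if a \<in> A then 1 else (2::nat)) A"
      by (rule sum.union_disjoint) (use finite_A tu in auto)
    also have "\<dots> = 9" using tu A(2) by simp
    finally show "coeff ?F n \<in> J" if "sum (\<lambda>a. if a \<in> A then 1 else 2) ({t, u} \<union> A) \<le> n" for n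
      using that d3 coeff_cubic_power_in_ideal[OF J P top, of 3 n] idl.subspace_scale[OF J] by simp
  qed (use finite_A apart tu A in auto)
  have l2': "coeffs_in J (smult (poly P t * poly P u) (P ^ 3))" if t: "t \<in> T - A" for t u
  proof -
    have "coeffs_in (poly_colon J (smult (poly P t) (P ^ 3))) P"
      by (rule coeffs_from_values[OF is_ideal_poly_colon[OF J], of "T - A - {t}"])
         (use infinite_T finite_A l2[of t] t in \<open>auto simp: poly_colon_def mult.commute\<close>)
    from poly_in_ideal[OF is_ideal_poly_colon[OF J] this, of u]
    show ?thesis by (simp add: poly_colon_def mult.commute)
  qed
  have "coeffs_in (poly_colon J (smult (poly P u) (P ^ 3))) P"
    by (rule coeffs_from_values[OF is_ideal_poly_colon[OF J], of "T - A"])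
       (use infinite_T finite_A l2'[of _ u] in \<open>auto simp: poly_colon_def mult.commute\<close>)
  from poly_in_ideal[OF is_ideal_poly_colon[OF J] this, of t]
  show ?thesis by (simp add: poly_colon_def mult.commute)
qed

text \<open>
  By the previous lemma, a quintic form in the dual of the degree five part modulo \<open>J\<close> vanishes triply
  along the twisted cubic, hence on all its secants, and so it is zero. The steps below turn this into
  counting: each time a product of five values is regarded as a cubic in one of its parameters, and four zeros
  of that cubic, counted with multiplicity, are known from the earlier steps.
\<close>

lemma products_in_ideal_3:
  assumes d3: "d = 3" and q: "q1 \<in> V" "q2 \<in> V" "q3 \<in> V" "q4 \<in> V" "q5 \<in> V"
  shows "q1 * q2 * q3 * q4 * q5 \<in> J"
proof -
  note value2 = value_in[OF curve_cube_times_values[OF d3]]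
  have deriv2: "poly (pderiv P) s * (poly P t * poly P u * poly P s ^ 2) \<in> J" for s t u
    using derivative_in[of "poly P t * poly P u" 2 s] curve_cube_times_values[OF d3, of t u] by simp
  have double: "vanishes_mod (colon J c) s 2 P" if "c = poly P t * poly P u * poly P s ^ 2" for c s t u
    by (rule vanishes_mod_2[OF is_ideal_colon[OF J]])
       (use value2[of t u s] deriv2[of s t u] in \<open>auto simp: colon_def that eval_nat_numeral mult_ac\<close>)
  \<comment> \<open>Modulo the colon ideal of \<open>P(s)\<^sup>2 P(t)\<^sup>2\<close> the cubic has double zeros at \<open>s\<close> and \<open>t\<close>.\<close>
  have l3: "poly P u * (poly P s ^ 2 * poly P t ^ 2) \<in> J" if "s \<in> T" "t \<in> T" "s \<noteq> t" for s t u
  proof -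
    have "coeffs_in (colon J (poly P s ^ 2 * poly P t ^ 2)) P"
    proof (rule coeffs_from_zeros[OF is_ideal_colon[OF J], of "{s, t}" "\<lambda>_. 2"])
      fix a assume "a \<in> {s, t}"
      then obtain b where "poly P s ^ 2 * poly P t ^ 2 = poly P b * poly P b * poly P a ^ 2"
        by (metis insertE mult.commute power2_eq_square singletonD)
      then show "vanishes_mod (colon J (poly P s ^ 2 * poly P t ^ 2)) a 2 P" by (rule double)
    qed (use that in auto)
    from poly_in_ideal[OF is_ideal_colon[OF J] this, of u] show ?thesis by (simp add: colon_def)
  qed
  \<comment> \<open>A double zero at \<open>s\<close>, simple zeros at \<open>u\<close> and \<open>v\<close>.\<close>
  have l4: "poly P w * (poly P s ^ 2 * poly P u * poly P v) \<in> J"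
    if "s \<in> T" "u \<in> T" "v \<in> T" "s \<noteq> u" "s \<noteq> v" "u \<noteq> v" for s u v w
  proof -
    let ?c = "poly P s ^ 2 * poly P u * poly P v"
    have "coeffs_in (colon J ?c) P"
    proof (rule coeffs_from_zeros[OF is_ideal_colon[OF J], of "{s, u, v}" "\<lambda>a. if a = s then 2 else 1"])
      fix a assume a: "a \<in> {s, u, v}"
      show "vanishes_mod (colon J ?c) a (if a = s then 2 else 1) P"
      proof (cases "a = s")
        case True
        have "?c = poly P u * poly P v * poly P s ^ 2" by (simp add: mult_ac)
        from double[OF this] True show ?thesis by simp
      next
        case False
        then have "poly P a * ?c \<in> J"
          using a l3[of s u v] l3[of s v u] that by (auto simp: power2_eq_square mult_ac)
        then show ?thesis using False vanishes_mod_1[OF is_ideal_colon[OF J]] by (auto simp: colon_def)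
      qed
    qed (use that in auto)
    from poly_in_ideal[OF is_ideal_colon[OF J] this, of w] show ?thesis by (simp add: colon_def)
  qed
  \<comment> \<open>Simple zeros at the four points.\<close>
  have l5: "poly P w * (poly P s * poly P t * poly P u * poly P v) \<in> J"
    if "{s, t, u, v} \<subseteq> T" "distinct [s, t, u, v]" for s t u v w
  proof -
    let ?c = "poly P s * poly P t * poly P u * poly P v"
    have "coeffs_in (colon J ?c) P"
    proof (rule coeffs_from_zeros[OF is_ideal_colon[OF J], of "{s, t, u, v}" "\<lambda>_. 1"])
      fix a assume a: "a \<in> {s, t, u, v}"
      have "poly P a * ?c \<in> J"
        using a l4[of s u v t] l4[of t u v s] l4[of u s v t] l4[of v s u t] that
        by (auto simp: power2_eq_square mult_ac)
      then show "vanishes_mod (colon J ?c) a 1 P"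
        using vanishes_mod_1[OF is_ideal_colon[OF J]] by (auto simp: colon_def)
    qed (use that in auto)
    from poly_in_ideal[OF is_ideal_colon[OF J] this, of w] show ?thesis by (simp add: colon_def)
  qed
  \<comment> \<open>The parameters are now replaced by variables, one after the other, and so need not be distinct any more.\<close>
  have m5: "q5 * (poly P s * poly P t * poly P u * poly P v) \<in> J"
    if "{s, t, u, v} \<subseteq> T" "distinct [s, t, u, v]" for s t u v
    by (rule extend_factor[of "{}"]) (use l5 that q in auto)
  have m4: "q4 * (q5 * poly P s * poly P t * poly P u) \<in> J"
    if "{s, t, u} \<subseteq> T" "distinct [s, t, u]" for s t u
    by (rule extend_factor[of "{s, t, u}"]) (use m5[of s t u] that q in \<open>auto simp: mult_ac\<close>)
  have m3: "q3 * (q4 * q5 * poly P s * poly P t) \<in> J"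
    if "{s, t} \<subseteq> T" "distinct [s, t]" for s t
    by (rule extend_factor[of "{s, t}"]) (use m4[of s t] that q in \<open>auto simp: mult_ac\<close>)
  have m2: "q2 * (q3 * q4 * q5 * poly P s) \<in> J" if "s \<in> T" for s
    by (rule extend_factor[of "{s}"]) (use m3[of s] that q in \<open>auto simp: mult_ac\<close>)
  have "q1 * (q2 * q3 * q4 * q5) \<in> J"
    by (rule extend_factor[of "{}"]) (use m2 q in \<open>auto simp: mult_ac\<close>)
  then show ?thesis by (simp add: mult_ac)
qed

end

section \<open>Evaluation and homogeneous components of polynomials\<close>

abbreviation lkp :: "('a \<Rightarrow>\<^sub>0 'b::zero) \<Rightarrow> 'a \<Rightarrow> 'b" where "lkp \<equiv> Poly_Mapping.lookup"
abbreviation mon :: "'a \<Rightarrow> 'b \<Rightarrow> ('a \<Rightarrow>\<^sub>0 'b::zero)" where "mon \<equiv> Poly_Mapping.single"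
abbreviation supp :: "('a \<Rightarrow>\<^sub>0 'b::zero) \<Rightarrow> 'a set" where "supp \<equiv> Poly_Mapping.keys"

lemma sum_of_terms: "(\<Sum>m\<in>supp f. mon m (lkp f m)) = (f :: 'a \<Rightarrow>\<^sub>0 'b::comm_monoid_add)"
  by (rule poly_mapping_eqI) (auto simp: lookup_sum lookup_single when_def in_keys_iff)

lemma mpoly_induct [case_names monom add]:
  fixes f :: "'a \<Rightarrow>\<^sub>0 'b::comm_monoid_add"
  assumes "\<And>m c. P (mon m c)" and "\<And>f g. P f \<Longrightarrow> P g \<Longrightarrow> P (f + g)"
  shows "P f"
proof -
  have "P (\<Sum>m\<in>S. mon m (lkp f m))" if "finite S" for S
    using that
  proof induction
    case empty
    then show ?case using assms(1)[of undefined 0] by simp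
  next
    case (insert x S)
    then show ?case using assms by simp
  qed
  from this[of "supp f"] show ?thesis by (simp add: sum_of_terms)
qed

lemma eval_mpoly_superset:
  assumes "finite S" "supp p \<subseteq> S"
  shows "eval_mpoly p c = (\<Sum>m\<in>S. lkp p m * (\<Prod>i\<in>UNIV. c i ^ lkp m i))"
  unfolding eval_mpoly_def using assms by (intro sum.mono_neutral_left) (auto simp: in_keys_iff)

lemma eval_mpoly_add [simp]: "eval_mpoly (p + q) c = eval_mpoly p c + eval_mpoly q c"
  using eval_mpoly_superset[of "supp p \<union> supp q" p c] eval_mpoly_superset[of "supp p \<union> supp q" q c]
    eval_mpoly_superset[of "supp p \<union> supp q" "p + q" c] keys_add[of p q]
  by (simp add: lookup_add distrib_right sum.distrib)

lemma eval_mpoly_single: "eval_mpoly (mon m a) c = a * (\<Prod>i\<in>UNIV. c i ^ lkp m i)"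
  by (simp add: eval_mpoly_superset[of "{m}"])

lemma eval_mpoly_mult [simp]: "eval_mpoly (p * q) c = eval_mpoly p c * eval_mpoly q c"
proof (induction p rule: mpoly_induct)
  case (monom m a)
  show ?case
  proof (induction q rule: mpoly_induct)
    case (monom n b)
    then show ?case by (simp add: mult_single eval_mpoly_single lookup_add power_add prod.distrib)
  qed (simp add: distrib_left)
qed (simp add: distrib_right)

lemma eval_mpoly_Const [simp]: "eval_mpoly (Const a) c = a"
  by (simp add: Const_def eval_mpoly_single)

lemma eval_mpoly_Var [simp]: "eval_mpoly (Var i) c = c i"
proof -
  have "(\<Prod>j\<in>UNIV. c j ^ lkp (mon i 1) j) = (\<Prod>j\<in>UNIV. if j = i then c j else 1)"
    by (rule prod.cong) (auto simp: lookup_single when_def)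
  then show ?thesis by (simp add: Var_def eval_mpoly_single)
qed

lemma Const_0 [simp]: "Const 0 = 0" and Const_1 [simp]: "Const 1 = 1"
  and Const_add: "Const (a + b) = Const a + Const b" and Const_mult: "Const (a * b) = Const a * Const b"
  and Const_diff: "Const (a - b) = Const a - Const b"
  by (simp_all add: Const_def single_add mult_single single_diff)

lemma Const_of_nat: "Const (of_nat n) = of_nat n"
  by (simp add: Const_def)

lemma Const_eq_iff [simp]: "Const a = Const b \<longleftrightarrow> a = b"
  by (auto simp: Const_def dest: inj_onD[OF inj_single])

lemma Const_unit: "a \<noteq> 0 \<Longrightarrow> (Const a :: ('n, 'k::field) mpoly) dvd 1"
  by (rule dvdI[of _ _ "Const (inverse a)"]) (simp flip: Const_mult)

lemma eval_mpoly_0 [simp]: "eval_mpoly 0 c = 0" and eval_mpoly_1 [simp]: "eval_mpoly 1 c = 1"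
  using eval_mpoly_Const[of 0 c] eval_mpoly_Const[of 1 c] by simp_all

lemma eval_mpoly_sum [simp]: "eval_mpoly (sum f A) c = (\<Sum>a\<in>A. eval_mpoly (f a) c)"
  by (induction A rule: infinite_finite_induct) auto

lemma eval_mpoly_prod [simp]: "eval_mpoly (prod f A) c = (\<Prod>a\<in>A. eval_mpoly (f a) c)"
  by (induction A rule: infinite_finite_induct) auto

lemma eval_mpoly_power [simp]: "eval_mpoly (p ^ n) c = eval_mpoly p c ^ n"
  by (induction n) auto

lemma eval_mpoly_minus [simp]: "eval_mpoly (- p) c = - eval_mpoly p c"
  using eval_mpoly_add[of "-p" p c] by (simp add: add_eq_0_iff)

lemma eval_mpoly_diff [simp]: "eval_mpoly (p - q) c = eval_mpoly p c - eval_mpoly q c"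
  using eval_mpoly_add[of p "-q" c] by simp

lemma eval_linear_form [simp]: "eval_mpoly (linear_form b) c = (\<Sum>i\<in>UNIV. b i * c i)"
  by (simp add: linear_form_def)

lemma total_deg_add [simp]: "total_deg (m + n) = total_deg m + total_deg n"
  by (simp add: total_deg_def lookup_add sum.distrib)

definition homog :: "nat \<Rightarrow> ('n::finite, 'k::field) mpoly \<Rightarrow> bool" where
  "homog t f \<longleftrightarrow> (\<forall>m\<in>supp f. total_deg m = t)"

lemma homog_iff: "homog t f \<longleftrightarrow> f \<in> graded_piece (int t)"
  by (simp add: homog_def graded_piece_def)

lemma homog_0 [simp]: "homog t 0" by (simp add: homog_def)

lemma homog_add: "homog t f \<Longrightarrow> homog t g \<Longrightarrow> homog t (f + g)"
  using keys_add[of f g] by (auto simp: homog_def)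

lemma supp_minus [simp]: "supp (- f) = supp (f :: 'a \<Rightarrow>\<^sub>0 'b::ab_group_add)"
  by (auto simp: in_keys_iff)

lemma homog_minus: "homog t f \<Longrightarrow> homog t (- f)"
  by (simp add: homog_def)

lemma homog_diff: "homog t f \<Longrightarrow> homog t g \<Longrightarrow> homog t (f - g)"
  using homog_add[of t f "-g"] homog_minus[of t g] by simp

lemma homog_mult: "homog s f \<Longrightarrow> homog t g \<Longrightarrow> homog (s + t) (f * g)"
  using keys_mult[of f g] by (fastforce simp: homog_def)

lemma homog_single: "homog (total_deg m) (mon m c)"
  by (auto simp: homog_def split: if_splits)

lemma homog_Const: "homog 0 (Const c)"
  using homog_single[of 0 c] by (simp add: Const_def total_deg_def)

lemma homog_Const_mult: "homog t f \<Longrightarrow> homog t (Const c * f)"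
  using homog_mult[OF homog_Const] by fastforce

lemma homog_sum: "(\<And>a. a \<in> A \<Longrightarrow> homog t (f a)) \<Longrightarrow> homog t (sum f A)"
  by (induction A rule: infinite_finite_induct) (auto intro: homog_add)

lemma homog_power: "homog t f \<Longrightarrow> homog (n * t) (f ^ n)"
proof (induction n)
  case 0
  then show ?case using homog_Const[of 1] by simp
qed (auto intro: homog_mult)

lemma homog_Var: "homog 1 (Var i)"
  using homog_single[of "mon i 1" 1] by (simp add: Var_def total_deg_single)

lemma homog_linear_form: "homog 1 (linear_form b)"
  unfolding linear_form_def by (intro homog_sum homog_Const_mult homog_Var)

lemma homog_linear_form_power: "homog n (linear_form b ^ n)"
  using homog_power[OF homog_linear_form, of n] by simp

lemma Var_power: "(Var i :: ('n, 'k::field) mpoly) ^ n = mon (mon i n) 1"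
proof (induction n)
  case (Suc n)
  then show ?case by (simp add: Var_def mult_single flip: single_add)
qed simp

lemma homog_0_eq_Const:
  fixes f :: "('n::finite, 'k::field) mpoly"
  assumes f: "homog 0 f"
  shows "\<exists>c. f = Const c"
proof -
  have "f = Const (lkp f 0)"
  proof (rule poly_mapping_eqI)
    fix m
    have "total_deg m = 0 \<longleftrightarrow> m = 0" for m :: "'n \<Rightarrow>\<^sub>0 nat"
      by (auto simp: total_deg_def intro: poly_mapping_eqI)
    then show "lkp f m = lkp (Const (lkp f 0)) m"
      using f by (auto simp: Const_def lookup_single when_def homog_def in_keys_iff)
  qed
  then show ?thesis ..
qed

lemma homog_1_eq_linear_form: "homog 1 f \<Longrightarrow> \<exists>b. f = linear_form b"
  using bij_betw_linear_form unfolding homog_iff bij_betw_def by auto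

definition hom_part :: "nat \<Rightarrow> ('n::finite, 'k::field) mpoly \<Rightarrow> ('n, 'k) mpoly" where
  "hom_part t f = (\<Sum>m\<in>{m \<in> supp f. total_deg m = t}. mon m (lkp f m))"

lemma lookup_hom_part: "lkp (hom_part t f) m = (if total_deg m = t then lkp f m else 0)"
  by (auto simp: hom_part_def lookup_sum lookup_single when_def in_keys_iff)

lemma hom_part_add: "hom_part t (f + g) = hom_part t f + hom_part t g"
  and hom_part_diff: "hom_part t (f - g) = hom_part t f - hom_part t g"
  by (rule poly_mapping_eqI, simp add: lookup_hom_part lookup_add lookup_minus)+

lemma homog_hom_part: "homog t (hom_part t f)"
  by (auto simp: homog_def in_keys_iff lookup_hom_part split: if_splits)

lemma hom_part_homog: "homog s f \<Longrightarrow> hom_part t f = (if s = t then f else 0)"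
  by (rule poly_mapping_eqI) (auto simp: lookup_hom_part homog_def in_keys_iff)

text \<open>
  This and the next lemma make it possible to pass from an identity that expresses membership in a homogeneous
  ideal to its components, with homogeneous cofactors.
\<close>

lemma hom_part_mult:
  assumes "homog e q"
  shows "hom_part (t + e) (f * q) = hom_part t f * q"
proof (induction f rule: mpoly_induct)
  case (monom m c)
  show ?case
    using hom_part_homog[OF homog_mult[OF homog_single assms], of "t + e" m c]
      hom_part_homog[OF homog_single, of t m c] by simp
qed (simp add: hom_part_add distrib_right)

lemma hom_part_mult_less:
  assumes "homog e q" "t < e"
  shows "hom_part t (f * q) = 0"
proof (induction f rule: mpoly_induct)
  case (monom m c)
  show ?case
    using hom_part_homog[OF homog_mult[OF homog_single assms(1)], of t m c] assms(2) by simp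
qed (simp add: hom_part_add distrib_right)

section \<open>The ideal generated by the powers of the variables\<close>

text \<open>
  The ideal is described by its monomials; that it is generated by the powers of the variables is
  \<open>powers_ideal_eq_span\<close>. In this form it is evident that it is preserved by operators that act on
  monomials.
\<close>

definition powers_ideal :: "nat \<Rightarrow> ('n::finite, 'k::field) mpoly set" where
  "powers_ideal d = {f. \<forall>m\<in>supp f. \<exists>i. d \<le> lkp m i}"

lemma is_ideal_powers_ideal: "is_ideal (powers_ideal d :: ('n::finite, 'k::field) mpoly set)"
proof (rule idl.subspaceI)
  show "f + g \<in> powers_ideal d" if "f \<in> powers_ideal d" "g \<in> powers_ideal d" for f g :: "('n, 'k) mpoly"
    using that keys_add[of f g] by (auto simp: powers_ideal_def)
  show "c * f \<in> powers_ideal d" if "f \<in> powers_ideal d" for c f :: "('n, 'k) mpoly"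
    unfolding powers_ideal_def
  proof (intro CollectI ballI)
    fix m assume "m \<in> supp (c * f)"
    then obtain a b where m: "m = a + b" "b \<in> supp f" using keys_mult[of c f] by blast
    then obtain i where "d \<le> lkp b i" using \<open>f \<in> powers_ideal d\<close> by (auto simp: powers_ideal_def)
    then show "\<exists>i. d \<le> lkp m i" unfolding m(1) lookup_add by (intro exI[of _ i]) simp
  qed
qed (simp add: powers_ideal_def)

lemmas powers_ideal_add = idl.subspace_add[OF is_ideal_powers_ideal]
  and powers_ideal_diff = idl.subspace_diff[OF is_ideal_powers_ideal]
  and powers_ideal_mult = idl.subspace_scale[OF is_ideal_powers_ideal]
  and powers_ideal_mult_right = is_ideal_mult_right[OF is_ideal_powers_ideal]
  and powers_ideal_sum = idl.subspace_sum[OF is_ideal_powers_ideal]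

lemma Var_power_in_powers_ideal: "Var i ^ d \<in> powers_ideal d"
  by (auto simp: Var_power powers_ideal_def intro!: exI[of _ i])

lemma hom_part_powers_ideal: "f \<in> powers_ideal d \<Longrightarrow> hom_part t f \<in> powers_ideal d"
  by (auto simp: powers_ideal_def in_keys_iff lookup_hom_part split: if_splits)

lemma single_in_powers_ideal: "d \<le> lkp m i \<Longrightarrow> mon m c \<in> powers_ideal d"
  by (auto simp: powers_ideal_def split: if_splits)

lemma single_eq_mult_Var_power:
  assumes "d \<le> lkp m i"
  shows "mon m c = mon (m - mon i d) c * (Var i :: ('n::finite, 'k::field) mpoly) ^ d"
proof -
  have "m - mon i d + mon i d = m"
    using assms by (intro poly_mapping_eqI) (auto simp: lookup_add lookup_minus lookup_single when_def)
  then show ?thesis by (simp add: Var_power mult_single)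
qed

lemma powers_ideal_homog_expansion:
  fixes f :: "('n::finite, 'k::field) mpoly"
  assumes f: "f \<in> powers_ideal d" and "homog t f" and "d \<le> t"
  shows "\<exists>G. f = (\<Sum>i\<in>UNIV. G i * Var i ^ d) \<and> (\<forall>i. homog (t - d) (G i))"
proof -
  define idx where "idx m = (SOME i. d \<le> lkp m i)" for m :: "'n \<Rightarrow>\<^sub>0 nat"
  have idx: "d \<le> lkp m (idx m)" if "m \<in> supp f" for m
    using f that unfolding powers_ideal_def idx_def by (auto intro: someI_ex)
  define G where "G i = (\<Sum>m\<in>{m \<in> supp f. idx m = i}. mon (m - mon i d) (lkp f m))" for i
  have "f = (\<Sum>m\<in>supp f. mon m (lkp f m))" by (simp add: sum_of_terms)
  also have "\<dots> = (\<Sum>i\<in>UNIV. \<Sum>m\<in>{m \<in> supp f. idx m = i}. mon m (lkp f m))"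
    by (rule sum.group[symmetric]) auto
  also have "\<dots> = (\<Sum>i\<in>UNIV. G i * Var i ^ d)"
    unfolding G_def sum_distrib_right
    by (intro sum.cong refl single_eq_mult_Var_power) (use idx in auto)
  finally have "f = (\<Sum>i\<in>UNIV. G i * Var i ^ d)" .
  moreover have "homog (t - d) (G i)" for i
    unfolding G_def
  proof (rule homog_sum)
    fix m assume m: "m \<in> {m \<in> supp f. idx m = i}"
    have "m - mon i d + mon i d = m"
      using idx[of m] m by (intro poly_mapping_eqI) (auto simp: lookup_add lookup_minus lookup_single when_def)
    then have "total_deg (m - mon i d) + d = total_deg m"
      by (metis total_deg_add total_deg_single)
    then have "total_deg (m - mon i d) = t - d" using m assms(2) by (auto simp: homog_def)
    then show "homog (t - d) (mon (m - mon i d) (lkp f m))" using homog_single by metis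
  qed
  ultimately show ?thesis by blast
qed

lemma lookup_le_total_deg: "lkp m i \<le> total_deg m"
  unfolding total_deg_def by (rule member_le_sum) auto

lemma powers_ideal_low_degree:
  assumes "f \<in> powers_ideal d" "homog t f" "t < d"
  shows "f = 0"
proof -
  have "False" if m: "m \<in> supp f" for m
  proof -
    obtain i where "d \<le> lkp m i" using assms(1) m by (auto simp: powers_ideal_def)
    then show False using lookup_le_total_deg[of m i] assms(2,3) m by (auto simp: homog_def)
  qed
  then show ?thesis by (intro poly_mapping_eqI) (auto simp: in_keys_iff)
qed

section \<open>The strong Lefschetz property of monomial complete intersections\<close>

lemma single_sum: "mon m (sum f A) = (\<Sum>a\<in>A. mon m (f a))"
  by (induction A rule: infinite_finite_induct) (auto simp: single_add)

lemma Const_mult_single: "Const c * mon m b = mon m (c * b)"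
  by (simp add: Const_def mult_single)

lemma Var_mult_single: "(Var j :: ('n, 'k::field) mpoly) * mon m c = mon (m + mon j 1) c"
  by (simp add: Var_def mult_single add.commute)

text \<open>
  The operator \<open>\<Sum>i. a\<^sub>i\<^sup>-\<^sup>1 ((d - 1) \<partial>\<^sub>i - x\<^sub>i \<partial>\<^sub>i\<^sup>2)\<close>, written on monomials. Together with the multiplication by
  \<open>\<Sum>i. a\<^sub>i x\<^sub>i\<close> it generates a representation of \<open>sl\<^sub>2\<close>, and each \<open>k[x\<^sub>i]/(x\<^sub>i\<^sup>d)\<close> is the
  irreducible representation of dimension \<open>d\<close>.
\<close>

definition lowering :: "nat \<Rightarrow> ('n::finite \<Rightarrow> 'k::field) \<Rightarrow> ('n, 'k) mpoly \<Rightarrow> ('n, 'k) mpoly" where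
  "lowering d a f = (\<Sum>m\<in>supp f. \<Sum>i\<in>UNIV.
     mon (m - mon i 1) (lkp f m * (of_nat (lkp m i) * (of_nat d - of_nat (lkp m i)) / a i)))"

lemma lowering_superset:
  assumes "finite S" "supp f \<subseteq> S"
  shows "lowering d a f = (\<Sum>m\<in>S. \<Sum>i\<in>UNIV.
     mon (m - mon i 1) (lkp f m * (of_nat (lkp m i) * (of_nat d - of_nat (lkp m i)) / a i)))"
  unfolding lowering_def using assms by (intro sum.mono_neutral_left) (auto simp: in_keys_iff)

lemma lowering_add: "lowering d a (f + g) = lowering d a f + lowering d a g"
  using lowering_superset[of "supp f \<union> supp g" f] lowering_superset[of "supp f \<union> supp g" g]
    lowering_superset[of "supp f \<union> supp g" "f + g"] keys_add[of f g]
  by (simp add: lookup_add distrib_right add_divide_distrib single_add sum.distrib)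

lemma lowering_0 [simp]: "lowering d a 0 = 0"
  by (simp add: lowering_def)

lemma lowering_sum: "lowering d a (sum f A) = (\<Sum>x\<in>A. lowering d a (f x))"
  by (induction A rule: infinite_finite_induct) (auto simp: lowering_add)

lemma lowering_single:
  "lowering d a (mon m c) = (\<Sum>i\<in>UNIV.
     mon (m - mon i 1) (c * (of_nat (lkp m i) * (of_nat d - of_nat (lkp m i)) / a i)))"
  by (subst lowering_superset[of "{m}"]) auto

lemma minus_plus_single:
  assumes "lkp m i > 0"
  shows "(m :: 'n \<Rightarrow>\<^sub>0 nat) - mon i 1 + n = m + n - mon i 1" and "m - mon i 1 + mon i 1 = m"
  using assms by (auto intro!: poly_mapping_eqI simp: lookup_add lookup_minus lookup_single when_def)

lemma total_deg_minus_single: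
  assumes "lkp m i > 0"
  shows "total_deg (m - mon i 1) = total_deg m - 1"
proof -
  have "total_deg m = total_deg (m - mon i 1) + total_deg (mon i 1 :: 'a \<Rightarrow>\<^sub>0 nat)"
    using minus_plus_single(2)[OF assms] total_deg_add by metis
  then show ?thesis by (simp add: total_deg_single)
qed

lemma homog_lowering:
  assumes "homog j f"
  shows "homog (j - 1) (lowering d a f)"
  unfolding lowering_def
proof (intro homog_sum)
  fix m i assume m: "m \<in> supp f"
  show "homog (j - 1) (mon (m - mon i 1) (lkp f m * (of_nat (lkp m i) * (of_nat d - of_nat (lkp m i)) / a i)))"
  proof (cases "lkp m i = 0")
    case False
    then show ?thesis
      using homog_single[of "m - mon i 1"] total_deg_minus_single[of m i] assms m by (auto simp: homog_def)
  qed simp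
qed

lemma lowering_homog_0:
  assumes "homog 0 f"
  shows "lowering d a f = 0"
  unfolding lowering_def
proof (intro sum.neutral ballI)
  fix m i assume "m \<in> supp f"
  then have "lkp m i = 0" using assms lookup_le_total_deg[of m i] by (simp add: homog_def)
  then show "mon (m - mon i 1) (lkp f m * (of_nat (lkp m i) * (of_nat d - of_nat (lkp m i)) / a i)) = 0"
    by simp
qed

text \<open>
  The exponent \<open>d\<close> is never lowered to \<open>d - 1\<close>, because of the factor \<open>e (d - e)\<close> in the operator.
\<close>

lemma lowering_powers_ideal:
  assumes "f \<in> powers_ideal d"
  shows "lowering d a f \<in> powers_ideal d"
  unfolding lowering_def
proof (intro powers_ideal_sum)
  fix m i assume "m \<in> supp f"
  then obtain k where k: "d \<le> lkp m k" using assms by (auto simp: powers_ideal_def)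
  let ?c = "lkp f m * (of_nat (lkp m i) * (of_nat d - of_nat (lkp m i)) / a i)"
  show "mon (m - mon i 1) ?c \<in> powers_ideal d"
  proof (cases "k = i \<and> lkp m i = d")
    case True
    then show ?thesis by (simp add: idl.subspace_0[OF is_ideal_powers_ideal])
  next
    case False
    then have "d \<le> lkp (m - mon i 1) k"
      using k by (auto simp: lookup_minus lookup_single when_def)
    then show ?thesis by (rule single_in_powers_ideal)
  qed
qed

text \<open>
  On a monomial, the terms that raise \<open>x\<^sub>k\<close> and lower \<open>x\<^sub>i\<close> with \<open>i \<noteq> k\<close> cancel. For \<open>i = k\<close> there remains
  \<open>w (e + 1) - w e = d - 1 - 2 e\<close> with \<open>w e = e (d - e)\<close>, where \<open>e\<close> is the exponent of \<open>x\<^sub>i\<close>.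
\<close>

lemma lowering_commutator:
  fixes a :: "'n::finite \<Rightarrow> 'k::field_char_0"
  assumes a: "\<And>i. a i \<noteq> 0" and f: "homog j f"
  shows "lowering d a (linear_form a * f) = linear_form a * lowering d a f
    + Const (of_nat CARD('n) * (of_nat d - 1) - 2 * of_nat j) * f"
proof -
  define w :: "nat \<Rightarrow> 'k" where "w k = of_nat k * (of_nat d - of_nat k)" for k
  have mono: "lowering d a (linear_form a * mon m c) = linear_form a * lowering d a (mon m c)
    + Const (of_nat CARD('n) * (of_nat d - 1) - 2 * of_nat (total_deg m)) * mon m c" for m c
  proof -
    have lin: "linear_form a * mon n b = (\<Sum>k\<in>UNIV. mon (n + mon k 1) (a k * b))" for n b
      unfolding linear_form_def sum_distrib_right
      by (intro sum.cong refl) (simp add: mult.assoc Var_mult_single Const_mult_single)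
    have L: "lowering d a (linear_form a * mon m c) =
      (\<Sum>k\<in>UNIV. \<Sum>i\<in>UNIV. mon (m + mon k 1 - mon i 1) (a k * c * (w (lkp (m + mon k 1) i) / a i)))"
      unfolding lin lowering_sum lowering_single w_def ..
    have R: "linear_form a * lowering d a (mon m c) =
      (\<Sum>k\<in>UNIV. \<Sum>i\<in>UNIV. mon (m - mon i 1 + mon k 1) (a k * (c * (w (lkp m i) / a i))))"
      unfolding lowering_single sum_distrib_left lin w_def by (rule sum.swap)
    have term_eq: "mon (m + mon k 1 - mon i 1) (a k * c * (w (lkp (m + mon k 1) i) / a i)) =
      mon (m - mon i 1 + mon k 1) (a k * (c * (w (lkp m i) / a i)))
        + (if i = k then mon m (c * (of_nat d - 1 - 2 * of_nat (lkp m k))) else 0)" for k i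
    proof (cases "i = k")
      case True
      have 1: "mon (m - mon k 1 + mon k 1) (a k * (c * (w (lkp m k) / a k))) = mon m (c * w (lkp m k))"
      proof (cases "lkp m k = 0")
        case False
        then show ?thesis using minus_plus_single(2)[of m k] a[of k] by simp
      qed (simp add: w_def)
      have 2: "c * w (Suc (lkp m k)) = c * w (lkp m k) + c * (of_nat d - 1 - 2 * of_nat (lkp m k))"
        by (simp add: w_def algebra_simps)
      show ?thesis
        unfolding True 1 using a[of k] 2 by (simp add: lookup_add flip: single_add)
    next
      case False
      then have e: "lkp (m + mon k 1) i = lkp m i" by (simp add: lookup_add lookup_single)
      show ?thesis
      proof (cases "lkp m i = 0")
        case True
        then show ?thesis unfolding e using False by (simp add: w_def)
      next
        case nz: False
        then show ?thesis unfolding e using False minus_plus_single(1)[of m i "mon k 1"] by (simp add: mult.assoc)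
      qed
    qed
    have "(\<Sum>k\<in>UNIV. \<Sum>i\<in>UNIV. if i = k then mon m (c * (of_nat d - 1 - 2 * of_nat (lkp m k))) else 0)
        = (\<Sum>k\<in>UNIV. mon m (c * (of_nat d - 1 - 2 * of_nat (lkp m k))))"
      by simp
    also have "\<dots> = mon m (\<Sum>k\<in>UNIV. c * (of_nat d - 1 - 2 * of_nat (lkp m k)))"
      by (rule single_sum[symmetric])
    also have "(\<Sum>k\<in>UNIV. c * (of_nat d - 1 - 2 * of_nat (lkp m k))) =
        (of_nat CARD('n) * (of_nat d - 1) - 2 * of_nat (total_deg m)) * c"
      by (simp add: total_deg_def sum_subtractf flip: sum_distrib_left)
    finally show ?thesis
      unfolding L R term_eq sum.distrib Const_mult_single by simp
  qed
  have "lowering d a (linear_form a * (\<Sum>m\<in>supp f. mon m (lkp f m))) =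
    linear_form a * lowering d a (\<Sum>m\<in>supp f. mon m (lkp f m))
    + Const (of_nat CARD('n) * (of_nat d - 1) - 2 * of_nat j) * (\<Sum>m\<in>supp f. mon m (lkp f m))"
    unfolding sum_distrib_left lowering_sum sum.distrib[symmetric]
    by (intro sum.cong refl) (use f mono in \<open>auto simp: homog_def\<close>)
  then show ?thesis unfolding sum_of_terms .
qed

lemma lowering_commutator_power:
  fixes a :: "'n::finite \<Rightarrow> 'k::field_char_0" and d :: nat
  assumes a: "\<And>i. a i \<noteq> 0" and f: "homog j f"
  defines "N \<equiv> of_nat CARD('n) * (of_nat d - 1)"
  shows "lowering d a (linear_form a ^ Suc m * f) = linear_form a ^ Suc m * lowering d a f
    + Const (of_nat (Suc m) * (N - 2 * of_nat j - of_nat m)) * (linear_form a ^ m * f)"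
proof (induction m)
  case 0
  show ?case using lowering_commutator[OF a f] by (simp add: N_def)
next
  case (Suc m)
  let ?L = "linear_form a" and ?D = "lowering d a"
  have h: "homog (Suc m + j) (?L ^ Suc m * f)"
    by (rule homog_mult[OF homog_linear_form_power f])
  have e: "of_nat (Suc m) * (N - 2 * of_nat j - of_nat m) + (N - 2 * of_nat (Suc m + j))
      = of_nat (Suc (Suc m)) * (N - 2 * of_nat j - of_nat (Suc m))"
    by (simp add: algebra_simps)
  have "?D (?L ^ Suc (Suc m) * f) = ?D (?L * (?L ^ Suc m * f))" by (simp only: power_Suc mult.assoc)
  also have "\<dots> = ?L * ?D (?L ^ Suc m * f) + Const (N - 2 * of_nat (Suc m + j)) * (?L ^ Suc m * f)"
    using lowering_commutator[OF a h] by (simp only: N_def)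
  also have "\<dots> = ?L ^ Suc (Suc m) * ?D f
      + (Const (of_nat (Suc m) * (N - 2 * of_nat j - of_nat m)) + Const (N - 2 * of_nat (Suc m + j))) * (?L ^ Suc m * f)"
    unfolding Suc by (simp add: algebra_simps)
  finally show ?case unfolding Const_add[symmetric] e .
qed

text \<open>
  The usual argument for representations of \<open>sl\<^sub>2\<close>, as an induction on the degree \<open>j\<close> and, inside, on the exponent \<open>m\<close>. From
  \<open>L\<^sup>m\<^sup>+\<^sup>1 f = 0\<close> the commutator relation gives \<open>L\<^sup>m\<^sup>+\<^sup>2 Y f = 0\<close> for the lowering operator \<open>Y\<close>, so \<open>Y f = 0\<close> by
  induction on the degree; the relation then reads \<open>0 = n L\<^sup>m f\<close> with a positive integer \<open>n\<close>.
\<close>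

theorem strong_lefschetz_powers:
  fixes a :: "'n::finite \<Rightarrow> 'k::field_char_0"
  assumes a: "\<And>i. a i \<noteq> 0" and d: "d > 0"
    and "homog j f" and "linear_form a ^ m * f \<in> powers_ideal d" and "2 * j + m \<le> CARD('n) * (d - 1)"
  shows "f \<in> powers_ideal d"
  using assms(3-)
proof (induction j arbitrary: m f)
  have step: "f \<in> powers_ideal d"
    if f: "homog j f" and deg: "2 * j + m \<le> CARD('n) * (d - 1)" and m: "linear_form a ^ m * f \<in> powers_ideal d"
      and low: "\<And>m. linear_form a ^ Suc (Suc m) * lowering d a f \<in> powers_ideal d \<Longrightarrow> 2 * j + Suc m \<le> CARD('n) * (d - 1)
        \<Longrightarrow> lowering d a f \<in> powers_ideal d"
    for j m f
    using deg m
  proof (induction m)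
    case (Suc m)
    let ?L = "linear_form a" and ?D = "lowering d a"
    let ?k = "Suc m * (CARD('n) * (d - 1) - 2 * j - m)"
    have c: "of_nat (Suc m) * (of_nat CARD('n) * (of_nat d - 1) - 2 * of_nat j - of_nat m) = (of_nat ?k :: 'k)"
    proof -
      have "(of_nat (CARD('n) * (d - 1) - 2 * j - m) :: 'k) = of_nat CARD('n) * (of_nat d - 1) - 2 * of_nat j - of_nat m"
        using Suc.prems(1) d by (simp add: of_nat_diff Suc_leI)
      then show ?thesis by (simp only: of_nat_mult)
    qed
    have comm: "?D (?L ^ Suc m * f) = ?L ^ Suc m * ?D f + Const (of_nat ?k) * (?L ^ m * f)"
      using lowering_commutator_power[OF a f, where d = d and m = m] unfolding c .
    have 1: "?D (?L ^ Suc m * f) \<in> powers_ideal d" by (rule lowering_powers_ideal[OF Suc.prems(2)])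
    have "?L * ?D (?L ^ Suc m * f) - Const (of_nat ?k) * (?L ^ Suc m * f) \<in> powers_ideal d"
      by (intro powers_ideal_diff powers_ideal_mult 1 Suc.prems(2))
    also have "?L * ?D (?L ^ Suc m * f) - Const (of_nat ?k) * (?L ^ Suc m * f) = ?L ^ Suc (Suc m) * ?D f"
      unfolding comm by (simp add: algebra_simps)
    finally have "?D f \<in> powers_ideal d" using low[of m] Suc.prems(1) by simp
    then have "?D (?L ^ Suc m * f) - ?L ^ Suc m * ?D f \<in> powers_ideal d"
      by (intro powers_ideal_diff powers_ideal_mult 1)
    then have "Const (of_nat ?k) * (?L ^ m * f) \<in> powers_ideal d" unfolding comm by simp
    moreover have "?k > 0" using Suc.prems(1) by simp
    then have "(of_nat ?k :: 'k) \<noteq> 0" unfolding of_nat_eq_0_iff by (rule gr_implies_not0)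
    ultimately have "?L ^ m * f \<in> powers_ideal d"
      using is_ideal_unit_cancel[OF is_ideal_powers_ideal Const_unit] by blast
    then show ?case using Suc.IH Suc.prems(1) by simp
  qed simp
  {
    case 0
    show ?case
      by (rule step[OF 0(1) _ 0(2)]) (use 0 lowering_homog_0[OF 0(1)] idl.subspace_0[OF is_ideal_powers_ideal] in auto)
  next
    case (Suc j)
    show ?case
    proof (rule step[OF Suc.prems(1,3,2)])
      fix m
      assume "linear_form a ^ Suc (Suc m) * lowering d a f \<in> powers_ideal d" "2 * Suc j + Suc m \<le> CARD('n) * (d - 1)"
      then show "lowering d a f \<in> powers_ideal d"
        using Suc.IH[of "lowering d a f" "Suc (Suc m)"] homog_lowering[OF Suc.prems(1), of d a] by simp
    qed
  }
qed

section \<open>Six linear forms on a twisted cubic\<close>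

lemma ideal_power_cong:
  assumes J: "is_ideal J" and "p - q \<in> J"
  shows "p ^ n - q ^ n \<in> J"
  unfolding power_diff_sumr2 by (rule is_ideal_mult_right[OF assms])

lemma ideal_power_mem_cong:
  assumes J: "is_ideal J" and "p - q \<in> J" "q ^ n \<in> J"
  shows "p ^ n \<in> J"
  using idl.subspace_add[OF J ideal_power_cong[OF assms(1,2), of n] assms(3)] by simp

lemma monomial_factor:
  assumes "total_deg m = Suc t"
  obtains i n where "total_deg n = t" "mon m b = Var i * (mon n b :: ('n::finite, 'k::field) mpoly)"
proof -
  have "\<exists>i. lkp m i > 0"
  proof (rule ccontr)
    assume "\<not> (\<exists>i. lkp m i > 0)"
    then have "total_deg m = 0" by (simp add: total_deg_def)
    then show False using assms by simp
  qed
  then obtain i where i: "lkp m i > 0" by blast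
  show ?thesis
    using that[of "m - mon i 1" i] total_deg_minus_single[OF i] minus_plus_single(2)[OF i] assms
    by (simp add: Var_mult_single)
qed

lemma coeff_linear_mult: "coeff ([:- a, 1:] * F) (Suc n) = coeff F n - a * coeff F (Suc n)"
  for F :: "'a::comm_ring_1 poly"
  by simp

text \<open>
  The coefficients of \<open>L\<close> are written as \<open>c\<^sub>i s\<^sub>i\<close>. The six forms \<open>x\<^sub>1, \<dots>, x\<^sub>5, L\<close> modulo \<open>ell = \<Sum>i. c\<^sub>i x\<^sub>i\<close> then lie on
  a twisted cubic with parameters \<open>s\<^sub>1, \<dots>, s\<^sub>5, \<infinity>\<close>.
\<close>

locale six_forms =
  fixes c s :: "'n::{finite,linorder} \<Rightarrow> 'k::field_char_0"
  assumes c: "\<And>i. c i \<noteq> 0" and s: "\<And>i. s i \<noteq> 0" and inj: "inj s" and n5: "CARD('n) = 5"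
begin

definition "ell = (linear_form c :: ('n, 'k) mpoly)"
definition "L = (linear_form (\<lambda>i. c i * s i) :: ('n, 'k) mpoly)"
definition "M = (linear_form (\<lambda>i. c i * s i ^ 2) :: ('n, 'k) mpoly)"
text \<open>
  The cubic is the curve: \<open>\<Sum>i. c\<^sub>i x\<^sub>i \<Prod>j\<noteq>i. (s - s\<^sub>j)\<close> without its term of degree four, which is a
  multiple of \<open>ell\<close>.
\<close>

definition "nodal = (\<Prod>j\<in>UNIV. [:- Const (s j), 1:] :: ('n, 'k) mpoly poly)"
definition "nodal_except i = (\<Prod>j\<in>- {i}. [:- Const (s j), 1:] :: ('n, 'k) mpoly poly)"
definition "cubic = (\<Sum>i\<in>UNIV. smult (Const (c i) * Var i) (nodal_except i)) - monom ell 4"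

lemma nodal_split: "nodal = [:- Const (s i), 1:] * nodal_except i"
  unfolding nodal_def nodal_except_def
  by (subst prod.remove[of UNIV i]) (auto simp: Compl_eq_Diff_UNIV)

lemma nodal_except_monic: "degree (nodal_except i) = 4" "coeff (nodal_except i) 4 = 1"
proof -
  have "inj_on (\<lambda>j. Const (s j) :: ('n, 'k) mpoly) (- {i})"
    using inj by (auto simp: inj_on_def)
  then have e: "nodal_except i = (\<Prod>a\<in>(\<lambda>j. Const (s j)) ` (- {i}). [:- a, 1:] ^ 1)"
    and "card ((\<lambda>j. Const (s j) :: ('n, 'k) mpoly) ` (- {i})) = 4"
    unfolding nodal_except_def using n5 by (simp_all add: prod.reindex card_image Compl_eq_Diff_UNIV card_Diff_singleton)
  then show "degree (nodal_except i) = 4"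
    using monic_prod_linear(1)[of "(\<lambda>j. Const (s j) :: ('n, 'k) mpoly) ` (- {i})" "\<lambda>_. 1"] by simp
  moreover have "lead_coeff (nodal_except i) = 1"
    unfolding e by (rule monic_prod_linear(2)) simp
  ultimately show "coeff (nodal_except i) 4 = 1" by simp
qed

text \<open>
  Comparison of coefficients in \<open>nodal = (s - s\<^sub>i) * nodal_except i\<close>, from the top downwards.
\<close>

lemma coeff_nodal_except:
  "coeff (nodal_except i) 3 = coeff nodal 4 + Const (s i)"
  "coeff (nodal_except i) 2 = coeff nodal 3 + Const (s i) * (coeff nodal 4 + Const (s i))"
proof -
  have "coeff nodal (Suc 3) = coeff (nodal_except i) 3 - Const (s i) * coeff (nodal_except i) (Suc 3)"
    unfolding nodal_split[of i] by (rule coeff_linear_mult)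
  then show 3: "coeff (nodal_except i) 3 = coeff nodal 4 + Const (s i)"
    using nodal_except_monic(2)[of i] by simp
  have "coeff nodal (Suc 2) = coeff (nodal_except i) 2 - Const (s i) * coeff (nodal_except i) (Suc 2)"
    unfolding nodal_split[of i] by (rule coeff_linear_mult)
  then show "coeff (nodal_except i) 2 = coeff nodal 3 + Const (s i) * (coeff nodal 4 + Const (s i))"
    using 3 by (simp add: numeral_3_eq_3)
qed

lemma ell_sum: "ell = (\<Sum>i\<in>UNIV. Const (c i) * Var i)"
  and L_sum: "L = (\<Sum>i\<in>UNIV. Const (c i) * Var i * Const (s i))"
  and M_sum: "M = (\<Sum>i\<in>UNIV. Const (c i) * Var i * (Const (s i) * Const (s i)))"
  unfolding ell_def L_def M_def linear_form_def
  by (auto intro!: sum.cong simp: Const_mult power2_eq_square mult_ac)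

lemma degree_cubic: "degree cubic \<le> 3"
proof (rule degree_le, intro allI impI)
  fix n :: nat assume "3 < n"
  then consider "n = 4" | "n > 4" by linarith
  then show "coeff cubic n = 0"
  proof cases
    case 1
    then show ?thesis by (simp add: cubic_def coeff_sum nodal_except_monic(2) ell_sum)
  next
    case 2
    then have "coeff (nodal_except i) n = 0" for i
      by (intro coeff_eq_0) (simp add: nodal_except_monic(1))
    then show ?thesis using 2 by (simp add: cubic_def coeff_sum)
  qed
qed

lemma coeff_cubic:
  "coeff cubic 3 = L + coeff nodal 4 * ell"
  "coeff cubic 2 = M + coeff nodal 4 * L + coeff nodal 3 * ell"
  by (simp_all add: cubic_def coeff_sum coeff_nodal_except ell_sum L_sum M_sum sum_distrib_left
      sum.distrib[symmetric] algebra_simps)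

lemma cubic_at_node:
  "\<exists>u. u dvd 1 \<and> poly cubic (Const (s i)) = Const (c i) * Var i * u - ell * Const (s i) ^ 4"
proof (intro exI conjI)
  let ?u = "\<Prod>j\<in>- {i}. Const (s i) - Const (s j) :: ('n, 'k) mpoly"
  show "?u dvd 1"
    using inj by (intro unit_prod) (auto simp flip: Const_diff intro!: Const_unit dest: injD)
  have "poly (nodal_except k) (Const (s i)) = (if k = i then ?u else 0)" for k
    unfolding nodal_except_def by (auto simp: poly_prod)
  then have "(\<Sum>k\<in>UNIV. Const (c k) * Var k * poly (nodal_except k) (Const (s i)))
      = (\<Sum>k\<in>UNIV. if k = i then Const (c i) * Var i * ?u else 0)"
    by (intro sum.cong refl) (simp only: mult_zero_right split: if_split, simp)
  then have "(\<Sum>k\<in>UNIV. Const (c k) * Var k * poly (nodal_except k) (Const (s i))) = Const (c i) * Var i * ?u"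
    by simp
  then show "poly cubic (Const (s i)) = Const (c i) * Var i * ?u - ell * Const (s i) ^ 4"
    by (simp add: cubic_def poly_sum poly_monom)
qed

definition "nodes = (\<lambda>i. Const (s i) :: ('n, 'k) mpoly) ` UNIV"

lemma card_nodes: "card nodes = 5"
  unfolding nodes_def using n5 inj by (subst card_image) (auto simp: inj_on_def)

lemma Const_apart: "a \<in> range Const \<Longrightarrow> b \<in> range Const \<Longrightarrow> a \<noteq> b \<Longrightarrow> (a - b :: ('n, 'k) mpoly) dvd 1"
  by (auto simp flip: Const_diff intro!: Const_unit)

lemma of_nat_unit: "n > 0 \<Longrightarrow> (of_nat n :: ('n, 'k) mpoly) dvd 1"
  unfolding Const_of_nat[symmetric] by (intro Const_unit) simp

text \<open>
  The ideal \<open>(x\<^sub>1\<^sup>d, \<dots>, x\<^sub>5\<^sup>d, L\<^sup>d)\<close> and the ideal \<open>(x\<^sub>1\<^sup>d, \<dots>, x\<^sub>5\<^sup>d, L\<^sup>e, ell)\<close>. The exponent \<open>e = d + 1\<close> serves to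
  isolate the coefficient of \<open>L\<^sup>d\<close> in a relation.
\<close>

definition "forms_ideal d = {f. \<exists>g. f - L ^ d * g \<in> powers_ideal d}"
definition "section_ideal d e = {f. \<exists>g h. f - L ^ e * g - ell * h \<in> powers_ideal d}"

lemma is_ideal_section_ideal: "is_ideal (section_ideal d e)"
proof (rule idl.subspaceI)
  show "0 \<in> section_ideal d e"
    unfolding section_ideal_def using idl.subspace_0[OF is_ideal_powers_ideal] by (auto intro!: exI[of _ 0])
  show "x + y \<in> section_ideal d e" if "x \<in> section_ideal d e" "y \<in> section_ideal d e" for x y
  proof -
    from that obtain g h g' h' where "x - L ^ e * g - ell * h \<in> powers_ideal d" "y - L ^ e * g' - ell * h' \<in> powers_ideal d"
      by (auto simp: section_ideal_def)
    from powers_ideal_add[OF this] show ?thesis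
      unfolding section_ideal_def by (intro CollectI exI[of _ "g + g'"] exI[of _ "h + h'"]) (simp add: algebra_simps)
  qed
  show "r * x \<in> section_ideal d e" if "x \<in> section_ideal d e" for r x
  proof -
    from that obtain g h where "x - L ^ e * g - ell * h \<in> powers_ideal d" by (auto simp: section_ideal_def)
    from powers_ideal_mult[OF this, of r] show ?thesis
      unfolding section_ideal_def by (intro CollectI exI[of _ "r * g"] exI[of _ "r * h"]) (simp add: algebra_simps)
  qed
qed

lemma powers_ideal_section_ideal: "f \<in> powers_ideal d \<Longrightarrow> f \<in> section_ideal d e"
  unfolding section_ideal_def by (auto intro!: exI[of _ 0])

lemma ell_section_ideal: "ell * h \<in> section_ideal d e"
  unfolding section_ideal_def using idl.subspace_0[OF is_ideal_powers_ideal]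
  by (intro CollectI exI[of _ 0] exI[of _ h]) simp

lemma L_section_ideal: "L ^ e * g \<in> section_ideal d e"
  unfolding section_ideal_def using idl.subspace_0[OF is_ideal_powers_ideal]
  by (intro CollectI exI[of _ g] exI[of _ 0]) simp

lemma cubic_zeros_section_ideal:
  assumes "a \<in> nodes"
  shows "poly cubic a ^ d \<in> section_ideal d e"
proof -
  obtain i where a: "a = Const (s i)" using assms by (auto simp: nodes_def)
  obtain u where u: "poly cubic a = Const (c i) * Var i * u - ell * Const (s i) ^ 4"
    using cubic_at_node a by blast
  show ?thesis
  proof (rule ideal_power_mem_cong[OF is_ideal_section_ideal])
    show "poly cubic a - Const (c i) * Var i * u \<in> section_ideal d e"
      unfolding u using ell_section_ideal[of "- (Const (s i) ^ 4)"] by simp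
    have "(Const (c i) * Var i * u) ^ d = Const (c i) ^ d * u ^ d * Var i ^ d"
      by (simp add: power_mult_distrib mult_ac)
    also have "\<dots> \<in> section_ideal d e"
      by (intro powers_ideal_section_ideal powers_ideal_mult Var_power_in_powers_ideal)
    finally show "(Const (c i) * Var i * u) ^ d \<in> section_ideal d e" .
  qed
qed

lemma cubic_top_section_ideal: "coeff cubic 3 ^ e \<in> section_ideal d e"
proof (rule ideal_power_mem_cong[OF is_ideal_section_ideal])
  show "coeff cubic 3 - L \<in> section_ideal d e"
    unfolding coeff_cubic using ell_section_ideal[of "coeff nodal 4"] by (simp add: mult.commute)
  show "L ^ e \<in> section_ideal d e" using L_section_ideal[of e 1] by simp
qed

text \<open>
  The last but one coefficient of the cubic is \<open>M\<close> up to multiples of \<open>L\<close> and \<open>ell\<close>. Such multiples may be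
  neglected, because in the product with \<open>L\<^sup>d\<close> they become multiples of \<open>L\<^sup>d\<^sup>+\<^sup>1\<close> and \<open>ell\<close>.
\<close>

lemma syzygy:
  assumes "d > 0"
  shows "L ^ d * M ^ (d - 1) \<in> section_ideal d (d + 1)"
proof -
  let ?J = "section_ideal d (d + 1)" and ?x = "coeff cubic 3" and ?y = "coeff cubic 2"
  note J = is_ideal_section_ideal[of d "d + 1"]
  have 1: "?x ^ d * ?y ^ (d - 1) \<in> ?J"
  proof (rule cubic_syzygy[OF J degree_cubic card_nodes])
    show "a - b dvd 1" if "a \<in> nodes" "b \<in> nodes" "a \<noteq> b" for a b
      using that by (intro Const_apart) (auto simp: nodes_def)
  qed (use cubic_zeros_section_ideal cubic_top_section_ideal[of "d + 1"] of_nat_unit assms in blast)+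
  have "?x - L \<in> ?J"
    unfolding coeff_cubic using ell_section_ideal[of "coeff nodal 4"] by (simp add: mult.commute)
  then have 2: "(?x ^ d - L ^ d) * ?y ^ (d - 1) \<in> ?J"
    by (intro is_ideal_mult_right J ideal_power_cong)
  define S where "S = (\<Sum>i<d - 1. M ^ (d - 1 - Suc i) * ?y ^ i)"
  have "L ^ d * (?y ^ (d - 1) - M ^ (d - 1)) = L ^ d * ((?y - M) * S)"
    unfolding S_def power_diff_sumr2 ..
  also have "\<dots> = L ^ (d + 1) * (coeff nodal 4 * S) + ell * (coeff nodal 3 * L ^ d * S)"
    unfolding coeff_cubic by (simp add: algebra_simps)
  also have "\<dots> \<in> ?J" by (intro idl.subspace_add[OF J] L_section_ideal ell_section_ideal)
  finally have 3: "L ^ d * (?y ^ (d - 1) - M ^ (d - 1)) \<in> ?J" .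
  have "L ^ d * M ^ (d - 1) = ?x ^ d * ?y ^ (d - 1) - (?x ^ d - L ^ d) * ?y ^ (d - 1) - L ^ d * (?y ^ (d - 1) - M ^ (d - 1))"
    by (simp add: algebra_simps)
  also have "\<dots> \<in> ?J" by (intro idl.subspace_diff[OF J] 1 2 3)
  finally show ?thesis .
qed

lemma homog_ell: "homog 1 ell" and homog_L: "homog 1 L" and homog_M: "homog 1 M"
  by (auto simp: ell_def L_def M_def homog_linear_form[simplified])

lemma homog_L_power: "homog n (L ^ n)" and homog_M_power: "homog n (M ^ n)"
  using homog_power[OF homog_L, of n] homog_power[OF homog_M, of n] by simp_all

lemma homog_syzygy:
  assumes d: "d \<ge> 2"
  obtains g f where "homog (d - 2) g" "homog (2 * d - 2) f"
    "L ^ d * M ^ (d - 1) - L ^ (d + 1) * g - ell * f \<in> powers_ideal d"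
proof -
  obtain g f where gf: "L ^ d * M ^ (d - 1) - L ^ (d + 1) * g - ell * f \<in> powers_ideal d"
    using syzygy[of d] d by (auto simp: section_ideal_def)
  have h: "homog (2 * d - 1) (L ^ d * M ^ (d - 1))"
    using homog_mult[OF homog_L_power homog_M_power, of d "d - 1"] d by (simp add: mult_2)
  have "hom_part (2 * d - 1) (L ^ d * M ^ (d - 1) - L ^ (d + 1) * g - ell * f) \<in> powers_ideal d"
    by (rule hom_part_powers_ideal[OF gf])
  moreover have "hom_part (2 * d - 1) (L ^ d * M ^ (d - 1)) = L ^ d * M ^ (d - 1)"
    using hom_part_homog[OF h, of "2 * d - 1"] by simp
  moreover have "hom_part (2 * d - 1) (L ^ (d + 1) * g) = L ^ (d + 1) * hom_part (d - 2) g"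
  proof -
    have "2 * d - 1 = d - 2 + (d + 1)" using d by simp
    then show ?thesis using hom_part_mult[OF homog_L_power[of "d + 1"], of "d - 2" g] by (metis mult.commute)
  qed
  moreover have "hom_part (2 * d - 1) (ell * f) = ell * hom_part (2 * d - 2) f"
  proof -
    have "2 * d - 1 = 2 * d - 2 + 1" using d by simp
    then show ?thesis using hom_part_mult[OF homog_ell, of "2 * d - 2" f] by (simp add: mult.commute)
  qed
  ultimately show ?thesis
    using that[OF homog_hom_part[of "d - 2" g] homog_hom_part[of "2 * d - 2" f]] by (simp add: hom_part_diff)
qed

lemma forms_ideal_homog:
  assumes f: "f \<in> forms_ideal d" "homog t f" and "t \<ge> d"
  obtains g where "homog (t - d) g" "f - L ^ d * g \<in> powers_ideal d"
proof -
  obtain g where g: "f - L ^ d * g \<in> powers_ideal d" using f by (auto simp: forms_ideal_def)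
  have "hom_part t (L ^ d * g) = L ^ d * hom_part (t - d) g"
    using hom_part_mult[OF homog_L_power[of d], of "t - d" g] assms(3) by (simp add: mult.commute)
  then have "f - L ^ d * hom_part (t - d) g \<in> powers_ideal d"
    using hom_part_powers_ideal[OF g, of t] hom_part_homog[OF f(2), of t] by (simp add: hom_part_diff)
  with that[OF homog_hom_part] show ?thesis by blast
qed

lemma three_indices: "\<exists>p q r :: 'n. distinct [p, q, r]"
proof -
  obtain S :: "'n set" where "card S = 3" using obtain_subset_with_card_n[of 3 "UNIV :: 'n set"] n5 by auto
  then show ?thesis by (auto simp: card_3_iff)
qed

text \<open>
  A Vandermonde determinant: on the coordinates \<open>p, q, r\<close> the forms \<open>ell, L, M\<close> have the coefficients \<open>1, s, s\<^sup>2\<close>, up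
  to the factors \<open>c\<close>. The point is, up to sign and these factors, the cross product of the first two rows.
\<close>

lemma separating_point:
  "\<exists>x. eval_mpoly ell x = 0 \<and> eval_mpoly L x = 0 \<and> eval_mpoly M x \<noteq> 0"
proof -
  obtain p q r :: 'n where pqr: "distinct [p, q, r]" using three_indices by blast
  define x where "x i = (if i = p then (s q - s r) / c p else if i = q then (s r - s p) / c q
    else if i = r then (s p - s q) / c r else 0)" for i
  have sum: "(\<Sum>i\<in>UNIV. c i * w i * x i) = w p * (s q - s r) + w q * (s r - s p) + w r * (s p - s q)" for w
  proof -
    have "(\<Sum>i\<in>UNIV. c i * w i * x i) = (\<Sum>i\<in>{p, q, r}. c i * w i * x i)"
      by (rule sum.mono_neutral_right) (auto simp: x_def)
    also have "\<dots> = w p * (s q - s r) + w q * (s r - s p) + w r * (s p - s q)"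
    proof -
      have "p \<noteq> q" "q \<noteq> p" "p \<noteq> r" "r \<noteq> p" "q \<noteq> r" "r \<noteq> q" using pqr by auto
      then show ?thesis using c by (simp add: x_def mult_ac)
    qed
    finally show ?thesis .
  qed
  have "eval_mpoly ell x = 0" using sum[of "\<lambda>_. 1"] by (simp add: ell_def algebra_simps)
  moreover have "eval_mpoly L x = 0" using sum[of s] by (simp add: L_def algebra_simps)
  moreover have "eval_mpoly M x = - ((s p - s q) * (s q - s r) * (s r - s p))"
    using sum[of "\<lambda>i. s i ^ 2"] by (simp add: M_def power2_eq_square algebra_simps)
  moreover have "(s p - s q) * (s q - s r) * (s r - s p) \<noteq> 0"
    using pqr inj by (auto dest: injD)
  ultimately show ?thesis by (intro exI[of _ x]) simp
qed

text \<open>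
  The element killed by \<open>ell\<close> is the cofactor of \<open>ell\<close> in the syzygy. If it were in the ideal, \<open>L\<^sup>d\<close> times a
  form \<open>k\<close> of degree \<open>d - 1\<close>, congruent to \<open>M\<^sup>d\<^sup>-\<^sup>1\<close> modulo \<open>L\<close> and \<open>ell\<close>, would lie in \<open>(x\<^sub>i\<^sup>d)\<close>. By the strong Lefschetz
  property \<open>k\<close> itself would, so \<open>k = 0\<close> for degree reasons; but \<open>M\<close> is not in the span of \<open>L\<close> and \<open>ell\<close>.
\<close>

lemma not_injective:
  assumes d: "d \<ge> 2"
  shows "\<exists>f. homog (2 * d - 2) f \<and> ell * f \<in> forms_ideal d \<and> f \<notin> forms_ideal d"
proof -
  obtain g f where gf: "homog (d - 2) g" "homog (2 * d - 2) f"
    "L ^ d * M ^ (d - 1) - L ^ (d + 1) * g - ell * f \<in> powers_ideal d"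
    using homog_syzygy[OF d] by blast
  have "ell * f - L ^ d * (M ^ (d - 1) - L * g) = - 1 * (L ^ d * M ^ (d - 1) - L ^ (d + 1) * g - ell * f)"
    by (simp add: algebra_simps)
  also have "\<dots> \<in> powers_ideal d" by (rule powers_ideal_mult[OF gf(3)])
  finally have 1: "ell * f \<in> forms_ideal d" unfolding forms_ideal_def by blast
  have 2: "f \<notin> forms_ideal d"
  proof
    assume "f \<in> forms_ideal d"
    moreover have "2 * d - 2 \<ge> d" using d by simp
    ultimately obtain h where h: "homog (2 * d - 2 - d) h" "f - L ^ d * h \<in> powers_ideal d"
      using forms_ideal_homog gf(2) by blast
    have h2: "homog (d - 2) h" using h(1) by (simp add: mult_2)
    let ?k = "M ^ (d - 1) - L * g - ell * h"
    have e: "1 + (d - 2) = d - 1" using d by simp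
    have hk: "homog (d - 1) ?k"
      using homog_mult[OF homog_L gf(1)] homog_mult[OF homog_ell h2] unfolding e
      by (intro homog_diff homog_M_power)
    have "L ^ d * ?k = (L ^ d * M ^ (d - 1) - L ^ (d + 1) * g - ell * f) + ell * (f - L ^ d * h)"
      by (simp add: algebra_simps)
    also have "\<dots> \<in> powers_ideal d" by (intro powers_ideal_add gf(3) powers_ideal_mult h(2))
    finally have "L ^ d * ?k \<in> powers_ideal d" .
    then have "?k \<in> powers_ideal d"
      unfolding L_def using c s d n5 by (intro strong_lefschetz_powers[OF _ _ hk[unfolded L_def], where m = d]) auto
    then have k0: "?k = 0" using powers_ideal_low_degree[OF _ hk] d by simp
    obtain x where "eval_mpoly ell x = 0" "eval_mpoly L x = 0" "eval_mpoly M x \<noteq> 0"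
      using separating_point by blast
    moreover have "eval_mpoly ?k x = 0" unfolding k0 by simp
    ultimately show False by simp
  qed
  show ?thesis using gf(2) 1 2 by blast
qed

text \<open>
  Modulo \<open>ell\<close> the variable \<open>x\<^sub>i\<close> is a unit times the value of the cubic at \<open>s\<^sub>i\<close>.
\<close>

lemma Vars_from_cubic:
  assumes K: "is_ideal K" "section_ideal d e \<subseteq> K" "coeffs_in K cubic"
  shows "range Var \<subseteq> K"
proof clarify
  fix i
  obtain u where u: "u dvd 1" "poly cubic (Const (s i)) = Const (c i) * Var i * u - ell * Const (s i) ^ 4"
    using cubic_at_node by blast
  have "poly cubic (Const (s i)) + ell * Const (s i) ^ 4 \<in> K"
    using poly_in_ideal[OF K(1,3)] ell_section_ideal K(2) by (intro idl.subspace_add[OF K(1)]) auto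
  then have "u * (Const (c i) * Var i) \<in> K" unfolding u(2) by (simp add: mult_ac)
  then show "Var i \<in> K"
    using is_ideal_unit_cancel[OF K(1)] u(1) Const_unit[OF c[of i]] by blast
qed

lemma cubic_zeros_locale:
  assumes "d > 0"
  shows "cubic_zeros (section_ideal d d) cubic nodes (range Const) (range Var) d"
proof
  show "infinite (range Const :: ('n, 'k) mpoly set)"
    using infinite_UNIV_char_0[where 'a='k] by (simp add: finite_image_iff inj_def)
qed (use is_ideal_section_ideal degree_cubic Const_apart card_nodes cubic_zeros_section_ideal cubic_top_section_ideal
    of_nat_unit assms Vars_from_cubic in \<open>auto simp: nodes_def\<close>)

lemma surjective_small:
  assumes "d \<in> {1, 2, 3}" and f: "homog t f" and t: "t \<ge> 2 * d - 1"
  shows "f \<in> section_ideal d d"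
proof -
  note J = is_ideal_section_ideal[of d d]
  have "mon m b \<in> section_ideal d d" if m: "total_deg m = t" for m b
  proof -
    consider "d = 1" | "d = 2" | "d = 3" using assms(1) by auto
    then show ?thesis
    proof cases
      case 1
      then obtain t' where "t = Suc t'" using t by (cases t) auto
      then obtain i n where i: "mon m b = Var i * mon n b" using monomial_factor m by metis
      have "Var i \<in> powers_ideal 1" using Var_power_in_powers_ideal[of i 1] by simp
      then show ?thesis unfolding i 1 using powers_ideal_section_ideal powers_ideal_mult_right by blast
    next
      case 2
      interpret cubic_zeros "section_ideal d d" cubic nodes "range Const" "range Var" d
        by (rule cubic_zeros_locale) (simp add: 2)
      have "t \<ge> 3" using t 2 by simp
      then obtain t' where "t = 3 + t'" using le_Suc_ex by blast
      then have t': "t = Suc (Suc (Suc t'))" by simp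
      obtain i1 n1 where 1: "total_deg n1 = Suc (Suc t')" "mon m b = Var i1 * mon n1 b"
        using monomial_factor m t' by metis
      obtain i2 n2 where 2: "total_deg n2 = Suc t'" "mon n1 b = Var i2 * mon n2 b"
        using monomial_factor 1 by metis
      obtain i3 n3 where 3: "mon n2 b = Var i3 * mon n3 b"
        using monomial_factor 2 by metis
      have "Var i1 * Var i2 * Var i3 * mon n3 b \<in> section_ideal d d"
        by (intro is_ideal_mult_right[OF J] products_in_ideal_2) (use \<open>d = 2\<close> in auto)
      then show ?thesis unfolding 1 2 3 by (simp add: mult_ac)
    next
      case 3
      interpret cubic_zeros "section_ideal d d" cubic nodes "range Const" "range Var" d
        by (rule cubic_zeros_locale) (simp add: 3)
      have "t \<ge> 5" using t 3 by simp
      then obtain t' where "t = 5 + t'" using le_Suc_ex by blast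
      then have t': "t = Suc (Suc (Suc (Suc (Suc t'))))" by simp
      obtain i1 n1 where 1: "total_deg n1 = Suc (Suc (Suc (Suc t')))" "mon m b = Var i1 * mon n1 b"
        using monomial_factor m t' by metis
      obtain i2 n2 where 2: "total_deg n2 = Suc (Suc (Suc t'))" "mon n1 b = Var i2 * mon n2 b"
        using monomial_factor 1 by metis
      obtain i3 n3 where 3: "total_deg n3 = Suc (Suc t')" "mon n2 b = Var i3 * mon n3 b"
        using monomial_factor 2 by metis
      obtain i4 n4 where 4: "total_deg n4 = Suc t'" "mon n3 b = Var i4 * mon n4 b"
        using monomial_factor 3 by metis
      obtain i5 n5 where 5: "mon n4 b = Var i5 * mon n5 b"
        using monomial_factor 4 by metis
      have "Var i1 * Var i2 * Var i3 * Var i4 * Var i5 * mon n5 b \<in> section_ideal d d"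
        by (intro is_ideal_mult_right[OF J] products_in_ideal_3) (use \<open>d = 3\<close> in auto)
      then show ?thesis unfolding 1 2 3 4 5 by (simp add: mult_ac)
    qed
  qed
  then have "(\<Sum>m\<in>supp f. mon m (lkp f m)) \<in> section_ideal d d"
    using f by (intro idl.subspace_sum[OF J]) (auto simp: homog_def)
  then show ?thesis by (simp add: sum_of_terms)
qed

end

section \<open>Injectivity for small exponents\<close>

text \<open>
  The mixed fourth difference at the origin, which extracts the part that is linear in each argument. For the
  restriction of a quartic form to combinations of four vectors it computes the
  polarization of the form.
\<close>

definition mixed_difference :: "('a \<Rightarrow> 'a \<Rightarrow> 'a \<Rightarrow> 'a \<Rightarrow> 'a::comm_ring_1) \<Rightarrow> 'a" where
  "mixed_difference F = F 1 1 1 1 - F 1 1 1 0 - F 1 1 0 1 - F 1 0 1 1 - F 0 1 1 1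
    + F 1 1 0 0 + F 1 0 1 0 + F 1 0 0 1 + F 0 1 1 0 + F 0 1 0 1 + F 0 0 1 1
    - F 1 0 0 0 - F 0 1 0 0 - F 0 0 1 0 - F 0 0 0 1 + F 0 0 0 0"

lemma mixed_difference_add: "mixed_difference (\<lambda>x y z w. F x y z w + G x y z w) = mixed_difference F + mixed_difference G"
  by (simp add: mixed_difference_def)

lemma mixed_difference_sum: "mixed_difference (\<lambda>x y z w. \<Sum>i\<in>A. F i x y z w) = (\<Sum>i\<in>A. mixed_difference (F i))"
  by (induction A rule: infinite_finite_induct) (auto simp: mixed_difference_add, simp_all add: mixed_difference_def)

lemma mixed_difference_linear_cube:
  "mixed_difference (\<lambda>x y z w. (x * g1 + y * g2 + z * g3 + w * g4) * (x * l1 + y * l2 + z * l3 + w * l4) ^ 3)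
    = 6 * (g1 * l2 * l3 * l4 + l1 * g2 * l3 * l4 + l1 * l2 * g3 * l4 + l1 * l2 * l3 * g4)"
  by (simp add: mixed_difference_def power3_eq_cube algebra_simps)

text \<open>
  A quartic form \<open>h l\<^sup>3 + \<Sum>i. G\<^sub>i x\<^sub>i\<^sup>3\<close> that vanishes on a hyperplane has vanishing polarization there. Each term
  of the polarization of \<open>G\<^sub>i x\<^sub>i\<^sup>3\<close> contains the \<open>i\<close>-th coordinates of three of the four vectors, so it is zero
  if two of these coordinates are zero, and only the contribution of \<open>h l\<^sup>3\<close> remains.
\<close>

lemma polarized_quartic:
  fixes h l :: "'n::finite \<Rightarrow> 'k::field_char_0" and G :: "'n \<Rightarrow> 'n \<Rightarrow> 'k" and u1 u2 u3 u4 :: "'n \<Rightarrow> 'k"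
  defines "ev b x \<equiv> (\<Sum>i\<in>UNIV. b i * x i)"
  assumes zero: "\<And>x. ev c x = 0 \<Longrightarrow> ev h x * ev l x ^ 3 + (\<Sum>i\<in>UNIV. ev (G i) x * x i ^ 3) = 0"
    and u: "ev c u1 = 0" "ev c u2 = 0" "ev c u3 = 0" "ev c u4 = 0"
    and two: "\<And>i. (u1 i = 0 \<and> u2 i = 0) \<or> (u1 i = 0 \<and> u3 i = 0) \<or> (u1 i = 0 \<and> u4 i = 0)
      \<or> (u2 i = 0 \<and> u3 i = 0) \<or> (u2 i = 0 \<and> u4 i = 0) \<or> (u3 i = 0 \<and> u4 i = 0)"
  shows "ev h u1 * ev l u2 * ev l u3 * ev l u4 + ev l u1 * ev h u2 * ev l u3 * ev l u4
    + ev l u1 * ev l u2 * ev h u3 * ev l u4 + ev l u1 * ev l u2 * ev l u3 * ev h u4 = 0"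
proof -
  define v where "v x y z w = (\<lambda>i. x * u1 i + y * u2 i + z * u3 i + w * u4 i)" for x y z w
  have ev_v: "ev b (v x y z w) = x * ev b u1 + y * ev b u2 + z * ev b u3 + w * ev b u4" for b x y z w
    by (simp add: ev_def v_def algebra_simps sum.distrib sum_distrib_left)
  have "mixed_difference (\<lambda>x y z w. ev h (v x y z w) * ev l (v x y z w) ^ 3
    + (\<Sum>i\<in>UNIV. ev (G i) (v x y z w) * v x y z w i ^ 3)) = 0"
    using zero[of "v _ _ _ _"] u by (simp add: mixed_difference_def ev_v)
  moreover have "mixed_difference (\<lambda>x y z w. ev (G i) (v x y z w) * v x y z w i ^ 3) = 0" for i
    unfolding ev_v unfolding v_def mixed_difference_linear_cube using two[of i] by auto
  ultimately have "mixed_difference (\<lambda>x y z w. ev h (v x y z w) * ev l (v x y z w) ^ 3) = 0"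
    by (simp add: mixed_difference_add mixed_difference_sum)
  then show ?thesis unfolding ev_v mixed_difference_linear_cube mult_eq_0_iff by simp
qed

text \<open>
  In the complete graph on four vertices the union of two perfect matchings is a \<open>4\<close>-cycle, and there are three matchings; so
  each matching has sum zero, that is, disjoint edges carry opposite values. With five vertices there is a closed
  chain of five edges in which consecutive ones are disjoint, and the value changes its sign an odd number of times.
\<close>

lemma four_cycles_zero:
  fixes \<phi> :: "'n::finite \<Rightarrow> 'n \<Rightarrow> 'k::field_char_0"
  assumes n5: "CARD('n) = 5" and sym: "\<And>p q. \<phi> p q = \<phi> q p"
    and cycle: "\<And>p q r w. distinct [p, q, r, w] \<Longrightarrow> \<phi> p q + \<phi> q r + \<phi> r w + \<phi> w p = 0"
    and "p \<noteq> q"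
  shows "\<phi> p q = 0"
proof -
  \<comment> \<open>Twice the sum over a matching is the sum of the two cycles containing it minus the third cycle.\<close>
  have opp: "\<phi> p q = - \<phi> r w" if "distinct [p, q, r, w]" for p q r w
  proof -
    have "\<phi> p q + \<phi> q r + \<phi> r w + \<phi> w p = 0" "\<phi> p q + \<phi> q w + \<phi> w r + \<phi> r p = 0"
      "\<phi> p r + \<phi> r q + \<phi> q w + \<phi> w p = 0"
      using that by (auto intro!: cycle)
    moreover have "2 * (\<phi> p q + \<phi> r w) = (\<phi> p q + \<phi> q r + \<phi> r w + \<phi> w p)
        + (\<phi> p q + \<phi> q w + \<phi> w r + \<phi> r p) - (\<phi> p r + \<phi> r q + \<phi> q w + \<phi> w p)"
      using sym[of r p] sym[of r q] sym[of w r] by simp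
    ultimately have "2 * (\<phi> p q + \<phi> r w) = 0" by simp
    then show ?thesis by (simp add: add_eq_0_iff2)
  qed
  have "card (- {p, q}) = 3" using n5 \<open>p \<noteq> q\<close> by (simp add: Compl_eq_Diff_UNIV card_Diff_subset)
  then obtain r w v where rwv: "- {p, q} = {r, w, v}" "distinct [r, w, v]" by (auto simp: card_3_iff)
  then have "r \<notin> {p, q}" "w \<notin> {p, q}" "v \<notin> {p, q}" by auto
  then have d: "distinct [p, q, r, w]" "distinct [r, w, v, p]" "distinct [v, p, q, r]" "distinct [q, r, w, v]"
      "distinct [w, v, p, q]"
    using rwv(2) \<open>p \<noteq> q\<close> by auto
  have "\<phi> p q = - \<phi> p q"
    using opp[OF d(1)] opp[OF d(2)] opp[OF d(3)] opp[OF d(4)] opp[OF d(5)] by simp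
  then show ?thesis by simp
qed

context six_forms
begin

text \<open>
  These vectors span the hyperplane \<open>ell = 0\<close>, and each has only two nonzero coordinates. The edges of a \<open>4\<close>-cycle are four
  vectors as they are needed in \<open>polarized_quartic\<close>.
\<close>

definition "edge p q i = (if i = p then 1 / c p else if i = q then - 1 / c q else 0)"

lemma ev_edge:
  assumes "p \<noteq> q"
  shows "(\<Sum>i\<in>UNIV. b i * edge p q i) = b p / c p - b q / c q"
proof -
  have "(\<Sum>i\<in>UNIV. b i * edge p q i) = (\<Sum>i\<in>{p, q}. b i * edge p q i)"
    by (rule sum.mono_neutral_right) (auto simp: edge_def)
  then show ?thesis using assms by (simp add: edge_def)
qed

text \<open>
  Polarization along a \<open>4\<close>-cycle shows that the quotients \<open>h(u)/L(u)\<close>, over the edge vectors \<open>u\<close> of the cycle, add up to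
  zero. Hence \<open>h\<close> vanishes on all edge vectors, that is, on the hyperplane \<open>ell = 0\<close>.
\<close>

lemma cofactor_multiple_of_ell:
  assumes h: "homog 1 h" and f: "homog 3 f" and m: "ell * f - L ^ 3 * h \<in> powers_ideal 3"
  shows "\<exists>\<kappa>. h = Const \<kappa> * ell"
proof -
  obtain \<eta> where \<eta>: "h = linear_form \<eta>" using homog_1_eq_linear_form[OF h] by blast
  have "homog 4 (ell * f - L ^ 3 * h)"
    using homog_mult[OF homog_ell f] homog_mult[OF homog_L_power h, of 3] by (intro homog_diff) simp_all
  then obtain G where G: "ell * f - L ^ 3 * h = (\<Sum>i\<in>UNIV. G i * Var i ^ 3)" "\<And>i. homog 1 (G i)"
    using powers_ideal_homog_expansion[OF m, of 4] by auto
  have "\<exists>b. \<forall>i. G i = linear_form (b i)" using homog_1_eq_linear_form[OF G(2)] by metis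
  then obtain b where b: "\<And>i. G i = linear_form (b i)" by blast
  define ev where "ev b x = (\<Sum>i\<in>UNIV. b i * x i)" for b x :: "'n \<Rightarrow> 'k"
  define l where "l i = c i * s i" for i
  have zero: "ev \<eta> x * ev l x ^ 3 + (\<Sum>i\<in>UNIV. ev (b i) x * x i ^ 3) = 0" if "ev c x = 0" for x
  proof -
    have "eval_mpoly (ell * f - L ^ 3 * h) x = eval_mpoly (\<Sum>i\<in>UNIV. G i * Var i ^ 3) x"
      unfolding G(1) ..
    then show ?thesis
      using that unfolding \<eta> b by (simp add: ell_def L_def ev_def l_def algebra_simps)
  qed
  define \<theta> where "\<theta> i = \<eta> i / c i" for i
  define \<phi> where "\<phi> p q = (\<theta> p - \<theta> q) / (s p - s q)" for p q
  have e: "ev \<eta> (edge p q) = \<theta> p - \<theta> q" "ev l (edge p q) = s p - s q" "ev c (edge p q) = 0" if "p \<noteq> q" for p q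
    unfolding ev_def \<theta>_def l_def using ev_edge[OF that] c by simp_all
  have cycle: "\<phi> p q + \<phi> q r + \<phi> r w + \<phi> w p = 0" if d: "distinct [p, q, r, w]" for p q r w
  proof -
    have ne: "p \<noteq> q" "q \<noteq> r" "r \<noteq> w" "w \<noteq> p" using d by auto
    have "ev \<eta> (edge p q) * ev l (edge q r) * ev l (edge r w) * ev l (edge w p)
      + ev l (edge p q) * ev \<eta> (edge q r) * ev l (edge r w) * ev l (edge w p)
      + ev l (edge p q) * ev l (edge q r) * ev \<eta> (edge r w) * ev l (edge w p)
      + ev l (edge p q) * ev l (edge q r) * ev l (edge r w) * ev \<eta> (edge w p) = 0"
      unfolding ev_def
    proof (rule polarized_quartic[where c = c and G = b])
      show "(\<Sum>i\<in>UNIV. c i * edge p q i) = 0" "(\<Sum>i\<in>UNIV. c i * edge q r i) = 0"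
        "(\<Sum>i\<in>UNIV. c i * edge r w i) = 0" "(\<Sum>i\<in>UNIV. c i * edge w p i) = 0"
        using e(3)[OF ne(1)] e(3)[OF ne(2)] e(3)[OF ne(3)] e(3)[OF ne(4)] unfolding ev_def by blast+
    qed (use zero[unfolded ev_def] ne d in \<open>auto simp: edge_def\<close>)
    moreover have "s p - s q \<noteq> 0" "s q - s r \<noteq> 0" "s r - s w \<noteq> 0" "s w - s p \<noteq> 0"
      using ne inj by (auto dest: injD)
    moreover have "A / a + B / b' + C / c' + D / d' = 0"
      if "A * b' * c' * d' + a * B * c' * d' + a * b' * C * d' + a * b' * c' * D = 0"
        "a \<noteq> 0" "b' \<noteq> 0" "c' \<noteq> 0" "d' \<noteq> 0" for A B C D a b' c' d' :: 'k
      using that by (simp add: field_simps)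
    ultimately show ?thesis unfolding \<phi>_def e[OF ne(1)] e[OF ne(2)] e[OF ne(3)] e[OF ne(4)] by blast
  qed
  have sym: "\<phi> p q = \<phi> q p" for p q
    unfolding \<phi>_def by (metis minus_diff_eq minus_divide_divide)
  have const: "\<theta> p = \<theta> q" for p q
  proof (cases "p = q")
    case False
    have "\<phi> p q = 0" by (rule four_cycles_zero[where \<phi> = \<phi>]; fact n5 sym cycle False)
    moreover have "s p - s q \<noteq> 0" using False inj by (auto dest: injD)
    ultimately show ?thesis by (simp add: \<phi>_def)
  qed simp
  obtain p :: 'n where True by blast
  have "\<eta> i = \<theta> p * c i" for i
    using const[of i p] c[of i] by (simp add: \<theta>_def field_simps)
  then have "h = Const (\<theta> p) * ell"
    unfolding \<eta> ell_def linear_form_def sum_distrib_left by (simp add: Const_mult mult.assoc)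
  then show ?thesis by blast
qed

text \<open>
  After multiplication by a variable the preceding lemma applies, and a nonzero multiple of a single variable is not a
  multiple of \<open>ell\<close>.
\<close>

lemma constant_cofactor_zero_cubes:
  assumes f: "homog 2 f" and m: "ell * f - L ^ 3 * Const \<eta> \<in> powers_ideal 3"
  shows "\<eta> = 0"
proof -
  obtain p q r :: 'n where pqr: "distinct [p, q, r]" using three_indices by blast
  have "homog 1 (Const \<eta> * Var p)" by (rule homog_Const_mult[OF homog_Var])
  moreover have "homog 3 (f * Var p)" using homog_mult[OF f homog_Var[of p]] by simp
  moreover have "ell * (f * Var p) - L ^ 3 * (Const \<eta> * Var p) \<in> powers_ideal 3"
    using powers_ideal_mult_right[OF m, of "Var p"] by (simp add: algebra_simps)
  ultimately obtain \<kappa> where \<kappa>: "Const \<eta> * Var p = Const \<kappa> * ell"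
    using cofactor_multiple_of_ell by blast
  have ev: "eval_mpoly (Const \<eta> * Var p) x = eval_mpoly (Const \<kappa> * ell) x" for x
    unfolding \<kappa> ..
  have "\<kappa> * c q = 0"
    using ev[of "\<lambda>i. if i = q then 1 else 0"] pqr by (simp add: ell_def if_distrib cong: if_cong)
  then have "\<kappa> = 0" using c by simp
  then show ?thesis using ev[of "\<lambda>_. 1"] by simp
qed

text \<open>
  Polarization of a quadratic form at two edge vectors with disjoint supports: the squares of the
  variables contribute nothing.
\<close>

lemma constant_cofactor_zero_squares:
  assumes f: "homog 1 f" and m: "ell * f - L ^ 2 * Const \<eta> \<in> powers_ideal 2"
  shows "\<eta> = 0"
proof -
  have "homog 2 (ell * f - L ^ 2 * Const \<eta>)"
    using homog_mult[OF homog_ell f] homog_mult[OF homog_L_power homog_Const, of 2 \<eta>] 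
    by (intro homog_diff) (simp_all add: numeral_2_eq_2)
  then obtain G where G: "ell * f - L ^ 2 * Const \<eta> = (\<Sum>i\<in>UNIV. G i * Var i ^ 2)" "\<And>i. homog 0 (G i)"
    using powers_ideal_homog_expansion[OF m, of 2] by auto
  have "\<exists>b. \<forall>i. G i = Const (b i)" using homog_0_eq_Const[OF G(2)] by metis
  then obtain b where b: "\<And>i. G i = Const (b i)" by blast
  define F where "F x = eval_mpoly L x ^ 2 * \<eta> + (\<Sum>i\<in>UNIV. b i * x i ^ 2)" for x
  have zero: "F x = 0" if "eval_mpoly ell x = 0" for x
  proof -
    have "eval_mpoly (ell * f - L ^ 2 * Const \<eta>) x = eval_mpoly (\<Sum>i\<in>UNIV. G i * Var i ^ 2) x"
      unfolding G(1) ..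
    then have "- (eval_mpoly L x ^ 2 * \<eta>) = (\<Sum>i\<in>UNIV. b i * x i ^ 2)"
      using that unfolding b by simp
    then show ?thesis unfolding F_def by (metis add.right_inverse)
  qed
  have "card (UNIV :: 'n set) \<ge> 4" using n5 by simp
  then obtain S :: "'n set" where S: "card S = 4" using obtain_subset_with_card_n by blast
  then obtain p S' where p: "S = insert p S'" "p \<notin> S'" "card S' = 3"
    by (metis card_Suc_eq eval_nat_numeral(2) semiring_norm(26,27) numeral_3_eq_3)
  then obtain q r w where pqrw: "distinct [p, q, r, w]" by (auto simp: card_3_iff)
  let ?u = "edge p q" and ?v = "edge r w" and ?uv = "\<lambda>i. edge p q i + edge r w i"
  have L: "eval_mpoly L ?u = s p - s q" "eval_mpoly L ?v = s r - s w"
    and e: "eval_mpoly ell ?u = 0" "eval_mpoly ell ?v = 0"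
    using pqrw c by (simp_all add: L_def ell_def ev_edge)
  have add: "eval_mpoly L ?uv = eval_mpoly L ?u + eval_mpoly L ?v"
    "eval_mpoly ell ?uv = eval_mpoly ell ?u + eval_mpoly ell ?v"
    by (simp_all add: L_def ell_def distrib_left sum.distrib)
  have orth: "?u i * ?v i = 0" for i using pqrw by (auto simp: edge_def)
  have sq: "b i * ?uv i ^ 2 = b i * ?u i ^ 2 + b i * ?v i ^ 2" for i
    using orth[of i] by (simp add: power2_eq_square algebra_simps)
  have "F ?uv = F ?u + F ?v + 2 * \<eta> * (s p - s q) * (s r - s w)"
    unfolding F_def sq sum.distrib add L by (simp add: power2_eq_square algebra_simps)
  moreover have "F ?uv = 0" "F ?u = 0" "F ?v = 0" using zero e add by simp_all
  moreover have "s p - s q \<noteq> 0" "s r - s w \<noteq> 0" using pqrw inj by (auto dest: injD)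
  ultimately show ?thesis by simp
qed

text \<open>
  Once the cofactor of \<open>L\<^sup>d\<close> in \<open>ell f\<close> is known to be a multiple of \<open>ell\<close>, a multiple of \<open>L\<^sup>d\<close> can be subtracted from
  \<open>f\<close>, and what remains is killed by \<open>ell\<close> modulo \<open>(x\<^sub>i\<^sup>d)\<close>. There \<open>ell\<close> is injective in degrees \<open>t\<close> with \<open>2 t + 1 \<le> 5 (d - 1)\<close>.
\<close>

lemma injective_small:
  assumes d: "d \<in> {1, 2, 3}" and f: "homog t f" and t: "t + 3 \<le> 2 * d" and m: "ell * f \<in> forms_ideal d"
  shows "f \<in> forms_ideal d"
proof -
  have d0: "d > 0" using d by auto
  have lef: "g \<in> powers_ideal d" if "homog t g" "ell * g \<in> powers_ideal d" for g
  proof (rule strong_lefschetz_powers[of c d t g 1])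
    show "linear_form c ^ 1 * g \<in> powers_ideal d" using that(2) by (simp add: ell_def)
    show "2 * t + 1 \<le> CARD('n) * (d - 1)" using t d n5 by auto
  qed (use c d0 that in auto)
  have h1: "homog (t + 1) (ell * f)" using homog_mult[OF homog_ell f] by simp
  show ?thesis
  proof (cases "t + 1 < d")
    case True
    obtain g where g: "ell * f - L ^ d * g \<in> powers_ideal d" using m by (auto simp: forms_ideal_def)
    have "hom_part (t + 1) (g * L ^ d) = 0" by (rule hom_part_mult_less[OF homog_L_power True])
    then have "ell * f \<in> powers_ideal d"
      using hom_part_powers_ideal[OF g, of "t + 1"] hom_part_homog[OF h1, of "t + 1"]
      by (simp add: hom_part_diff mult.commute)
    then show ?thesis using lef[OF f] unfolding forms_ideal_def by (intro CollectI exI[of _ 0]) simp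
  next
    case False
    then obtain h where h: "homog (t + 1 - d) h" "ell * f - L ^ d * h \<in> powers_ideal d"
      using forms_ideal_homog[OF m h1] by auto
    have "\<exists>h'. h = ell * h' \<and> homog t (L ^ d * h')"
    proof -
      \<comment> \<open>The degree of \<open>h\<close> is \<open>t + 1 - d\<close>, which leaves three cases.\<close>
      consider "d = 2" "t = 1" | "d = 3" "t = 2" | "d = 3" "t = 3" using d t False by fastforce
      then show ?thesis
      proof cases
        case 1
        then obtain \<eta> where "h = Const \<eta>" using homog_0_eq_Const h(1) by auto
        then have "h = 0" using constant_cofactor_zero_squares[of f \<eta>] f h(2) 1 by simp
        then show ?thesis by (intro exI[of _ 0]) simp
      next
        case 2
        then obtain \<eta> where "h = Const \<eta>" using homog_0_eq_Const h(1) by auto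
        then have "h = 0" using constant_cofactor_zero_cubes[of f \<eta>] f h(2) 2 by simp
        then show ?thesis by (intro exI[of _ 0]) simp
      next
        case 3
        then obtain \<kappa> where "h = Const \<kappa> * ell"
          using cofactor_multiple_of_ell[of h f] f h by auto
        moreover have "homog 3 (L ^ 3 * Const \<kappa>)"
          using homog_mult[OF homog_L_power homog_Const, of 3 \<kappa>] by simp
        ultimately show ?thesis using 3 by (intro exI[of _ "Const \<kappa>"]) (simp add: mult.commute)
      qed
    qed
    then obtain h' where h': "h = ell * h'" "homog t (L ^ d * h')" by blast
    have "ell * (f - L ^ d * h') \<in> powers_ideal d"
      using h(2) unfolding h'(1) by (simp add: algebra_simps)
    then have "f - L ^ d * h' \<in> powers_ideal d" by (rule lef[OF homog_diff[OF f h'(2)]])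
    then show ?thesis unfolding forms_ideal_def by blast
  qed
qed

end

section \<open>Failure of surjectivity for large exponents\<close>

text \<open>
  Polynomials as a vector space over the coefficients, for the sake of counting dimensions. As a
  rewrite rule, \<open>scale_scale\<close> would loop with \<open>Const_mult\<close> and associativity.
\<close>

interpretation kv: Vector_Spaces.vector_space "\<lambda>(a :: 'k::field) (f :: ('n, 'k) mpoly). Const a * f"
  by unfold_locales (auto simp: algebra_simps Const_add Const_mult)

declare kv.scale_scale [simp del]

definition Mon :: "'n::finite set \<Rightarrow> nat \<Rightarrow> ('n \<Rightarrow>\<^sub>0 nat) set" where
  "Mon V t = {m. supp m \<subseteq> V \<and> total_deg m = t}"

lemma total_deg_eq_0_iff: "total_deg m = 0 \<longleftrightarrow> m = 0"
  by (auto simp: total_deg_def intro: poly_mapping_eqI)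

lemma Mon_0: "Mon V 0 = {0}"
  by (auto simp: Mon_def total_deg_eq_0_iff)

lemma Mon_empty_Suc: "Mon {} (Suc t) = {}"
  by (auto simp: Mon_def total_deg_def)

text \<open>
  Monomials in \<open>V\<close> and \<open>x\<^sub>i\<close> either do not involve \<open>x\<^sub>i\<close> or are divisible by it; this gives Pascal's rule for
  their numbers.
\<close>

lemma Mon_insert_Suc:
  assumes "i \<notin> V"
  shows "Mon (insert i V) (Suc t) = Mon V (Suc t) \<union> (\<lambda>m. m + mon i 1) ` Mon (insert i V) t" (is "?L = ?A \<union> ?B")
    and "Mon V (Suc t) \<inter> (\<lambda>m. m + mon i 1) ` Mon (insert i V) t = {}"
proof -
  show "?L = ?A \<union> ?B"
  proof (intro equalityI subsetI)
    fix m assume m: "m \<in> ?L"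
    show "m \<in> ?A \<union> ?B"
    proof (cases "lkp m i = 0")
      case True
      then have "i \<notin> supp m" by (simp add: in_keys_iff)
      then show ?thesis using m by (auto simp: Mon_def)
    next
      case False
      then have pos: "lkp m i > 0" by simp
      have "supp (m - mon i 1) \<subseteq> supp m" by (auto simp: in_keys_iff lookup_minus)
      then have "m - mon i 1 \<in> Mon (insert i V) t"
        using m total_deg_minus_single[OF pos] by (auto simp: Mon_def)
      then show ?thesis using minus_plus_single(2)[OF pos] by (metis UnI2 image_eqI)
    qed
  next
    fix m assume "m \<in> ?A \<union> ?B"
    then show "m \<in> ?L"
    proof
      assume "m \<in> ?B"
      then obtain n where n: "m = n + mon i 1" "n \<in> Mon (insert i V) t" by blast
      then show ?thesis using keys_add[of n "mon i 1"] by (auto simp: Mon_def total_deg_single)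
    qed (auto simp: Mon_def)
  qed
  show "?A \<inter> ?B = {}"
  proof -
    have "i \<in> supp (n + mon i 1)" for n :: "'a \<Rightarrow>\<^sub>0 nat" by (simp add: in_keys_iff lookup_add)
    then show ?thesis using assms by (auto simp: Mon_def)
  qed
qed

lemma finite_card_Mon:
  assumes "finite V"
  shows "finite (Mon V t) \<and> (V \<noteq> {} \<longrightarrow> card (Mon V t) = (card V - 1 + t) choose t)"
  using assms
proof (induction V arbitrary: t)
  case empty
  show ?case by (cases t) (simp_all add: Mon_0 Mon_empty_Suc)
next
  case (insert i V)
  show ?case
  proof (induction t)
    case 0
    show ?case by (simp add: Mon_0)
  next
    case (Suc t)
    let ?B = "(\<lambda>m. m + mon i 1) ` Mon (insert i V) t"
    have fin: "finite (Mon V (Suc t))" "finite ?B" using insert.IH Suc by auto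
    have "card (Mon (insert i V) (Suc t)) = card (Mon V (Suc t)) + card ?B"
      unfolding Mon_insert_Suc(1)[OF insert(2)] by (rule card_Un_disjoint[OF fin Mon_insert_Suc(2)[OF insert(2)]])
    also have "card ?B = card (Mon (insert i V) t)"
      by (rule card_image) (simp add: inj_on_def)
    also have "\<dots> = (card V + t) choose t" using Suc insert(1,2) by simp
    also have "card (Mon V (Suc t)) + \<dots> = (card V + Suc t) choose Suc t"
    proof (cases "V = {}")
      case True
      then show ?thesis by (simp add: Mon_empty_Suc)
    next
      case False
      then have "card (Mon V (Suc t)) = (card V - 1 + Suc t) choose Suc t" using insert.IH by blast
      moreover have "card V - 1 + Suc t = card V + t" using False insert(1) by (simp add: Suc_diff_le card_gt_0_iff)
      ultimately show ?thesis by simp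
    qed
    finally show ?case using fin insert(1,2) Mon_insert_Suc(1)[OF insert(2), of t] by simp
  qed
qed

lemma finite_Mon: "finite (Mon V t)"
  using finite_card_Mon[of V t] finite by blast

lemma card_Mon:
  assumes "card V = Suc k" and "n = k + t"
  shows "card (Mon V t) = n choose k"
proof -
  have "card (Mon V t) = (k + t) choose t"
    using finite_card_Mon[of V t] assms(1) by force
  also have "\<dots> = n choose k"
    unfolding assms(2) by (subst binomial_symmetric) simp_all
  finally show ?thesis .
qed

lemma homog_in_subspace:
  assumes E: "kv.subspace E" and mon: "\<And>m. total_deg m = t \<Longrightarrow> y * mon m 1 \<in> E" and f: "homog t f"
  shows "y * f \<in> E"
proof -
  have "y * (\<Sum>m\<in>supp f. mon m (lkp f m)) = (\<Sum>m\<in>supp f. Const (lkp f m) * (y * mon m 1))"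
    unfolding sum_distrib_left
    by (intro sum.cong refl) (simp add: Const_mult_single mult.left_commute[of _ y])
  also have "\<dots> \<in> E"
    by (intro kv.subspace_sum[OF E] kv.subspace_scale[OF E] mon) (use f in \<open>auto simp: homog_def\<close>)
  finally show ?thesis by (simp add: sum_of_terms)
qed

lemma linear_form_mult_single:
  "linear_form b * mon n e = (\<Sum>k\<in>UNIV. mon (n + mon k 1) (b k * e))"
  unfolding linear_form_def sum_distrib_right
  by (intro sum.cong refl) (simp add: mult.assoc Var_mult_single Const_mult_single)

text \<open>
  If a linear form involves \<open>x\<^sub>q\<close>, then modulo its multiples \<open>x\<^sub>q\<close> can be replaced by the other variables. The
  induction is on the exponent of \<open>x\<^sub>q\<close>. The factor \<open>y\<close> is carried along, because the subspace \<open>E\<close> below need not be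
  an ideal.
\<close>

lemma eliminate_variable:
  fixes E :: "('n::finite, 'k::field) mpoly set"
  assumes E: "kv.subspace E" and b: "b q \<noteq> 0" "\<And>i. i \<notin> V \<Longrightarrow> b i = 0"
    and base: "\<And>m. m \<in> Mon (V - {q}) t \<Longrightarrow> y * mon m 1 \<in> E"
    and mult: "\<And>n. n \<in> Mon V (t - 1) \<Longrightarrow> t > 0 \<Longrightarrow> y * (linear_form b * mon n 1) \<in> E"
    and m: "m \<in> Mon V t"
  shows "y * mon m 1 \<in> E"
  using m
proof (induction "lkp m q" arbitrary: m)
  case 0
  then have "q \<notin> supp m" by (simp add: in_keys_iff)
  then show ?case using base 0 by (auto simp: Mon_def)
next
  case (Suc e)
  let ?n = "m - mon q 1"
  have pos: "lkp m q > 0" using Suc(2) by simp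
  have mn: "?n + mon q 1 = m" by (rule minus_plus_single(2)[OF pos])
  have t: "t > 0" using Suc(3) pos lookup_le_total_deg[of m q] by (auto simp: Mon_def)
  have "supp ?n \<subseteq> supp m" by (auto simp: in_keys_iff lookup_minus)
  then have n: "?n \<in> Mon V (t - 1)" using Suc(3) total_deg_minus_single[OF pos] by (auto simp: Mon_def)
  have other: "y * mon (?n + mon k 1) (b k) \<in> E" if "k \<noteq> q" for k
  proof (cases "k \<in> V")
    case True
    have "lkp (?n + mon k 1) q = e"
      using Suc(2) that by (simp add: lookup_add lookup_minus lookup_single)
    moreover have "?n + mon k 1 \<in> Mon V t"
      using n True keys_add[of ?n "mon k 1"] t by (auto simp: Mon_def total_deg_single)
    ultimately have "y * mon (?n + mon k 1) 1 \<in> E" using Suc(1) by simp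
    from kv.subspace_scale[OF E this, of "b k"] show ?thesis
      by (simp add: mult.left_commute[of _ y] Const_mult_single)
  next
    case False
    then show ?thesis using b(2) kv.subspace_0[OF E] by simp
  qed
  have "y * (linear_form b * mon ?n 1) = (\<Sum>k\<in>UNIV. y * mon (?n + mon k 1) (b k))"
    unfolding linear_form_mult_single by (simp add: sum_distrib_left)
  also have "\<dots> = y * mon (?n + mon q 1) (b q) + (\<Sum>k\<in>UNIV - {q}. y * mon (?n + mon k 1) (b k))"
    by (rule sum.remove) auto
  also have "?n + mon q 1 = m" by (rule mn)
  finally have "y * mon m (b q) = y * (linear_form b * mon ?n 1) - (\<Sum>k\<in>UNIV - {q}. y * mon (?n + mon k 1) (b k))"
    by simp
  also have "\<dots> \<in> E"
    by (intro kv.subspace_diff[OF E] mult[OF n t] kv.subspace_sum[OF E] other) auto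
  finally have "Const (inverse (b q)) * (y * mon m (b q)) \<in> E" by (rule kv.subspace_scale[OF E])
  then show ?case using b(1) by (simp add: mult.left_commute[of _ y] Const_mult_single)
qed

lemma eval_unit_vector:
  assumes "homog k f"
  shows "eval_mpoly f (\<lambda>i. if i = r then 1 else 0) = lkp f (mon r k)"
proof -
  have *: "(\<Prod>i\<in>UNIV. (if i = r then 1 else 0 :: 'b) ^ lkp m i) = (if m = mon r k then 1 else 0)" if "m \<in> supp f" for m
  proof (cases "\<forall>i. i \<noteq> r \<longrightarrow> lkp m i = 0")
    case True
    have "total_deg m = (\<Sum>i\<in>{r}. lkp m i)"
      unfolding total_deg_def by (rule sum.mono_neutral_right) (use True in auto)
    then have "lkp m r = k" using assms that by (simp add: homog_def)
    then have "m = mon r k" using True by (intro poly_mapping_eqI) (auto simp: lookup_single when_def)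
    moreover have "(if i = r then 1 else 0 :: 'b) ^ lkp m i = 1" for i using True by simp
    ultimately show ?thesis by simp
  next
    case False
    then obtain i where i: "i \<noteq> r" "lkp m i \<noteq> 0" by blast
    then have "m \<noteq> mon r k" by (auto simp: lookup_single)
    moreover have "(\<Prod>i\<in>UNIV. (if i = r then 1 else 0 :: 'b) ^ lkp m i) = 0"
      by (rule prod_zero) (use i in \<open>auto intro!: bexI[of _ i]\<close>)
    ultimately show ?thesis by simp
  qed
  have "eval_mpoly f (\<lambda>i. if i = r then 1 else 0) = (\<Sum>m\<in>supp f. if m = mon r k then lkp f m else 0)"
    unfolding eval_mpoly_def by (intro sum.cong refl) (simp add: *)
  then show ?thesis by (simp add: in_keys_iff)
qed

lemma supp_linear_form_power:
  assumes "\<And>i. i \<notin> V \<Longrightarrow> b i = 0" and "m \<in> supp (linear_form b ^ k)"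
  shows "supp m \<subseteq> V"
  using assms(2)
proof (induction k arbitrary: m)
  case 0
  then show ?case by simp
next
  case (Suc k)
  then obtain x y where xy: "m = x + y" "x \<in> supp (linear_form b)" "y \<in> supp (linear_form b ^ k)"
    using keys_mult[of "linear_form b" "linear_form b ^ k"] by auto
  from xy(2) obtain i where "x = mon i 1" "b i \<noteq> 0"
    unfolding in_keys_iff lookup_linear_form
    by (auto elim!: sum.not_neutral_contains_not_neutral split: if_splits)
  then have "supp x \<subseteq> V" using assms(1) by auto
  then show ?case using Suc.IH[OF xy(3)] keys_add[of x y] xy(1) by blast
qed

lemma independent_monomials:
  fixes S :: "('n \<Rightarrow>\<^sub>0 nat) set"
  assumes S: "finite S"
  shows "\<not> kv.dependent ((\<lambda>m. mon m 1 :: ('n, 'k::field) mpoly) ` S)"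
proof (rule kv.independent_if_scalars_zero)
  fix u :: "('n, 'k) mpoly \<Rightarrow> 'k" and x :: "('n, 'k) mpoly"
  assume sum: "(\<Sum>x\<in>(\<lambda>m. mon m 1) ` S. Const (u x) * x) = 0" and "x \<in> (\<lambda>m. mon m 1) ` S"
  then obtain m where m: "m \<in> S" "x = mon m 1" by blast
  have inj: "inj_on (\<lambda>m. mon m 1 :: ('n, 'k) mpoly) S"
    by (rule inj_onI) (metis keys_single one_neq_zero the_elem_eq)
  have "0 = lkp (\<Sum>n\<in>S. mon n (u (mon n 1))) m"
    using sum by (simp add: sum.reindex[OF inj] Const_mult_single)
  also have "\<dots> = u (mon m 1)"
    using S m by (simp add: lookup_sum lookup_single when_def)
  finally show "u x = 0" using m by simp
qed (use S in simp)

lemma six_binomial: "6 * ((n + 2) choose 3) = (n + 2) * (n + 1) * n"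
proof (induction n)
  case (Suc n)
  have "2 * ((n + 2) choose 2) = (n + 2) * (n + 1)"
    by (induction n) (simp_all add: numeral_2_eq_2)
  moreover have "(Suc n + 2) choose 3 = ((n + 2) choose 3) + ((n + 2) choose 2)"
    by (simp add: numeral_3_eq_3 numeral_2_eq_2)
  ultimately have "6 * ((Suc n + 2) choose 3) = (n + 2) * (n + 1) * n + 3 * ((n + 2) * (n + 1))"
    using Suc by simp
  then show ?case by (simp add: algebra_simps)
qed (simp add: numeral_3_eq_3)

text \<open>
  Three times the difference of the two sides is \<open>d (d + 1) (d - 4)\<close>; at \<open>d = 4\<close> both sides are \<open>120\<close>.
\<close>

lemma count_inequality:
  assumes "d \<ge> 4"
  shows "6 * ((d + 2) choose 3) \<le> (2 * d + 2) choose 3"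
proof -
  obtain e where d: "d = 4 + e" using assms le_Suc_ex by blast
  have "6 * (6 * ((d + 2) choose 3)) \<le> 6 * ((2 * d + 2) choose 3)"
    unfolding six_binomial d by (simp add: algebra_simps)
  then show ?thesis by simp
qed

context six_forms
begin

text \<open>
  If the multiplication were surjective, the forms of degree \<open>2 d - 1\<close> would be spanned by the multiples of \<open>ell\<close>, of
  the \<open>x\<^sub>i\<^sup>d\<close> and of \<open>L\<^sup>d\<close>. For the cofactors of \<open>x\<^sub>i\<^sup>d\<close> four variables suffice, as \<open>x\<^sub>q\<close> can be eliminated modulo \<open>ell\<close>. The cofactors
  of \<open>L\<^sup>d\<close> are divided into multiples of \<open>L'\<close>, which is \<open>L\<close> without \<open>x\<^sub>q\<close>, and forms in the three variables other than
  \<open>x\<^sub>p\<close> and \<open>x\<^sub>q\<close>. By the syzygy the monomial \<open>x\<^sub>r\<^sup>d\<^sup>-\<^sup>1\<close> can be left out of the last family, since it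
  occurs in \<open>M'\<^sup>d\<^sup>-\<^sup>1\<close>, where \<open>M'\<close> is \<open>M\<close> reduced to these three variables. One generator less than expected
  is too few.
\<close>

lemma not_surjective:
  assumes d: "d \<ge> 4"
  shows "\<exists>f. homog (2 * d - 1) f \<and> f \<notin> section_ideal d d"
proof (rule ccontr)
  assume "\<not> ?thesis"
  then have surj: "f \<in> section_ideal d d" if "homog (2 * d - 1) f" for f using that by blast
  obtain p q r :: 'n where pqr: "distinct [p, q, r]" using three_indices by blast
  define L' where "L' = (linear_form (\<lambda>i. c i * (s i - s q)) :: ('n, 'k) mpoly)"
  define M' where "M' = (linear_form (\<lambda>i. c i * ((s i - s p) * (s i - s q))) :: ('n, 'k) mpoly)"
  let ?m0 = "mon r (d - 1) :: 'n \<Rightarrow>\<^sub>0 nat"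
  \<comment> \<open>The spanning set; the monomial \<open>?m0\<close> is left out of its last part.\<close>
  define G1 where "G1 = (\<lambda>n. ell * mon n 1) ` Mon UNIV (2 * d - 2)"
  define G2 where "G2 i = (\<lambda>n. Var i ^ d * mon n 1 :: ('n, 'k) mpoly) ` Mon (UNIV - {q}) (d - 1)" for i
  define G3 where "G3 = (\<lambda>n. (L ^ d * L') * mon n 1) ` Mon (UNIV - {q}) (d - 2)"
  define G4 where "G4 = (\<lambda>n. L ^ d * mon n 1) ` (Mon (UNIV - {q} - {p}) (d - 1) - {?m0})"
  define G where "G = G1 \<union> (\<Union>i. G2 i) \<union> G3 \<union> G4"
  define E where "E = kv.span G"
  have E: "kv.subspace E" unfolding E_def by (rule kv.subspace_span)
  have GE: "x \<in> E" if "x \<in> G" for x unfolding E_def using that by (rule kv.span_base)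
  note add = kv.subspace_add[OF E] and diff = kv.subspace_diff[OF E] and scale = kv.subspace_scale[OF E]
  have ell_E: "ell * f \<in> E" if "homog (2 * d - 2) f" for f
    by (rule homog_in_subspace[OF E _ that]) (auto intro!: GE simp: G_def G1_def Mon_def)
  have ell_E': "y * (linear_form c * mon n 1) \<in> E" if "homog e y" "n \<in> Mon UNIV t" "e + t = 2 * d - 2" for e t y n
  proof -
    have "homog (2 * d - 2) (y * mon n 1)"
      using homog_mult[OF that(1) homog_single[of n 1]] that(2,3) by (simp add: Mon_def)
    from ell_E[OF this] show ?thesis by (simp add: ell_def mult.left_commute)
  qed
  \<comment> \<open>modulo \<open>ell\<close> the variable \<open>q\<close> can be eliminated\<close>
  have elim_q: "y * f \<in> E"
    if y: "homog e y" and f: "homog t f" and et: "e + t = 2 * d - 1" and base: "\<And>m. m \<in> Mon (UNIV - {q}) t \<Longrightarrow> y * mon m 1 \<in> E"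
    for e t y f
  proof (rule homog_in_subspace[OF E _ f])
    fix m :: "'n \<Rightarrow>\<^sub>0 nat" assume "total_deg m = t"
    then have m: "m \<in> Mon UNIV t" by (simp add: Mon_def)
    show "y * mon m 1 \<in> E"
    proof (rule eliminate_variable[where b = c and q = q and V = UNIV, OF E _ _ base _ m])
      show "y * (linear_form c * mon n 1) \<in> E" if "n \<in> Mon UNIV (t - 1)" "t > 0" for n
        by (rule ell_E'[OF y that(1)]) (use et that(2) in simp)
    qed (use c in auto)
  qed
  have hV: "homog d (Var i ^ d)" for i using homog_power[OF homog_Var, of d i] by simp
  have G2_E: "Var i ^ d * f \<in> E" if "homog (d - 1) f" for i f
  proof (rule elim_q[OF hV that])
    show "Var i ^ d * mon m 1 \<in> E" if "m \<in> Mon (UNIV - {q}) (d - 1)" for m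
      using that by (intro GE) (auto simp only: G_def G2_def)
  qed (use d in simp)
  have powers_E: "f \<in> E" if f: "f \<in> powers_ideal d" "homog (2 * d - 1) f" for f
  proof -
    have "d \<le> 2 * d - 1" using d by simp
    then obtain H where H: "f = (\<Sum>i\<in>UNIV. H i * Var i ^ d)" "\<And>i. homog (2 * d - 1 - d) (H i)"
      using powers_ideal_homog_expansion[OF f] by blast
    have "homog (d - 1) (H i)" for i using H(2)[of i] by (simp add: mult_2)
    then have "(\<Sum>i\<in>UNIV. Var i ^ d * H i) \<in> E" by (intro kv.subspace_sum[OF E] G2_E)
    then show ?thesis unfolding H(1) by (simp add: mult.commute)
  qed
  have hL': "homog 1 L'" unfolding L'_def by (rule homog_linear_form)
  have hLL': "homog (d + 1) (L ^ d * L')" by (rule homog_mult[OF homog_L_power hL'])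
  have L_eq: "L = L' + Const (s q) * ell"
    unfolding L_def L'_def ell_def linear_form_def sum_distrib_left sum.distrib[symmetric]
    by (intro sum.cong refl) (simp add: Const_mult Const_diff algebra_simps)
  have G3_E: "(L ^ d * L') * f \<in> E" if "homog (d - 2) f" for f
  proof (rule elim_q[OF hLL' that])
    show "(L ^ d * L') * mon m 1 \<in> E" if "m \<in> Mon (UNIV - {q}) (d - 2)" for m
      using that by (intro GE) (auto simp only: G_def G3_def)
  qed (use d in simp)
  have L_E: "L ^ (d + 1) * f \<in> E" if f: "homog (d - 2) f" for f
  proof -
    have "d + (d - 2) = 2 * d - 2" using d by simp
    then have "homog (2 * d - 2) (L ^ d * f)" using homog_mult[OF homog_L_power f, of d] by simp
    then have "(L ^ d * L') * f + Const (s q) * (ell * (L ^ d * f)) \<in> E"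
      by (intro add G3_E f scale ell_E)
    also have "(L ^ d * L') * f + Const (s q) * (ell * (L ^ d * f)) = L ^ d * (L' + Const (s q) * ell) * f"
      by (simp add: algebra_simps)
    also have "\<dots> = L ^ (d + 1) * f" unfolding L_eq[symmetric] by (simp add: mult_ac)
    finally show ?thesis .
  qed
  have syz_E: "L ^ d * M ^ (d - 1) \<in> E"
  proof -
    have "d \<ge> 2" using d by simp
    then obtain g f where gf: "homog (d - 2) g" "homog (2 * d - 2) f"
      "L ^ d * M ^ (d - 1) - L ^ (d + 1) * g - ell * f \<in> powers_ideal d"
      using homog_syzygy by blast
    have e: "d + (d - 1) = 2 * d - 1" "d + 1 + (d - 2) = 2 * d - 1" "1 + (2 * d - 2) = 2 * d - 1" using d by simp_all
    have "homog (2 * d - 1) (L ^ d * M ^ (d - 1) - L ^ (d + 1) * g - ell * f)"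
      using homog_mult[OF homog_L_power homog_M_power, of d "d - 1"] homog_mult[OF homog_L_power gf(1), of "d + 1"]
        homog_mult[OF homog_ell gf(2)] unfolding e by (intro homog_diff)
    from add[OF add[OF powers_E[OF gf(3) this] L_E[OF gf(1)]] ell_E[OF gf(2)]]
    show ?thesis by (simp add: algebra_simps)
  qed
  have M'_eq: "M' - M = Const (s p * s q) * ell - Const (s p + s q) * L"
    unfolding M_def M'_def L_def ell_def linear_form_def sum_distrib_left sum_subtractf[symmetric]
    by (intro sum.cong refl) (simp add: Const_mult Const_diff Const_add power2_eq_square algebra_simps)
  have hM': "homog 1 M'" unfolding M'_def by (rule homog_linear_form)
  have hM'k: "homog k (M' ^ k)" for k using homog_power[OF hM', of k] by simp
  have M'_E: "L ^ d * M' ^ (d - 1) \<in> E"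
  proof -
    define S where "S = (\<Sum>i<d - 1. M ^ (d - 1 - Suc i) * M' ^ i)"
    have S: "homog (d - 2) S"
      unfolding S_def
    proof (rule homog_sum)
      fix i assume "i \<in> {..<d - 1}"
      then have "d - 1 - Suc i + i = d - 2" by auto
      then show "homog (d - 2) (M ^ (d - 1 - Suc i) * M' ^ i)"
        using homog_mult[OF homog_M_power[of "d - 1 - Suc i"] hM'k[of i]] by simp
    qed
    have "d + (d - 2) = 2 * d - 2" using d by simp
    then have LS: "homog (2 * d - 2) (L ^ d * S)" using homog_mult[OF homog_L_power S, of d] by simp
    have "M' ^ (d - 1) - M ^ (d - 1) = (Const (s p * s q) * ell - Const (s p + s q) * L) * S"
      unfolding S_def power_diff_sumr2 M'_eq ..
    then have e: "M' ^ (d - 1) = M ^ (d - 1) + (Const (s p * s q) * ell - Const (s p + s q) * L) * S"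
      by (simp only: diff_eq_eq add.commute)
    have "L ^ d * M' ^ (d - 1) = L ^ d * M ^ (d - 1)
        + Const (s p * s q) * (ell * (L ^ d * S)) - Const (s p + s q) * (L ^ (d + 1) * S)"
      unfolding e by (simp add: algebra_simps)
    also have "\<dots> \<in> E" by (intro add diff syz_E scale ell_E LS L_E S)
    finally show ?thesis .
  qed
  \<comment> \<open>Evaluation at a unit vector gives the coefficient of a pure power.\<close>
  have r_coeff: "lkp (M' ^ (d - 1)) ?m0 \<noteq> 0"
  proof -
    have "lkp (M' ^ (d - 1)) ?m0 = (c r * ((s r - s p) * (s r - s q))) ^ (d - 1)"
      using eval_unit_vector[OF hM'k, of "d - 1" r] by (simp add: M'_def if_distrib cong: if_cong)
    moreover have "c r * ((s r - s p) * (s r - s q)) \<noteq> 0" using c pqr inj by (auto dest: injD)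
    ultimately show ?thesis by simp
  qed
  have supp_M': "m \<in> Mon (UNIV - {q} - {p}) (d - 1)" if m: "m \<in> supp (M' ^ (d - 1))" for m
  proof -
    have "supp m \<subseteq> UNIV - {q} - {p}"
      by (rule supp_linear_form_power[OF _ m[unfolded M'_def]]) auto
    then show ?thesis using m hM'k[of "d - 1"] by (auto simp: Mon_def homog_def)
  qed
  have m0_E: "L ^ d * mon ?m0 1 \<in> E"
  proof -
    let ?a = "lkp (M' ^ (d - 1))"
    have "M' ^ (d - 1) = (\<Sum>m\<in>supp (M' ^ (d - 1)). mon m (?a m))" by (rule sum_of_terms[symmetric])
    also have "\<dots> = mon ?m0 (?a ?m0) + (\<Sum>m\<in>supp (M' ^ (d - 1)) - {?m0}. mon m (?a m))"
      by (rule sum.remove) (use r_coeff in \<open>auto simp: in_keys_iff\<close>)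
    finally have e1: "mon ?m0 (?a ?m0) = M' ^ (d - 1) - (\<Sum>m\<in>supp (M' ^ (d - 1)) - {?m0}. mon m (?a m))"
      by (rule eq_diff_eq[THEN iffD2, OF sym])
    have "L ^ d * mon ?m0 (?a ?m0) = L ^ d * M' ^ (d - 1)
        - (\<Sum>m\<in>supp (M' ^ (d - 1)) - {?m0}. Const (?a m) * (L ^ d * mon m 1))"
      unfolding e1 right_diff_distrib sum_distrib_left
      by (simp add: mult.left_commute[of _ "L ^ d"] Const_mult_single)
    also have "\<dots> \<in> E"
      by (intro diff M'_E kv.subspace_sum[OF E] scale GE) (use supp_M' in \<open>auto simp: G_def G4_def\<close>)
    finally have "Const (inverse (?a ?m0)) * (L ^ d * mon ?m0 (?a ?m0)) \<in> E" by (rule scale)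
    then show ?thesis using r_coeff by (simp add: mult.left_commute[of _ "L ^ d"] Const_mult_single)
  qed
  have Ld_E: "L ^ d * f \<in> E" if f: "homog (d - 1) f" for f
  proof (rule elim_q[OF homog_L_power f])
    fix m :: "'n \<Rightarrow>\<^sub>0 nat" assume m: "m \<in> Mon (UNIV - {q}) (d - 1)"
    show "L ^ d * mon m 1 \<in> E"
    proof (rule eliminate_variable[where b = "\<lambda>i. c i * (s i - s q)" and q = p and V = "UNIV - {q}", OF E _ _ _ _ m])
      show "c p * (s p - s q) \<noteq> 0" using c pqr inj by (auto dest: injD)
      show "L ^ d * mon n 1 \<in> E" if "n \<in> Mon (UNIV - {q} - {p}) (d - 1)" for n
        using that m0_E by (cases "n = ?m0") (auto intro!: GE simp: G_def G4_def)
      show "L ^ d * (linear_form (\<lambda>i. c i * (s i - s q)) * mon n 1) \<in> E" if "n \<in> Mon (UNIV - {q}) (d - 1 - 1)" for n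
      proof -
        have "n \<in> Mon (UNIV - {q}) (d - 2)" using that by (simp add: numeral_2_eq_2)
        then have "(L ^ d * L') * mon n 1 \<in> E" by (intro GE) (auto simp: G_def G3_def)
        then show ?thesis by (simp add: L'_def mult.assoc)
      qed
    qed auto
  qed (use d in simp)
  have all: "f \<in> E" if f: "homog (2 * d - 1) f" for f
  proof -
    obtain g h where gh: "f - L ^ d * g - ell * h \<in> powers_ideal d" using surj[OF f] by (auto simp: section_ideal_def)
    have e: "2 * d - 1 = d - 1 + d" "2 * d - 1 = 2 * d - 2 + 1" using d by simp_all
    have 1: "hom_part (2 * d - 1) (L ^ d * g) = L ^ d * hom_part (d - 1) g"
      unfolding e(1) using hom_part_mult[OF homog_L_power, of "d - 1" d g] by (simp add: mult.commute)
    have 2: "hom_part (2 * d - 1) (ell * h) = ell * hom_part (2 * d - 2) h"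
      unfolding e(2) using hom_part_mult[OF homog_ell, of "2 * d - 2" h] by (simp add: mult.commute)
    have "hom_part (2 * d - 1) (f - L ^ d * g - ell * h) = f - L ^ d * hom_part (d - 1) g - ell * hom_part (2 * d - 2) h"
      unfolding hom_part_diff 1 2 using hom_part_homog[OF f] by simp
    then have "f - L ^ d * hom_part (d - 1) g - ell * hom_part (2 * d - 2) h \<in> E"
      using powers_E[OF hom_part_powers_ideal[OF gh] homog_hom_part] by simp
    from add[OF add[OF this ell_E[OF homog_hom_part[of _ h]]] Ld_E[OF homog_hom_part[of _ g]]] show ?thesis
      by (simp add: algebra_simps)
  qed
  have finG: "finite G" unfolding G_def G1_def G2_def G3_def G4_def by (intro finite_UnI finite_UN_I) (auto simp: finite_Mon)
  let ?B = "(\<lambda>m. mon m 1 :: ('n, 'k) mpoly) ` Mon UNIV (2 * d - 1)"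
  have "?B \<subseteq> kv.span G"
  proof clarify
    fix m :: "'n \<Rightarrow>\<^sub>0 nat" assume "m \<in> Mon UNIV (2 * d - 1)"
    then have "homog (2 * d - 1) (mon m 1 :: ('n, 'k) mpoly)" using homog_single[of m 1] by (simp add: Mon_def)
    then show "mon m 1 \<in> kv.span G" using all unfolding E_def by blast
  qed
  then have le: "card ?B \<le> card G"
    using kv.independent_span_bound[OF finG independent_monomials[OF finite_Mon]] by blast
  have "inj_on (\<lambda>m. mon m 1 :: ('n, 'k) mpoly) (Mon UNIV (2 * d - 1))"
    by (rule inj_onI) (metis keys_single one_neq_zero the_elem_eq)
  then have cardB: "card ?B = card (Mon (UNIV :: 'n set) (2 * d - 1))" by (rule card_image)
  have four: "card (UNIV - {q} :: 'n set) = 4"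
    using n5 pqr by (auto simp: card_Diff_singleton)
  have three: "card (UNIV - {q} - {p} :: 'n set) = 3"
    using n5 pqr by (auto simp: card_Diff_singleton)
  have m0: "?m0 \<in> Mon (UNIV - {q} - {p}) (d - 1)"
    using pqr by (auto simp: Mon_def total_deg_single split: if_splits)
  have cards:
    "card (Mon (UNIV :: 'n set) (2 * d - 1)) = (2 * d + 3) choose 4"
    "card (Mon (UNIV :: 'n set) (2 * d - 2)) = (2 * d + 2) choose 4"
    "card (Mon (UNIV - {q}) (d - 1)) = (d + 2) choose 3"
    "card (Mon (UNIV - {q}) (d - 2)) = (d + 1) choose 3"
    "card (Mon (UNIV - {q} - {p}) (d - 1)) = (d + 1) choose 2"
    using n5 four three d by (intro card_Mon; simp)+
  have "card G \<le> card G1 + card (\<Union>i. G2 i) + card G3 + card G4"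
    unfolding G_def by (meson add_mono card_Un_le le_refl order_trans)
  also have "card (\<Union>i. G2 i) \<le> (\<Sum>i\<in>UNIV. card (G2 i))" by (rule card_UN_le) simp
  also have "\<dots> \<le> (\<Sum>i\<in>(UNIV :: 'n set). (d + 2) choose 3)"
    unfolding G2_def cards(3)[symmetric] by (intro sum_mono card_image_le finite_Mon)
  also have "\<dots> = 5 * ((d + 2) choose 3)" using n5 by simp
  also have "card G1 \<le> (2 * d + 2) choose 4"
    unfolding G1_def cards(2)[symmetric] by (intro card_image_le finite_Mon)
  also have "card G3 \<le> (d + 1) choose 3"
    unfolding G3_def cards(4)[symmetric] by (intro card_image_le finite_Mon)
  also have "card G4 \<le> ((d + 1) choose 2) - 1"
    unfolding G4_def cards(5)[symmetric] card_Diff_singleton[OF m0, symmetric]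
    by (intro card_image_le finite_Diff finite_Mon)
  finally have "(2 * d + 3) choose 4
      \<le> ((2 * d + 2) choose 4) + 5 * ((d + 2) choose 3) + ((d + 1) choose 3) + (((d + 1) choose 2) - 1)"
    using le unfolding cardB cards by linarith
  moreover have "(2 * d + 3) choose 4 = ((2 * d + 2) choose 3) + ((2 * d + 2) choose 4)"
    "(d + 2) choose 3 = ((d + 1) choose 2) + ((d + 1) choose 3)"
    by (simp_all add: eval_nat_numeral)
  moreover have "(d + 1) choose 2 > 0" using d by (intro zero_less_binomial) simp
  ultimately show False using count_inequality[OF d] by linarith
qed

end

section \<open>Graded quotients and maximal rank\<close>

lemma ideal_type_algebra_iff:
  "ideal J (ring_of_type_algebra :: 'a::comm_ring_1 ring) \<longleftrightarrow> is_ideal J"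
proof
  assume "ideal J (ring_of_type_algebra :: 'a ring)"
  then interpret ideal J "ring_of_type_algebra :: 'a ring" .
  show "is_ideal J"
    using additive_subgroup.a_closed[OF is_additive_subgroup] additive_subgroup.zero_closed[OF is_additive_subgroup]
      I_l_closed
    by (intro idl.subspaceI) (auto simp: ring_of_type_algebra_def)
next
  assume J: "is_ideal J"
  show "ideal J (ring_of_type_algebra :: 'a ring)"
  proof (rule idealI[OF ring_from_type_algebra])
    have grp: "group (add_monoid (ring_of_type_algebra :: 'a ring))"
      using ring_from_type_algebra[where 'a = 'a] abelian_group.a_group ring.is_abelian_group by blast
    show "subgroup J (add_monoid (ring_of_type_algebra :: 'a ring))"
    proof (rule group.subgroupI[OF grp])
      fix x assume x: "x \<in> J"
      have "inv\<^bsub>add_monoid (ring_of_type_algebra :: 'a ring)\<^esub> x = - x"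
        by (rule group.inv_equality[OF grp]) (simp_all add: ring_of_type_algebra_def)
      then show "inv\<^bsub>add_monoid (ring_of_type_algebra :: 'a ring)\<^esub> x \<in> J"
        using idl.subspace_neg[OF J x] by simp
    qed (use idl.subspace_0[OF J] idl.subspace_add[OF J] in \<open>auto simp: ring_of_type_algebra_def\<close>)
  qed (use idl.subspace_scale[OF J] is_ideal_mult_right[OF J] in \<open>auto simp: ring_of_type_algebra_def\<close>)
qed

lemma genideal_type_algebra: "Idl\<^bsub>ring_of_type_algebra\<^esub> S = idl.span (S :: 'a::comm_ring_1 set)"
proof
  show "Idl\<^bsub>ring_of_type_algebra\<^esub> S \<subseteq> idl.span S"
    unfolding genideal_def using idl.span_superset[of S] idl.subspace_span[of S] by (auto simp: ideal_type_algebra_iff)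
  show "idl.span S \<subseteq> Idl\<^bsub>ring_of_type_algebra\<^esub> S"
    unfolding genideal_def using idl.span_minimal by (auto simp: ideal_type_algebra_iff)
qed

lemma powers_ideal_eq_span: "powers_ideal d = idl.span (range (\<lambda>i. Var i ^ d) :: ('n::finite, 'k::field) mpoly set)"
proof
  show "idl.span (range (\<lambda>i. Var i ^ d)) \<subseteq> (powers_ideal d :: ('n, 'k) mpoly set)"
    by (rule idl.span_minimal) (auto simp: Var_power_in_powers_ideal is_ideal_powers_ideal)
  show "powers_ideal d \<subseteq> (idl.span (range (\<lambda>i. Var i ^ d)) :: ('n, 'k) mpoly set)"
  proof
    fix f :: "('n, 'k) mpoly" assume f: "f \<in> powers_ideal d"
    have "mon m (lkp f m) \<in> idl.span (range (\<lambda>i. Var i ^ d))" if m: "m \<in> supp f" for m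
    proof -
      obtain i where "d \<le> lkp m i" using f m by (auto simp: powers_ideal_def)
      then show ?thesis
        using single_eq_mult_Var_power[of d m i "lkp f m"]
        by (simp only:) (intro idl.span_scale idl.span_base rangeI)
    qed
    then have "(\<Sum>m\<in>supp f. mon m (lkp f m)) \<in> idl.span (range (\<lambda>i. Var i ^ d))" by (intro idl.span_sum)
    then show "f \<in> idl.span (range (\<lambda>i. Var i ^ d))" by (simp add: sum_of_terms)
  qed
qed

lemma in_powers_ideal_plus_form:
  "f \<in> Idl\<^bsub>mpoly_ring\<^esub> (insert (L ^ d) (range (\<lambda>i. Var i ^ d))) \<longleftrightarrow> (\<exists>g. f - L ^ d * g \<in> powers_ideal d)"
  unfolding genideal_type_algebra idl.span_insert powers_ideal_eq_span by (simp add: mult.commute)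

lemma coset_type_algebra:
  fixes J :: "'a::comm_ring_1 set"
  assumes J: "is_ideal J"
  shows "J +>\<^bsub>ring_of_type_algebra\<^esub> f = J +>\<^bsub>ring_of_type_algebra\<^esub> g \<longleftrightarrow> f - g \<in> J"
proof
  have coset: "J +>\<^bsub>ring_of_type_algebra\<^esub> x = {j + x |j. j \<in> J}" for x :: 'a
    by (auto simp: a_r_coset_def' ring_of_type_algebra_def)
  show "f - g \<in> J" if "J +>\<^bsub>ring_of_type_algebra\<^esub> f = J +>\<^bsub>ring_of_type_algebra\<^esub> g"
  proof -
    have "0 + f \<in> J +>\<^bsub>ring_of_type_algebra\<^esub> f" unfolding coset using idl.subspace_0[OF J] by blast
    then have "0 + f \<in> J +>\<^bsub>ring_of_type_algebra\<^esub> g" using that by simp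
    then obtain j where "0 + f = j + g" "j \<in> J" unfolding coset by blast
    then show ?thesis by simp
  qed
  show "J +>\<^bsub>ring_of_type_algebra\<^esub> f = J +>\<^bsub>ring_of_type_algebra\<^esub> g" if fg: "f - g \<in> J"
  proof -
    have "j + f = (j + (f - g)) + g \<and> j + (f - g) \<in> J" "j + g = (j - (f - g)) + f \<and> j - (f - g) \<in> J" if "j \<in> J" for j
      using idl.subspace_add[OF J that fg] idl.subspace_diff[OF J that fg] by simp_all
    then show ?thesis unfolding coset by blast
  qed
qed

lemma coset_mult_type_algebra:
  fixes J :: "'a::comm_ring_1 set"
  assumes "is_ideal J"
  shows "(J +>\<^bsub>ring_of_type_algebra\<^esub> f) \<otimes>\<^bsub>ring_of_type_algebra Quot J\<^esub> (J +>\<^bsub>ring_of_type_algebra\<^esub> g)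
    = J +>\<^bsub>ring_of_type_algebra\<^esub> (f * g)"
proof -
  let ?R = "ring_of_type_algebra :: 'a ring"
  have "ideal J ?R" using assms by (simp add: ideal_type_algebra_iff)
  moreover have "f \<in> carrier ?R" "g \<in> carrier ?R" "f \<otimes>\<^bsub>?R\<^esub> g = f * g"
    by (simp_all add: ring_of_type_algebra_def)
  ultimately show ?thesis using ideal.rcoset_mult_add[of J ?R f g] by (simp add: FactRing_def)
qed

text \<open>
  Injectivity and surjectivity on cosets, expressed by representatives; the multiplication is additive, so injectivity
  is a statement about its kernel.
\<close>

lemma maximal_rank_iff:
  fixes J :: "('n::finite, 'k::field) mpoly set"
  assumes J: "is_ideal J" and l: "l \<in> graded_piece 1"
  shows "maximal_rank (\<lambda>a. (J +>\<^bsub>mpoly_ring\<^esub> l) \<otimes>\<^bsub>mpoly_ring Quot J\<^esub> a)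
      (quot_graded_piece J t) (quot_graded_piece J (t + 1)) \<longleftrightarrow>
    (\<forall>f\<in>graded_piece t. l * f \<in> J \<longrightarrow> f \<in> J) \<or>
    (\<forall>g\<in>graded_piece (t + 1). \<exists>f\<in>graded_piece t. g - l * f \<in> J)"
proof -
  let ?q = "\<lambda>f. J +>\<^bsub>mpoly_ring\<^esub> f" and ?h = "\<lambda>a. (J +>\<^bsub>mpoly_ring\<^esub> l) \<otimes>\<^bsub>mpoly_ring Quot J\<^esub> a"
  note eq = coset_type_algebra[OF J] and mult = coset_mult_type_algebra[OF J]
  have diff: "f - g \<in> graded_piece t" if "f \<in> graded_piece t" "g \<in> graded_piece t" for f g :: "('n, 'k) mpoly"
    using that by (auto simp: graded_piece_def in_keys_iff lookup_minus)
  have zero: "(0 :: ('n, 'k) mpoly) \<in> graded_piece t" by (simp add: graded_piece_def)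
  have prod: "l * f \<in> graded_piece (t + 1)" if "f \<in> graded_piece t" for f
  proof (clarsimp simp: graded_piece_def)
    fix m assume "m \<in> supp (l * f)"
    then obtain a b where "m = a + b" "a \<in> supp l" "b \<in> supp f" using keys_mult[of l f] by blast
    then show "int (total_deg m) = t + 1" using l that by (auto simp: graded_piece_def)
  qed
  have "inj_on ?h (quot_graded_piece J t) \<longleftrightarrow> (\<forall>f\<in>graded_piece t. l * f \<in> J \<longrightarrow> f \<in> J)"
  proof
    assume inj: "inj_on ?h (quot_graded_piece J t)"
    show "\<forall>f\<in>graded_piece t. l * f \<in> J \<longrightarrow> f \<in> J"
    proof (intro ballI impI)
      fix f assume f: "f \<in> graded_piece t" "l * f \<in> J"
      then have "?h (?q f) = ?h (?q 0)" unfolding mult eq by simp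
      then have "?q f = ?q 0"
        using inj_onD[OF inj] f(1) zero unfolding quot_graded_piece_def by blast
      then show "f \<in> J" unfolding eq by simp
    qed
  next
    assume *: "\<forall>f\<in>graded_piece t. l * f \<in> J \<longrightarrow> f \<in> J"
    show "inj_on ?h (quot_graded_piece J t)"
      unfolding quot_graded_piece_def
    proof (rule inj_onI, clarify)
      fix f g :: "('n, 'k) mpoly"
      assume fg: "f \<in> graded_piece t" "g \<in> graded_piece t" "?h (?q f) = ?h (?q g)"
      then have "l * (f - g) \<in> J" unfolding mult eq by (simp add: right_diff_distrib)
      then show "?q f = ?q g" unfolding eq using * diff[OF fg(1,2)] by blast
    qed
  qed
  moreover have "?h ` quot_graded_piece J t = quot_graded_piece J (t + 1) \<longleftrightarrow>
    (\<forall>g\<in>graded_piece (t + 1). \<exists>f\<in>graded_piece t. g - l * f \<in> J)"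
  proof -
    have im: "?h ` quot_graded_piece J t = (\<lambda>f. ?q (l * f)) ` graded_piece t"
      unfolding quot_graded_piece_def image_image mult ..
    have "(\<lambda>f. ?q (l * f)) ` graded_piece t \<subseteq> quot_graded_piece J (t + 1)"
      using prod unfolding quot_graded_piece_def by blast
    then have "?h ` quot_graded_piece J t = quot_graded_piece J (t + 1) \<longleftrightarrow>
        quot_graded_piece J (t + 1) \<subseteq> (\<lambda>f. ?q (l * f)) ` graded_piece t"
      unfolding im by (simp only: set_eq_subset simp_thms)
    also have "\<dots> \<longleftrightarrow> (\<forall>g\<in>graded_piece (t + 1). \<exists>f\<in>graded_piece t. ?q g = ?q (l * f))"
      unfolding quot_graded_piece_def image_subset_iff image_iff ..
    finally have "?h ` quot_graded_piece J t = quot_graded_piece J (t + 1) \<longleftrightarrow>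
        (\<forall>g\<in>graded_piece (t + 1). \<exists>f\<in>graded_piece t. ?q g = ?q (l * f))" .
    then show ?thesis unfolding eq .
  qed
  ultimately show ?thesis unfolding maximal_rank_def by blast
qed

section \<open>Generic linear forms\<close>

lemma zariski_open_nonvanishing: "zariski_open {c. eval_mpoly p c \<noteq> 0}"
  unfolding zariski_open_def by (intro exI[of _ "{p}"]) auto

text \<open>
  Join a point of \<open>U\<close> to a point where \<open>q\<close> does not vanish by a line. On the line, \<open>q\<close> and one of the polynomials that
  define the complement of \<open>U\<close> become nonzero polynomials in one variable, which have finitely many zeros.
\<close>

lemma zariski_open_dense:
  fixes U :: "('n::finite \<Rightarrow> 'k::field_char_0) set"
  assumes "zariski_open U" "U \<noteq> {}" and c2: "eval_mpoly q c2 \<noteq> 0"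
  shows "\<exists>c\<in>U. eval_mpoly q c \<noteq> 0"
proof -
  obtain S :: "('n, 'k) mpoly set" where S: "U = - {c. \<forall>p\<in>S. eval_mpoly p c = 0}"
    using assms(1) by (auto simp: zariski_open_def)
  then obtain c1 p where p: "p \<in> S" "eval_mpoly p c1 \<noteq> 0" using assms(2) by auto
  define line where "line r = (\<Sum>m\<in>supp r. smult (lkp r m) (\<Prod>i\<in>UNIV. [:c1 i, c2 i - c1 i:] ^ lkp m i))"
    for r :: "('n, 'k) mpoly"
  define pt where "pt x i = c1 i + x * (c2 i - c1 i)" for x i
  have line: "poly (line r) x = eval_mpoly r (pt x)" for r x
    by (simp add: line_def eval_mpoly_def pt_def poly_sum poly_prod)
  have "pt 0 = c1" "pt 1 = c2" by (simp_all add: pt_def fun_eq_iff)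
  then have "line p \<noteq> 0" "line q \<noteq> 0" using line[of p 0] line[of q 1] p(2) c2 by auto
  then have "finite {x. poly (line p * line q) x = 0}" by (intro poly_roots_finite) simp
  then obtain x where "poly (line p * line q) x \<noteq> 0"
    using infinite_UNIV_char_0[where 'a = 'k] by (metis (mono_tags, lifting) UNIV_I ex_new_if_finite mem_Collect_eq)
  then have "eval_mpoly p (pt x) \<noteq> 0" "eval_mpoly q (pt x) \<noteq> 0" by (simp_all add: line)
  then show ?thesis using S p(1) by (intro bexI[of _ "pt x"]) auto
qed

text \<open>
  It does not vanish at \<open>c\<close> exactly if the parameters \<open>s\<^sub>i = a\<^sub>i / c\<^sub>i\<close> are defined and distinct.
\<close>

definition discriminating :: "('n::finite \<Rightarrow> 'k::field) \<Rightarrow> ('n, 'k) mpoly" where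
  "discriminating a = (\<Prod>i\<in>UNIV. Var i) *
     (\<Prod>(i, j)\<in>{(i, j). i \<noteq> j}. Const (a i) * Var j - Const (a j) * Var i)"

lemma eval_discriminating:
  "eval_mpoly (discriminating a) c \<noteq> 0 \<longleftrightarrow> (\<forall>i. c i \<noteq> 0) \<and> (\<forall>i j. i \<noteq> j \<longrightarrow> a i * c j \<noteq> a j * c i)"
  by (auto simp: discriminating_def case_prod_unfold)

text \<open>
  Choose \<open>c\<^sub>i = a\<^sub>i / s\<^sub>i\<close> for distinct positive integers \<open>s\<^sub>i\<close>.
\<close>

lemma discriminating_nonzero:
  fixes a :: "'n::finite \<Rightarrow> 'k::field_char_0"
  assumes a: "\<And>i. a i \<noteq> 0"
  shows "\<exists>c. eval_mpoly (discriminating a) c \<noteq> 0"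
proof -
  obtain idx :: "'n \<Rightarrow> nat" where idx: "inj idx"
    using finite_imp_inj_to_nat_seg[of "UNIV :: 'n set"] by auto
  define s :: "'n \<Rightarrow> 'k" where "s i = of_nat (Suc (idx i))" for i
  have s: "s i \<noteq> 0" for i unfolding s_def of_nat_eq_0_iff by simp
  have "a i * (a j / s j) \<noteq> a j * (a i / s i)" if "i \<noteq> j" for i j
  proof -
    have "s i \<noteq> s j" unfolding s_def of_nat_eq_iff using idx that by (auto dest: injD)
    then show ?thesis using a[of i] a[of j] s[of i] s[of j] by (simp add: field_simps)
  qed
  then show ?thesis
    unfolding eval_discriminating using a s by (intro exI[of _ "\<lambda>i. a i / s i"]) auto
qed

lemma six_forms_of_discriminating:
  fixes a c :: "'n::{finite,linorder} \<Rightarrow> 'k::field_char_0"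
  assumes a: "\<And>i. a i \<noteq> 0" and "eval_mpoly (discriminating a) c \<noteq> 0" and n5: "CARD('n) = 5"
  shows "six_forms c (\<lambda>i. a i / c i)" and "six_forms.L c (\<lambda>i. a i / c i) = linear_form a"
proof -
  have c: "c i \<noteq> 0" "i \<noteq> j \<Longrightarrow> a i * c j \<noteq> a j * c i" for i j
    using assms(2) by (auto simp: eval_discriminating)
  have inj: "inj (\<lambda>i. a i / c i)"
  proof (rule injI, rule ccontr)
    fix i j assume "a i / c i = a j / c j" "i \<noteq> j"
    then show False using c(1)[of i] c(1)[of j] c(2)[of i j] by (simp add: field_simps)
  qed
  show six: "six_forms c (\<lambda>i. a i / c i)"
    by unfold_locales (use a c inj n5 in auto)
  show "six_forms.L c (\<lambda>i. a i / c i) = linear_form a"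
    unfolding six_forms.L_def[OF six] using c by simp
qed

context six_forms
begin

lemma forms_ideal_eq_genideal: "forms_ideal d = Idl\<^bsub>mpoly_ring\<^esub> (insert (L ^ d) (range (\<lambda>i. Var i ^ d)))"
  unfolding forms_ideal_def using in_powers_ideal_plus_form by blast

lemma is_ideal_forms_ideal: "is_ideal (forms_ideal d)"
  unfolding forms_ideal_eq_genideal genideal_type_algebra by (rule idl.subspace_span)

text \<open>
  For \<open>t \<ge> 0\<close> either \<open>t \<le> 2 d - 3\<close>, and the multiplication is injective, or \<open>t \<ge> 2 d - 2\<close>, and it is surjective; for
  \<open>t < 0\<close> the source is zero.
\<close>

lemma maximal_rank_small:
  assumes d: "d \<in> {1, 2, 3}"
  shows "maximal_rank (\<lambda>a. (forms_ideal d +>\<^bsub>mpoly_ring\<^esub> ell) \<otimes>\<^bsub>mpoly_ring Quot forms_ideal d\<^esub> a)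
      (quot_graded_piece (forms_ideal d) t) (quot_graded_piece (forms_ideal d) (t + 1))"
proof -
  have ell: "ell \<in> graded_piece 1" using homog_ell by (simp add: homog_iff)
  consider "t < 0" | n where "t = int n" "n + 3 \<le> 2 * d" | n where "t = int n" "n + 1 \<ge> 2 * d - 1"
  proof (cases "t < 0")
    case False
    then obtain n where "t = int n" using nonneg_int_cases by (metis linorder_not_less)
    then show ?thesis using that(2,3)[of n] by linarith
  qed (use that in blast)
  then show ?thesis
  proof cases
    case 1
    have "f = 0" if "f \<in> graded_piece t" for f :: "('n, 'k) mpoly"
    proof -
      have "m \<notin> supp f" for m using that 1 by (auto simp: graded_piece_def)
      then show ?thesis by (intro poly_mapping_eqI) (simp add: in_keys_iff)
    qed
    then show ?thesis
      unfolding maximal_rank_iff[OF is_ideal_forms_ideal ell] using idl.subspace_0[OF is_ideal_forms_ideal] by auto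
  next
    case (2 n)
    then show ?thesis
      unfolding maximal_rank_iff[OF is_ideal_forms_ideal ell] using injective_small[OF d] by (auto simp: homog_iff)
  next
    case (3 n)
    have "\<exists>f\<in>graded_piece t. g - ell * f \<in> forms_ideal d" if "g \<in> graded_piece (t + 1)" for g
    proof -
      have g: "homog (n + 1) g" using that 3 by (simp add: homog_iff add.commute)
      obtain x h where xh: "g - L ^ d * x - ell * h \<in> powers_ideal d"
        using surjective_small[OF d g 3(2)] by (auto simp: section_ideal_def)
      have "\<exists>y. hom_part (n + 1) (L ^ d * x) = L ^ d * y"
      proof (cases "n + 1 < d")
        case True
        then show ?thesis using hom_part_mult_less[OF homog_L_power True, of x]
          by (intro exI[of _ 0]) (simp add: mult.commute)
      next
        case False
        then have "n + 1 = n + 1 - d + d" by simp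
        then show ?thesis using hom_part_mult[OF homog_L_power, of "n + 1 - d" d x] by (metis mult.commute)
      qed
      then obtain y where y: "hom_part (n + 1) (L ^ d * x) = L ^ d * y" by blast
      have e: "hom_part (n + 1) (ell * h) = ell * hom_part n h"
        using hom_part_mult[OF homog_ell, of n h] by (simp add: mult.commute)
      have "hom_part (n + 1) (g - L ^ d * x - ell * h) \<in> powers_ideal d"
        by (rule hom_part_powers_ideal[OF xh])
      then have "g - L ^ d * y - ell * hom_part n h \<in> powers_ideal d"
        unfolding hom_part_diff y e hom_part_homog[OF g] by simp
      then have "g - ell * hom_part n h \<in> forms_ideal d"
        unfolding forms_ideal_def by (intro CollectI exI[of _ y]) (simp add: algebra_simps)
      then show ?thesis using homog_hom_part[of n h] 3(1) by (auto simp: homog_iff)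
    qed
    then show ?thesis unfolding maximal_rank_iff[OF is_ideal_forms_ideal ell] by blast
  qed
qed

lemma not_maximal_rank_large:
  assumes d: "d \<ge> 4"
  shows "\<not> maximal_rank (\<lambda>a. (forms_ideal d +>\<^bsub>mpoly_ring\<^esub> ell) \<otimes>\<^bsub>mpoly_ring Quot forms_ideal d\<^esub> a)
      (quot_graded_piece (forms_ideal d) (int (2 * d - 2))) (quot_graded_piece (forms_ideal d) (int (2 * d - 2) + 1))"
proof -
  have ell: "ell \<in> graded_piece 1" using homog_ell by (simp add: homog_iff)
  have "d \<ge> 2" using d by simp
  then obtain f where f: "f \<in> graded_piece (int (2 * d - 2))" "ell * f \<in> forms_ideal d" "f \<notin> forms_ideal d"
    using not_injective by (auto simp: homog_iff)
  obtain g where g: "homog (2 * d - 1) g" "g \<notin> section_ideal d d" using not_surjective[OF d] by blast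
  have "int (2 * d - 1) = int (2 * d - 2) + 1" using d by simp
  then have g': "g \<in> graded_piece (int (2 * d - 2) + 1)" using g(1) by (simp only: homog_iff)
  have "g - ell * h \<notin> forms_ideal d" for h
  proof
    assume "g - ell * h \<in> forms_ideal d"
    then obtain x where "g - ell * h - L ^ d * x \<in> powers_ideal d" by (auto simp: forms_ideal_def)
    then have "g \<in> section_ideal d d"
      unfolding section_ideal_def by (intro CollectI exI[of _ x] exI[of _ h]) (simp add: algebra_simps)
    then show False using g(2) by simp
  qed
  then show ?thesis unfolding maximal_rank_iff[OF is_ideal_forms_ideal ell] using f g' by blast
qed

end

text \<open>
  The open condition on \<open>L\<close> is that all its coefficients are different from zero. Given such an \<open>L\<close>, the
  discriminating polynomial describes the linear forms \<open>ell\<close> to which the preceding analysis applies. They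
  form a nonempty open set, which suffices for the property to hold for small \<open>d\<close>, and which meets every
  other nonempty open set, so that the property fails for large \<open>d\<close>.
\<close>

theorem theorem4p1:
  fixes d :: nat
  assumes "d > 0"
  shows "for_general_linear_form
    (\<lambda>L :: (5, 'k::field_char_0) mpoly.
       \<not> WLP (Idl\<^bsub>mpoly_ring\<^esub> (insert (L ^ d) ((\<lambda>i. Var i ^ d) ` (UNIV :: 5 set)))) \<longleftrightarrow> d > 3)"
proof -
  have n5: "CARD(5) = 5" by simp
  let ?U = "{a :: 5 \<Rightarrow> 'k. eval_mpoly (\<Prod>i\<in>UNIV. Var i) a \<noteq> 0}"
  have main: "\<not> WLP (Idl\<^bsub>mpoly_ring\<^esub> (insert (linear_form a ^ d) (range (\<lambda>i. Var i ^ d)))) \<longleftrightarrow> d > 3"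
    if a: "\<And>i. a i \<noteq> 0" for a :: "5 \<Rightarrow> 'k"
  proof -
    let ?I = "Idl\<^bsub>mpoly_ring\<^esub> (insert (linear_form a ^ d) (range (\<lambda>i. Var i ^ d)))"
    let ?max = "\<lambda>c t. maximal_rank (\<lambda>x. (?I +>\<^bsub>mpoly_ring\<^esub> linear_form c) \<otimes>\<^bsub>mpoly_ring Quot ?I\<^esub> x)
         (quot_graded_piece ?I t) (quot_graded_piece ?I (t + 1))"
    let ?good = "\<lambda>c. eval_mpoly (discriminating a) c \<noteq> 0"
    have I: "six_forms.forms_ideal c (\<lambda>i. a i / c i) d = ?I" and ell: "six_forms.ell c = linear_form c" if "?good c" for c
    proof -
      interpret six_forms c "\<lambda>i. a i / c i" by (rule six_forms_of_discriminating(1)[OF a that n5])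
      show "forms_ideal d = ?I" unfolding forms_ideal_eq_genideal six_forms_of_discriminating(2)[OF a that n5] ..
      show "ell = linear_form c" by (rule ell_def)
    qed
    obtain c0 where c0: "?good c0" using discriminating_nonzero[of a] a by blast
    show ?thesis
    proof (cases "d > 3")
      case True
      have "\<not> WLP ?I"
      proof
        assume "WLP ?I"
        then obtain U where U: "zariski_open U" "U \<noteq> {}" "\<And>c t. c \<in> U \<Longrightarrow> ?max c t"
          unfolding WLP_def for_general_linear_form_def by blast
        obtain c where c: "c \<in> U" "?good c" using zariski_open_dense[OF U(1,2) c0] by blast
        have "d \<ge> 4" using True by simp
        from six_forms.not_maximal_rank_large[OF six_forms_of_discriminating(1)[OF a c(2) n5] this]
        show False unfolding I[OF c(2)] ell[OF c(2)] using U(3)[OF c(1)] by blast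
      qed
      then show ?thesis using True by simp
    next
      case False
      then have d: "d \<in> {1, 2, 3}" using assms by auto
      have "?max c t" if "?good c" for c t
        using six_forms.maximal_rank_small[OF six_forms_of_discriminating(1)[OF a that n5] d]
        unfolding I[OF that] ell[OF that] .
      then have "WLP ?I"
        unfolding WLP_def for_general_linear_form_def
        using zariski_open_nonvanishing[of "discriminating a"] c0
        by (intro exI[of _ "{c. ?good c}"]) auto
      then show ?thesis using False by simp
    qed
  qed
  show ?thesis
    unfolding for_general_linear_form_def
  proof (intro exI conjI ballI)
    show "zariski_open ?U" by (rule zariski_open_nonvanishing)
    have "(\<lambda>_. 1) \<in> ?U" by simp
    then show "?U \<noteq> {}" by blast
    show "\<not> WLP (Idl\<^bsub>mpoly_ring\<^esub> (insert (linear_form a ^ d) (range (\<lambda>i. Var i ^ d)))) \<longleftrightarrow> d > 3"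
      if "a \<in> ?U" for a
      by (rule main) (use that in simp)
  qed
qed

end
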